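(* Let $n\geq 1$. If $X$ is a Peano continuum, then $\mathbf{w}_n(X)$ is a compact metric space. Moreover, if $C$ is any compact metric space, then there exists a Peano continuum $X$ such that (1) $\mathbf{w}_n(X)=C$, (2) $X\setminus C$ is a countable disjoint union of open $1$-cells and open $n$-cells, (3) $\dim(X)=\max\{\dim(C),n\}$.
   Context: All spaces are Hausdorff and maps are continuous. A Peano continuum is a compact, connected, locally connected metric space. $\dim$ denotes Lebesgue covering dimension. An open $k$-cell is a space homeomorphic to $\mathbb{R}^k$. $S^n$ is the unit $n$-sphere with basepoint $s_0=(1,0,\dots,0)$; a map $S^n\to X$ is essential if it is not null-homotopic. The $n$-dimensional infinite earring $\mathbb{E}_n$ is the shrinking wedge of copies $S^n_j$ ($j\in\mathbb{N}$) of $S^n$: as a set it is the one-point union $\bigvee_{j}S^n_j$ with wedge point $b_0$; a set $U$ is open iff $U\cap S^n_j$ is open in $S^n_j$ for all $j$ and, whenever $b_0\in U$, $S^n_j\subseteq U$ for all but finitely many $j$. A map $f:\mathbb{E}_n\to X$ is fully essential if its restriction to $S^n_j$ is essential in $X$ for every $j$. A point $x\in X$ is a $\pi_n$-wild point if there is a fully essential map $f:(\mathbb{E}_n,b_0)\to(X,x)$; equivalently, there is a sequence of essential maps $(S^n,s_0)\to (X,x)$ such that every neighborhood of $x$ contains the images of all but finitely many of them. The $\pi_n$-wild set $\mathbf{w}_n(X)$ is the subspace of $X$ consisting of all $\pi_n$-wild points of $X$. *)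

theory Defs
  imports "HOL-Analysis.Analysis"
begin

definition peano_continuum :: "'a topology \<Rightarrow> bool" where
  "peano_continuum X \<longleftrightarrow>
     compact_space X \<and> connected_space X \<and> locally_connected_space X \<and> metrizable_space X"


subsection \<open>Essential maps of spheres\<close>

definition sphere_base :: "nat \<Rightarrow> real" where
  "sphere_base = (\<lambda>i. if i = 0 then 1 else 0)"

lemma sphere_base_in_nsphere: "sphere_base \<in> topspace (nsphere n)"
  unfolding sphere_base_def by (rule in_topspace_nsphere)

definition null_homotopic :: "'a topology \<Rightarrow> 'b topology \<Rightarrow> ('a \<Rightarrow> 'b) \<Rightarrow> bool" where
  "null_homotopic X Y f \<longleftrightarrow> (\<exists>c. homotopic_with (\<lambda>_. True) X Y f (\<lambda>_. c))"

definition essential :: "nat \<Rightarrow> 'a topology \<Rightarrow> ((nat \<Rightarrow> real) \<Rightarrow> 'a) \<Rightarrow> bool" where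
  "essential n X f \<longleftrightarrow>
     continuous_map (nsphere n) X f \<and> \<not> null_homotopic (nsphere n) X f"


subsection \<open>The infinite earring\<close>

text \<open>The one-point union of the spheres is encoded in an option type: \<^term>\<open>None\<close> is the wedge
  point, and \<open>Some (j, x)\<close> is the point \<open>x\<close> of the \<open>j\<close>-th sphere, for \<open>x\<close> different from the
  basepoint.\<close>

definition earring_incl :: "nat \<Rightarrow> (nat \<Rightarrow> real) \<Rightarrow> (nat \<times> (nat \<Rightarrow> real)) option" where
  "earring_incl j x = (if x = sphere_base then None else Some (j, x))"

definition earring_open :: "nat \<Rightarrow> (nat \<times> (nat \<Rightarrow> real)) option set \<Rightarrow> bool" where
  "earring_open n U \<longleftrightarrow>
     U \<subseteq> (\<Union>j. earring_incl j ` topspace (nsphere n)) \<and>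
     (\<forall>j. openin (nsphere n) {x \<in> topspace (nsphere n). earring_incl j x \<in> U}) \<and>
     (None \<in> U \<longrightarrow> finite {j. \<not> earring_incl j ` topspace (nsphere n) \<subseteq> U})"

definition earring :: "nat \<Rightarrow> (nat \<times> (nat \<Rightarrow> real)) option topology" where
  "earring n = topology (earring_open n)"

lemma istopology_earring_open: "istopology (earring_open n)"
  unfolding istopology_def
proof (intro conjI allI impI)
  fix S T assume S: "earring_open n S" and T: "earring_open n T"
  have "{x \<in> topspace (nsphere n). earring_incl j x \<in> S \<inter> T} =
      {x \<in> topspace (nsphere n). earring_incl j x \<in> S} \<inter>
      {x \<in> topspace (nsphere n). earring_incl j x \<in> T}" for j
    by blast
  moreover have "finite {j. \<not> earring_incl j ` topspace (nsphere n) \<subseteq> S \<inter> T}"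
    if "None \<in> S \<inter> T"
  proof (rule finite_subset)
    show "finite ({j. \<not> earring_incl j ` topspace (nsphere n) \<subseteq> S} \<union>
        {j. \<not> earring_incl j ` topspace (nsphere n) \<subseteq> T})"
      using S T that by (simp add: earring_open_def)
  qed blast
  ultimately show "earring_open n (S \<inter> T)"
    using S T unfolding earring_open_def by (auto intro: openin_Int)
next
  fix \<K> assume K: "\<forall>K\<in>\<K>. earring_open n K"
  have "openin (nsphere n) {x \<in> topspace (nsphere n). earring_incl j x \<in> \<Union>\<K>}" for j
  proof -
    have "{x \<in> topspace (nsphere n). earring_incl j x \<in> \<Union>\<K>} =
        (\<Union>K\<in>\<K>. {x \<in> topspace (nsphere n). earring_incl j x \<in> K})"
      by blast
    then show ?thesis
      using K by (auto simp: earring_open_def)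
  qed
  moreover have "finite {j. \<not> earring_incl j ` topspace (nsphere n) \<subseteq> \<Union>\<K>}"
    if "None \<in> \<Union>\<K>"
  proof -
    from that obtain K where "K \<in> \<K>" "None \<in> K" by blast
    then have "finite {j. \<not> earring_incl j ` topspace (nsphere n) \<subseteq> K}"
      using K by (simp add: earring_open_def)
    then show ?thesis
      by (rule rev_finite_subset) (use \<open>K \<in> \<K>\<close> in blast)
  qed
  moreover have "\<Union>\<K> \<subseteq> (\<Union>j. earring_incl j ` topspace (nsphere n))"
    using K unfolding earring_open_def by (meson Sup_least)
  ultimately show "earring_open n (\<Union>\<K>)"
    unfolding earring_open_def by blast
qed

lemma openin_earring: "openin (earring n) = earring_open n"
  unfolding earring_def by (rule topology_inverse'[OF istopology_earring_open])

lemma topspace_earring: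
  "topspace (earring n) = (\<Union>j. earring_incl j ` topspace (nsphere n))"
proof
  show "topspace (earring n) \<subseteq> (\<Union>j. earring_incl j ` topspace (nsphere n))"
    using openin_topspace[of "earring n"] by (simp add: openin_earring earring_open_def)
  have "{x \<in> topspace (nsphere n).
      earring_incl j x \<in> (\<Union>j. earring_incl j ` topspace (nsphere n))} = topspace (nsphere n)" for j
    by blast
  moreover have "{j. \<not> earring_incl j ` topspace (nsphere n) \<subseteq>
      (\<Union>j. earring_incl j ` topspace (nsphere n))} = {}"
    by blast
  ultimately have "openin (earring n) (\<Union>j. earring_incl j ` topspace (nsphere n))"
    unfolding openin_earring earring_open_def by simp
  then show "(\<Union>j. earring_incl j ` topspace (nsphere n)) \<subseteq> topspace (earring n)"
    by (rule openin_subset)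
qed

lemma continuous_map_earring_incl: "continuous_map (nsphere n) (earring n) (earring_incl j)"
  unfolding continuous_map_def by (auto simp: topspace_earring openin_earring earring_open_def)


subsection \<open>The wild set\<close>

definition fully_essential ::
    "nat \<Rightarrow> 'a topology \<Rightarrow> ((nat \<times> (nat \<Rightarrow> real)) option \<Rightarrow> 'a) \<Rightarrow> bool" where
  "fully_essential n X f \<longleftrightarrow>
     continuous_map (earring n) X f \<and> (\<forall>j. essential n X (f \<circ> earring_incl j))"

definition wild_point :: "nat \<Rightarrow> 'a topology \<Rightarrow> 'a \<Rightarrow> bool" where
  "wild_point n X x \<longleftrightarrow> x \<in> topspace X \<and> (\<exists>f. fully_essential n X f \<and> f None = x)"

definition wild_set :: "nat \<Rightarrow> 'a topology \<Rightarrow> 'a set" where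
  "wild_set n X = {x. wild_point n X x}"


subsection \<open>Lebesgue covering dimension\<close>

definition covering_dim_le :: "'a topology \<Rightarrow> int \<Rightarrow> bool" where
  "covering_dim_le X m \<longleftrightarrow>
     (\<forall>\<U>. (\<forall>U\<in>\<U>. openin X U) \<and> \<Union>\<U> = topspace X \<longrightarrow>
       (\<exists>\<V>. (\<forall>V\<in>\<V>. openin X V) \<and> \<Union>\<V> = topspace X \<and>
            (\<forall>V\<in>\<V>. \<exists>U\<in>\<U>. V \<subseteq> U) \<and>
            (\<forall>x\<in>topspace X. finite {V\<in>\<V>. x \<in> V} \<and> int (card {V\<in>\<V>. x \<in> V}) \<le> m + 1)))"

text \<open>The dimension of the empty space is \<open>-1\<close>, and it is \<open>\<infinity>\<close> (the infimum of the empty set)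
  if there is no bound.\<close>

definition covering_dim :: "'a topology \<Rightarrow> ereal" where
  "covering_dim X = Inf {ereal (real_of_int m) | m. -1 \<le> m \<and> covering_dim_le X m}"


subsection \<open>Disjoint unions of open cells\<close>

text \<open>The disjoint union is the topological one, so each cell is open in \<open>Y\<close>. Finite unions are
  included, as the index set is an arbitrary set of natural numbers.\<close>

definition countable_union_of_cells :: "nat set \<Rightarrow> 'a topology \<Rightarrow> bool" where
  "countable_union_of_cells D Y \<longleftrightarrow>
     (\<exists>(I :: nat set) k. (\<forall>i\<in>I. k i \<in> D) \<and>
        Y homeomorphic_space sum_topology (\<lambda>i. Euclidean_space (k i)) I)"

end

theory Submission
  imports Defs "HOL-Homology.Brouwer_Degree"
begin

text \<open>A Peano continuum is locally path connected, so an essential sphere at a wild point close to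
  \<open>x\<close> can be moved along a short path to \<open>x\<close>. Hence the wild set is closed. For the converse, embed
  \<open>C\<close> in the space of sequences and attach two null families of cells that leave it in additional
  coordinates: \<open>n\<close>-spheres at the points of a dense sequence, each of them infinitely often, and
  arcs between close points of successive finite nets. The arcs make the space connected and give
  it Sierpinski's property S. Every sphere is a retract, hence essential, so all points of the dense
  sequence are wild, whereas the open cells contain no wild point. Off a neighbourhood of \<open>C\<close> only
  finitely many cells remain, each meeting the rest in finitely many points, so that a refinement of
  small order on \<open>C\<close> extends to the whole space.\<close>

text \<open>A compact locally connected set yields chains of points at once, but not paths; a path
  is obtained as the uniform limit of step functions along ever finer chains whose lengths divide
  one another. The cells attached to C accumulate at C, so nothing can be settled cell by cell:
  compactness, property S and the dimension bound all rest on the diameters of the cells tending to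
  0, and the retraction onto a sphere is glued from two closed sets. That the remaining points of C
  become wild is the closedness from the first half, applied to X itself. The dimension formula
  needs both bounds for the sphere: the order n + 1 comes from the Kuhn triangulation, the lower
  bound from the identity not being null-homotopic. For empty C, claim (2) would force X, being
  compact and connected, to be empty, against claim (3); hence C is taken nonempty.\<close>

section \<open>Compact metrizable spaces as spaces of sequences\<close>

text \<open>The distances to the points of a countable dense set separate points; compactness turns
  the injective continuous map into an embedding.\<close>

lemma compact_metrizable_embedding:
  fixes X :: "'a topology"
  assumes "compact_space X" "metrizable_space X"
  obtains e :: "'a \<Rightarrow> nat \<Rightarrow> real" where "embedding_map X euclidean e"
proof -
  obtain M d where M: "Metric_space M d" and X: "X = Metric_space.mtopology M d"
    using assms(2) unfolding metrizable_space_def by blast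
  interpret Metric_space M d by (rule M)
  have tb: "mtotally_bounded M"
    using assms(1) by (metis X compact_space_eq_mcomplete_mtotally_bounded)
  have "\<exists>K. finite K \<and> K \<subseteq> M \<and> M \<subseteq> (\<Union>x\<in>K. mball x (inverse (Suc k)))" for k :: nat
    using tb by (simp add: mtotally_bounded_def del: of_nat_Suc)
  then have "\<exists>K. \<forall>k. finite (K k) \<and> K k \<subseteq> M \<and> M \<subseteq> (\<Union>x\<in>K k. mball x (inverse (real (Suc k))))"
    by (intro choice allI)
  then obtain K where K: "\<And>k. finite (K k)" "\<And>k. K k \<subseteq> M"
    "\<And>k. M \<subseteq> (\<Union>x\<in>K k. mball x (inverse (real (Suc k))))"
    by blast
  define D where "D = (\<Union>k. K k)"
  have D: "countable D" "D \<subseteq> M"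
    using K by (auto simp: D_def intro: countable_finite)
  \<comment> \<open>\<open>from_nat_into\<close> gives no point of the space when \<open>D\<close>
    is empty, that is, for empty \<open>X\<close>; the constant 0 covers that case.\<close>
  define e where "e = (\<lambda>x i. if D = {} then 0 else d x (from_nat_into D i))"
  have cont: "continuous_map X euclidean e"
  proof -
    have "continuous_map X euclideanreal (\<lambda>x. e x i)" for i
    proof (cases "D = {}")
      case False
      then have *: "from_nat_into D i \<in> M"
        using D(2) from_nat_into[OF False, of i] by auto
      have "continuous_map X euclideanreal (\<lambda>x. d x (from_nat_into D i))"
        using continuous_map_mdist[of X "metric (M, d)" "\<lambda>x. x" "\<lambda>x. from_nat_into D i"] *
        by (auto simp: X)
      then show ?thesis
        using False by (simp add: e_def)
    qed (simp add: e_def)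
    then show ?thesis
      by (simp add: continuous_map_componentwise_UNIV flip: euclidean_product_topology)
  qed
  have inj: "inj_on e (topspace X)"
  proof (rule inj_onI)
    fix x y assume xy: "x \<in> topspace X" "y \<in> topspace X" "e x = e y"
    then have M2: "x \<in> M" "y \<in> M" by (auto simp: X)
    show "x = y"
    proof (rule ccontr)
      assume "x \<noteq> y"
      then have "0 < d x y / 2" using M2 by simp
      \<comment> \<open>A net point whose distance to x is below half of \<open>d x y\<close> cannot
        be equidistant from x and y.\<close>
      then obtain k where k: "inverse (Suc k) < d x y / 2"
        using reals_Archimedean by blast
      obtain z where z: "z \<in> K k" "x \<in> mball z (inverse (Suc k))"
        using K(3)[of k] M2 by blast
      then have "z \<in> D" by (auto simp: D_def)
      then obtain i where i: "from_nat_into D i = z"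
        using D(1) by (metis from_nat_into_surj)
      have "d x z = d y z"
        using fun_cong[OF xy(3), of i] \<open>z \<in> D\<close> i by (auto simp: e_def split: if_splits)
      then have "d x y < d x y"
        using triangle[of x z y] z M2 k by (simp add: commute)
      then show False by simp
    qed
  qed
  show thesis
  proof
    show "embedding_map X euclidean e"
      using continuous_imp_closed_map[OF cont assms(1) Hausdorff_space_euclidean] cont inj
      by (simp add: injective_closed_imp_embedding_map)
  qed
qed

subsection \<open>Local path-connectedness of compact locally connected metric spaces\<close>

text \<open>The classical epsilon-chain. Connectedness yields such chains rather than paths; paths
  are obtained later as limits of them.\<close>

definition chained :: "'a::metric_space set \<Rightarrow> real \<Rightarrow> 'a \<Rightarrow> 'a \<Rightarrow> bool" where
  "chained S d x y \<longleftrightarrow> (\<exists>c m. c 0 = x \<and> c m = y \<and> (\<forall>i\<le>m. c i \<in> S) \<and> (\<forall>i<m. dist (c i) (c (Suc i)) < d))"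

lemma chained_step:
  assumes "chained S d x y" "z \<in> S" "dist y z < d"
  shows "chained S d x z"
proof -
  obtain c and m :: nat where c: "c 0 = x" "c m = y" "\<forall>i\<le>m. c i \<in> S" "\<forall>i<m. dist (c i) (c (Suc i)) < d"
    using assms(1) unfolding chained_def by blast
  have "(c(Suc m := z)) 0 = x" "(c(Suc m := z)) (Suc m) = z"
    "\<forall>i\<le>Suc m. (c(Suc m := z)) i \<in> S"
    "\<forall>i<Suc m. dist ((c(Suc m := z)) i) ((c(Suc m := z)) (Suc i)) < d"
    using c assms(2,3) by (auto simp: le_Suc_eq less_Suc_eq)
  then show ?thesis
    unfolding chained_def by blast
qed

text \<open>The points reachable from x form a clopen subset: a step shorter than d neither leaves
  it nor enters it from outside.\<close>

lemma connected_imp_chained: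
  fixes S :: "'a::metric_space set"
  assumes "connected S" "0 < d" "x \<in> S" "y \<in> S"
  shows "chained S d x y"
proof -
  define A where "A = {y \<in> S. chained S d x y}"
  have near: "z \<in> A" if "w \<in> A" "z \<in> S" "dist w z < d" for w z
    using that chained_step unfolding A_def by blast
  have "openin (top_of_set S) A"
    unfolding openin_contains_ball
    using near \<open>0 < d\<close> by (auto simp: A_def intro!: exI[of _ d])
  moreover have "openin (top_of_set S) (S - A)"
    unfolding openin_contains_ball
  proof (intro conjI ballI)
    fix z assume "z \<in> S - A"
    then have "w \<notin> A" if "w \<in> S" "dist z w < d" for w
      using near[of w z] that by (auto simp: dist_commute)
    then show "\<exists>e>0. ball z e \<inter> S \<subseteq> S - A"
      using \<open>0 < d\<close> by (intro exI[of _ d]) auto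
  qed auto
  ultimately have "A = {} \<or> A = S"
    using assms(1) by (auto simp: connected_clopen closedin_def A_def)
  moreover have "x \<in> A"
    using assms(3) by (auto simp: A_def chained_def intro!: exI[of _ "\<lambda>_. x"] exI[of _ 0])
  ultimately show ?thesis
    using assms(4) unfolding A_def by blast
qed

text \<open>A Lebesgue number of a cover by open sets with small connected traces makes the size d
  uniform over S.\<close>

lemma compact_uniformly_locally_connected:
  fixes S :: "'a::metric_space set"
  assumes "compact S" "locally_connected_space (top_of_set S)" "0 < e"
  obtains d where "0 < d"
    "\<And>x y. \<lbrakk>x \<in> S; y \<in> S; dist x y < d\<rbrakk> \<Longrightarrow> \<exists>A\<subseteq>S. connected A \<and> x \<in> A \<and> y \<in> A \<and> (\<forall>u\<in>A. \<forall>v\<in>A. dist u v < e)"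
proof -
  have "\<exists>V. open V \<and> x \<in> V \<and> connected (S \<inter> V) \<and> S \<inter> V \<subseteq> ball x (e/2)" if "x \<in> S" for x
  proof -
    have "openin (top_of_set S) (S \<inter> ball x (e/2))" by blast
    moreover have "x \<in> S \<inter> ball x (e/2)" using that assms(3) by simp
    ultimately obtain U where "openin (top_of_set S) U" "connectedin (top_of_set S) U" "x \<in> U" "U \<subseteq> S \<inter> ball x (e/2)"
      using assms(2) unfolding locally_connected_space by metis
    then show ?thesis
      by (auto simp: openin_open connectedin_subtopology)
  qed
  then obtain V where V: "\<And>x. x \<in> S \<Longrightarrow> open (V x)" "\<And>x. x \<in> S \<Longrightarrow> x \<in> V x"
    "\<And>x. x \<in> S \<Longrightarrow> connected (S \<inter> V x)" "\<And>x. x \<in> S \<Longrightarrow> S \<inter> V x \<subseteq> ball x (e/2)"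
    by metis
  obtain d where d: "0 < d" "\<And>x. x \<in> S \<Longrightarrow> \<exists>G\<in>V ` S. ball x d \<subseteq> G"
    using Heine_Borel_lemma[OF assms(1), of "V ` S"] V by blast
  show thesis
  proof
    fix x y assume xy: "x \<in> S" "y \<in> S" "dist x y < d"
    obtain z where z: "z \<in> S" "ball x d \<subseteq> V z" using d(2)[OF xy(1)] by blast
    have "dist u v < e" if "u \<in> S \<inter> V z" "v \<in> S \<inter> V z" for u v
    proof -
      have "dist z u < e/2" "dist z v < e/2" using V(4)[OF z(1)] that by auto
      then show ?thesis using dist_triangle_half_r by blast
    qed
    moreover have "x \<in> S \<inter> V z" "y \<in> S \<inter> V z" using z xy d(1) by auto
    ultimately show "\<exists>A\<subseteq>S. connected A \<and> x \<in> A \<and> y \<in> A \<and> (\<forall>u\<in>A. \<forall>v\<in>A. dist u v < e)"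
      using V(3)[OF z(1)] by (meson inf_le1)
  qed (rule d(1))
qed

text \<open>The refinements of the gaps are padded to a common length \<open>M\<close>.\<close>

lemma chain_refinement:
  fixes S :: "'a::metric_space set"
  assumes d: "\<And>x y. \<lbrakk>x \<in> S; y \<in> S; dist x y < d\<rbrakk> \<Longrightarrow> \<exists>A\<subseteq>S. connected A \<and> x \<in> A \<and> y \<in> A \<and> (\<forall>u\<in>A. \<forall>v\<in>A. dist u v < e)"
    and "0 < d'" and p: "\<And>i. i \<le> N \<Longrightarrow> p i \<in> S" "\<And>i. i < N \<Longrightarrow> dist (p i) (p (Suc i)) < d" and "0 < e"
  obtains M p' where "0 < M" "\<And>i. i \<le> N \<Longrightarrow> p' (i * M) = p i" "\<And>i. i \<le> N * M \<Longrightarrow> p' i \<in> S"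
    "\<And>i. i < N * M \<Longrightarrow> dist (p' i) (p' (Suc i)) < d'"
    "\<And>i. i \<le> N * M \<Longrightarrow> dist (p' i) (p (i div M)) < e"
proof -
  define P where "P i c m \<longleftrightarrow> c 0 = p i \<and> c m = p (Suc i) \<and> (\<forall>j\<le>m. c j \<in> S \<and> dist (c j) (p i) < e)
    \<and> (\<forall>j<m. dist (c j) (c (Suc j)) < d')" for i c and m :: nat
  have "\<exists>c m. P i c m" if i: "i < N" for i
  proof -
    obtain A where A: "A \<subseteq> S" "connected A" "p i \<in> A" "p (Suc i) \<in> A" "\<forall>u\<in>A. \<forall>v\<in>A. dist u v < e"
      using d[OF p(1) p(1) p(2), of i] i by auto
    then have "chained A d' (p i) (p (Suc i))"
      by (simp add: connected_imp_chained \<open>0 < d'\<close>)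
    then obtain c m where "c 0 = p i" "c m = p (Suc i)" "\<forall>i\<le>m. c i \<in> A" "\<forall>i<m. dist (c i) (c (Suc i)) < d'"
      unfolding chained_def by blast
    then have "P i c m"
      unfolding P_def using A by blast
    then show ?thesis by blast
  qed
  then obtain c m where P: "\<And>i. i < N \<Longrightarrow> P i (c i) (m i)"
    by metis
  have cm: "\<And>i. i < N \<Longrightarrow> c i 0 = p i" "\<And>i. i < N \<Longrightarrow> c i (m i) = p (Suc i)"
    "\<And>i j. i < N \<Longrightarrow> j \<le> m i \<Longrightarrow> c i j \<in> S \<and> dist (c i j) (p i) < e"
    "\<And>i j. i < N \<Longrightarrow> j < m i \<Longrightarrow> dist (c i j) (c i (Suc j)) < d'"
    using P unfolding P_def by blast+
  \<comment> \<open>The successor makes M exceed each \<open>m i\<close>, so the last index of every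
    block already holds the endpoint of that gap; it also keeps M positive for N = 0.\<close>
  define M where "M = Suc (\<Sum>i<N. m i)"
  have mM: "m i < M" if "i < N" for i
    using that member_le_sum[of i "{..<N}" m] by (simp add: M_def less_Suc_eq_le)
  \<comment> \<open>\<open>min\<close> holds the chain at its endpoint for the rest of its block; up
    to N * M the second branch is reached only at the index N * M.\<close>
  define p' where "p' = (\<lambda>i. if i div M < N then c (i div M) (min (i mod M) (m (i div M))) else p N)"
  have M: "0 < M" by (simp add: M_def)
  have big: "i = N * M" if "i \<le> N * M" "\<not> i div M < N" for i
  proof -
    have "N * M \<le> i div M * M" using that(2) by simp
    also have "\<dots> \<le> i" by simp
    finally show ?thesis using that(1) by simp
  qed
  show thesis
  proof
    show "0 < M" by (rule M)
    show "p' (i * M) = p i" if "i \<le> N" for i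
      using that cm(1) M by (auto simp: p'_def)
    show "p' i \<in> S" if "i \<le> N * M" for i
      using cm(3) p(1)[of N] by (auto simp: p'_def)
    show "dist (p' i) (p (i div M)) < e" if "i \<le> N * M" for i
      using cm(3) big[OF that] M \<open>0 < e\<close> by (auto simp: p'_def)
    show "dist (p' i) (p' (Suc i)) < d'" if "i < N * M" for i
    proof -
      have i: "i div M < N" using that by (simp add: less_mult_imp_div_less)
      show ?thesis
      proof (cases "Suc (i mod M) = M")
        case True
        then have S: "Suc i div M = Suc (i div M)" "Suc i mod M = 0"
          by (simp_all add: div_Suc mod_Suc)
        have "m (i div M) \<le> i mod M" using mM[OF i] True by linarith
        then have "p' i = p (Suc (i div M))"
          using i cm(2) by (simp add: p'_def min_absorb2)
        moreover have "p' (Suc i) = p (Suc (i div M))"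
          using i S cm(1)[of "Suc (i div M)"] by (cases "Suc (i div M) = N") (auto simp: p'_def)
        ultimately show ?thesis using \<open>0 < d'\<close> by simp
      next
        case False
        then have S: "Suc i div M = i div M" "Suc i mod M = Suc (i mod M)"
          by (simp_all add: div_Suc mod_Suc)
        show ?thesis
        proof (cases "i mod M < m (i div M)")
          case True
          then show ?thesis using i S cm(4)[OF i True] by (simp add: p'_def min_def)
        next
          case False
          then show ?thesis using i S \<open>0 < d'\<close> by (simp add: p'_def min_def)
        qed
      qed
    qed
  qed
qed

text \<open>Start with the two-point chain x, y and refine. Since each length divides the next, a
  parameter t picks out related members of consecutive chains, so the step functions
  \<open>f k\<close> converge uniformly. Their jumps are below \<open>\<delta> k\<close>, which
  tends to 0, so the limit is continuous.\<close>

lemma compact_locally_connected_imp_short_paths: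
  fixes S :: "'a::metric_space set"
  assumes S: "compact S" "locally_connected_space (top_of_set S)" and "0 < e"
  obtains d where "0 < d"
    "\<And>x y. \<lbrakk>x \<in> S; y \<in> S; dist x y < d\<rbrakk>
       \<Longrightarrow> \<exists>g. path g \<and> path_image g \<subseteq> S \<inter> ball x e \<and> pathstart g = x \<and> pathfinish g = y"
proof -
  \<comment> \<open>The ratio 1/2 makes the sum of the tail from k equal to 2 * \<open>r k\<close>,
    which the second fact states in telescoping form. With e/8 the path stays within
    \<open>r 0\<close> + 2 * \<open>r 0\<close> = 3e/8 of x.\<close>
  define r where "r = (\<lambda>k::nat. e/8 * (1/2)^k)"
  have r: "0 < r k" "r k = 2 * r k - 2 * r (Suc k)" for k
    using \<open>0 < e\<close> by (auto simp: r_def)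
  have "\<exists>d. 0 < d \<and> d \<le> r k \<and> (\<forall>x\<in>S. \<forall>y\<in>S. dist x y < d \<longrightarrow>
      (\<exists>A\<subseteq>S. connected A \<and> x \<in> A \<and> y \<in> A \<and> (\<forall>u\<in>A. \<forall>v\<in>A. dist u v < r k)))" for k
  proof -
    obtain d where "0 < d" "\<And>x y. \<lbrakk>x \<in> S; y \<in> S; dist x y < d\<rbrakk> \<Longrightarrow>
       \<exists>A\<subseteq>S. connected A \<and> x \<in> A \<and> y \<in> A \<and> (\<forall>u\<in>A. \<forall>v\<in>A. dist u v < r k)"
      by (rule compact_uniformly_locally_connected[OF S r(1)]) blast
    then show ?thesis
      using r(1)[of k] by (intro exI[of _ "min d (r k)"]) auto
  qed
  then obtain \<delta> where \<delta>: "\<And>k. 0 < \<delta> k" "\<And>k. \<delta> k \<le> r k"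
    "\<And>k x y. \<lbrakk>x \<in> S; y \<in> S; dist x y < \<delta> k\<rbrakk> \<Longrightarrow>
      \<exists>A\<subseteq>S. connected A \<and> x \<in> A \<and> y \<in> A \<and> (\<forall>u\<in>A. \<forall>v\<in>A. dist u v < r k)"
    by metis
  show thesis
  proof
    show "0 < \<delta> 0" by (rule \<delta>(1))
    fix x y assume xy: "x \<in> S" "y \<in> S" "dist x y < \<delta> 0"
    define P where "P k s \<longleftrightarrow> 0 < fst s \<and> (\<forall>i\<le>fst s. snd s i \<in> S) \<and>
      (\<forall>i<fst s. dist (snd s i) (snd s (Suc i)) < \<delta> k) \<and> snd s 0 = x \<and> snd s (fst s) = y"
      for k and s :: "nat \<times> (nat \<Rightarrow> 'a)"
    define Q where "Q k s s' \<longleftrightarrow> (\<exists>M>0. fst s' = fst s * M \<and> (\<forall>j\<le>fst s'. dist (snd s' j) (snd s (j div M)) < r k))"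
      for k and s s' :: "nat \<times> (nat \<Rightarrow> 'a)"
    have base: "P 0 (1, \<lambda>i. if i = 0 then x else y)"
      using xy by (auto simp: P_def)
    have step: "\<exists>s'. P (Suc k) s' \<and> Q k s s'" if Ps: "P k s" for k s
    proof -
      obtain N p where s: "s = (N, p)" by fastforce
      have p: "0 < N" "\<And>i. i \<le> N \<Longrightarrow> p i \<in> S" "\<And>i. i < N \<Longrightarrow> dist (p i) (p (Suc i)) < \<delta> k" "p 0 = x" "p N = y"
        using Ps by (auto simp: P_def s)
      obtain M p' where "0 < M" "\<And>i. i \<le> N \<Longrightarrow> p' (i * M) = p i" "\<And>i. i \<le> N * M \<Longrightarrow> p' i \<in> S"
        "\<And>i. i < N * M \<Longrightarrow> dist (p' i) (p' (Suc i)) < \<delta> (Suc k)"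
        "\<And>i. i \<le> N * M \<Longrightarrow> dist (p' i) (p (i div M)) < r k"
        by (rule chain_refinement[of S "\<delta> k" "r k" "\<delta> (Suc k)" N p,
                OF \<delta>(3)[where k = k] \<delta>(1)[of "Suc k"] p(2) p(3) r(1)[of k]]) blast+
      moreover from this(2)[of 0] this(2)[of N] have "p' 0 = x" "p' (N * M) = y"
        using p by auto
      ultimately have "P (Suc k) (N * M, p') \<and> Q k s (N * M, p')"
        using p(1) by (auto simp: P_def Q_def s)
      then show ?thesis by blast
    qed
    obtain s where s: "\<And>k. P k (s k)" "\<And>k. Q k (s k) (s (Suc k))" and s0: "fst (s 0) = 1"
    proof -
      \<comment> \<open>The single link of the initial chain is carried through the choice, because
        it forces \<open>f 0\<close> to take only the values x and y.\<close>
      have "\<exists>s. \<forall>k. (P k (s k) \<and> (k = 0 \<longrightarrow> fst (s k) = 1)) \<and> Q k (s k) (s (Suc k))"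
        using base step by (intro dependent_nat_choice) fastforce+
      then show thesis using that by blast
    qed
    define N where "N = (\<lambda>k. fst (s k))"
    define p where "p = (\<lambda>k. snd (s k))"
    have N: "0 < N k" for k
      using s(1)[of k] by (simp add: P_def N_def)
    have pS: "p k i \<in> S" if "i \<le> N k" for k i
      using s(1)[of k] that by (simp add: P_def N_def p_def)
    have pd: "dist (p k i) (p k (Suc i)) < \<delta> k" if "i < N k" for k i
      using s(1)[of k] that by (simp add: P_def N_def p_def)
    have p0: "p k 0 = x" and pN: "p k (N k) = y" for k
      using s(1)[of k] by (simp_all add: P_def N_def p_def)
    define ix where "ix = (\<lambda>k t. nat \<lfloor>t * real (N k)\<rfloor>)"
    define f where "f = (\<lambda>k t. p k (ix k t))"
    have ix: "ix k t \<le> N k" if "t \<in> {0..1}" for k t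
    proof -
      have "t * real (N k) \<le> 1 * real (N k)"
        using that by (intro mult_right_mono) auto
      then have "\<lfloor>t * real (N k)\<rfloor> \<le> int (N k)"
        by linarith
      then show ?thesis by (simp add: ix_def)
    qed
    have fS: "f k t \<in> S" if "t \<in> {0..1}" for k t
      using pS[OF ix[OF that]] by (simp add: f_def)
    have f1: "dist (f k t) (f (Suc k) t) < r k" if t: "t \<in> {0..1}" for k t
    proof -
      obtain M where M: "0 < M" "N (Suc k) = N k * M" "\<forall>j\<le>N (Suc k). dist (p (Suc k) j) (p k (j div M)) < r k"
        using s(2)[of k] unfolding Q_def N_def p_def by blast
      \<comment> \<open>Rounding commutes with refinement: the block of t at the finer level lies in
        its block at the coarser one.\<close>
      have "\<lfloor>t * real (N k)\<rfloor> = \<lfloor>t * real (N (Suc k)) / real_of_int (int M)\<rfloor>"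
        using M by simp
      also have "\<dots> = \<lfloor>t * real (N (Suc k))\<rfloor> div int M"
        by (rule floor_divide_real_eq_div) simp
      finally have "ix (Suc k) t div M = ix k t"
        using t by (simp add: ix_def nat_div_distrib)
      then show ?thesis
        using M(3) ix[OF t, of "Suc k"] by (auto simp: f_def dist_commute)
    qed
    have fm: "dist (f k t) (f (k + m) t) \<le> 2 * r k - 2 * r (k + m)" if t: "t \<in> {0..1}" for k m t
    proof (induction m)
      case (Suc m)
      have "dist (f k t) (f (k + Suc m) t) \<le> dist (f k t) (f (k + m) t) + dist (f (k + m) t) (f (Suc (k + m)) t)"
        by (simp add: dist_triangle)
      then show ?case
        using Suc f1[OF t, of "k + m"] r(2)[of "k + m"] by simp
    qed simp
    have fm2: "dist (f k t) (f m t) \<le> 2 * r k" if t: "t \<in> {0..1}" "k \<le> m" for k m t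
      using fm[OF t(1), of k "m - k"] t(2) r(1)[of m] by simp
    have rlim: "r \<longlonglongrightarrow> 0"
      unfolding r_def by (intro tendsto_mult_right_zero LIMSEQ_power_zero) simp
    have small: "\<exists>k. r k < c" if "0 < c" for c
      using order_tendstoD(2)[OF rlim that] by (auto simp: eventually_sequentially)
    have "\<exists>l\<in>S. (\<lambda>k. f k t) \<longlonglongrightarrow> l" if t: "t \<in> {0..1}" for t
    proof -
      have "Cauchy (\<lambda>k. f k t)"
        unfolding Cauchy_altdef
      proof (intro allI impI)
        fix c :: real assume "0 < c"
        then obtain k where k: "r k < c/4" using small[of "c/4"] by auto
        have "dist (f m t) (f m' t) < c" if "k \<le> m" "k \<le> m'" for m m'
          using fm2[OF t that(1)] fm2[OF t that(2)] k dist_triangle3[of "f m t" "f m' t" "f k t"] \<open>0 < c\<close> by linarith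
        then show "\<exists>M. \<forall>m\<ge>M. \<forall>n>m. dist (f m t) (f n t) < c"
          by (meson le_trans less_imp_le)
      qed
      then show ?thesis
        using compact_imp_complete[OF S(1)] fS[OF t] by (meson complete_def)
    qed
    then obtain g where g: "\<And>t. t \<in> {0..1} \<Longrightarrow> g t \<in> S" "\<And>t. t \<in> {0..1} \<Longrightarrow> (\<lambda>k. f k t) \<longlonglongrightarrow> g t"
      by metis
    have fg: "dist (f k t) (g t) \<le> 2 * r k" if t: "t \<in> {0..1}" for k t
    proof (rule LIMSEQ_le_const2)
      show "(\<lambda>m. dist (f k t) (f m t)) \<longlonglongrightarrow> dist (f k t) (g t)"
        by (intro tendsto_intros g t)
      show "\<exists>n0. \<forall>m\<ge>n0. dist (f k t) (f m t) \<le> 2 * r k"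
        using fm2[OF t] by blast
    qed
    have jump: "dist (f k s) (f k t) < \<delta> k" if "s \<in> {0..1}" "t \<in> {0..1}" "s \<le> t" "t - s < 1 / N k" for k s t
    proof -
      have "(t - s) * real (N k) < 1"
        using that(4) N[of k] by (simp add: field_simps)
      then have "t * real (N k) < s * real (N k) + 1"
        by (simp add: algebra_simps)
      then have "\<lfloor>t * real (N k)\<rfloor> \<le> \<lfloor>s * real (N k)\<rfloor> + 1" "\<lfloor>s * real (N k)\<rfloor> \<le> \<lfloor>t * real (N k)\<rfloor>"
        using that(3) by (linarith, simp add: floor_mono mult_right_mono)
      moreover have "0 \<le> \<lfloor>s * real (N k)\<rfloor>"
        using that(1) by simp
      ultimately have "ix k t = ix k s \<or> ix k t = Suc (ix k s)"
        unfolding ix_def by linarith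
      then show ?thesis
        using pd[of "ix k s" k] ix[OF that(2), of k] \<delta>(1)[of k] by (auto simp: f_def)
    qed
    have "continuous_on {0..1} g"
      unfolding continuous_on_iff
    proof (intro ballI allI impI)
      fix t c :: real assume t: "t \<in> {0..1}" and "0 < c"
      then obtain k where k: "r k < c/5" using small[of "c/5"] by auto
      have "dist (g t') (g t) < c" if t': "t' \<in> {0..1}" "dist t' t < 1 / N k" for t'
      proof -
        have "dist (f k t') (f k t) < \<delta> k"
          using jump[of t t' k] jump[of t' t k] t t' by (cases "t \<le> t'") (auto simp: dist_real_def dist_commute)
        then have "dist (f k t') (f k t) < r k" using \<delta>(2)[of k] by linarith
        moreover have "dist (g t') (g t) \<le> dist (g t') (f k t') + dist (f k t') (f k t) + dist (f k t) (g t)"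
          using dist_triangle[of "g t'" "g t" "f k t'"] dist_triangle[of "f k t'" "g t" "f k t"] by linarith
        ultimately show ?thesis
          using fg[OF t, of k] fg[OF t'(1), of k] k by (simp add: dist_commute)
      qed
      then show "\<exists>d>0. \<forall>t'\<in>{0..1}. dist t' t < d \<longrightarrow> dist (g t') (g t) < c"
        using N[of k] by (intro exI[of _ "1 / N k"]) auto
    qed
    moreover have "g 0 = x"
      using g(2)[of 0] LIMSEQ_unique[of _ "g 0" x] p0 by (simp add: f_def ix_def)
    moreover have "g 1 = y"
      using g(2)[of 1] LIMSEQ_unique[of _ "g 1" y] pN by (simp add: f_def ix_def)
    moreover have "dist x (g t) < e" if t: "t \<in> {0..1}" for t
    proof -
      have "ix 0 t = 0 \<or> ix 0 t = N 0"
        using ix[OF t, of 0] s0 by (auto simp: N_def)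
      then have "f 0 t = x \<or> f 0 t = y"
        using p0[of 0] pN[of 0] by (auto simp: f_def)
      then have "dist x (f 0 t) \<le> r 0"
        using xy(3) \<delta>(2)[of 0] r(1)[of 0] by auto
      then show ?thesis
        using fg[OF t, of 0] dist_triangle[of x "g t" "f 0 t"] \<open>0 < e\<close> by (simp add: r_def)
    qed
    ultimately show "\<exists>g. path g \<and> path_image g \<subseteq> S \<inter> ball x e \<and> pathstart g = x \<and> pathfinish g = y"
      using g(1) by (intro exI[of _ g]) (auto simp: path_def path_image_def pathstart_def pathfinish_def)
  qed
qed

lemma compact_locally_connected_imp_locally_path_connected:
  fixes S :: "'a::metric_space set"
  assumes S: "compact S" "locally_connected_space (top_of_set S)"
  shows "locally_path_connected_space (top_of_set S)"
  unfolding locally_path_connected_space_im_kleinen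
proof (intro allI impI)
  fix V x assume V: "openin (top_of_set S) V \<and> x \<in> V"
  then obtain e where e: "0 < e" "S \<inter> ball x e \<subseteq> V"
    by (metis inf_commute openin_contains_ball)
  have x: "x \<in> S" using V openin_imp_subset by blast
  obtain d where d: "0 < d" "\<And>x y. \<lbrakk>x \<in> S; y \<in> S; dist x y < d\<rbrakk>
       \<Longrightarrow> \<exists>g. path g \<and> path_image g \<subseteq> S \<inter> ball x e \<and> pathstart g = x \<and> pathfinish g = y"
    using compact_locally_connected_imp_short_paths[OF S e(1)] by metis
  define U where "U = V \<inter> (S \<inter> ball x d)"
  have "openin (top_of_set S) U"
    using V unfolding U_def by blast
  moreover have "\<exists>C. path_connectedin (top_of_set S) C \<and> C \<subseteq> V \<and> x \<in> C \<and> y \<in> C" if y: "y \<in> U" for y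
  proof -
    have "y \<in> S" "dist x y < d" using y by (auto simp: U_def)
    then obtain g where g: "path g" "path_image g \<subseteq> S \<inter> ball x e" "pathstart g = x" "pathfinish g = y"
      using d(2)[OF x] by blast
    have "path_connectedin (top_of_set S) (path_image g)"
      using path_connected_path_image[OF g(1)] g(2) by (simp add: path_connectedin_subtopology)
    then show ?thesis
      using e(2) g pathstart_in_path_image[of g] pathfinish_in_path_image[of g] by (intro exI[of _ "path_image g"]) auto
  qed
  moreover have "x \<in> U" using V x d(1) by (auto simp: U_def)
  ultimately show "\<exists>U. openin (top_of_set S) U \<and> x \<in> U \<and> U \<subseteq> V \<and>
      (\<forall>y\<in>U. \<exists>C. path_connectedin (top_of_set S) C \<and> C \<subseteq> V \<and> x \<in> C \<and> y \<in> C)"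
    unfolding U_def by (intro exI[of _ "V \<inter> (S \<inter> ball x d)"]) blast
qed

lemma peano_continuum_imp_locally_path_connected:
  assumes "peano_continuum X"
  shows "locally_path_connected_space X"
proof -
  have X: "compact_space X" "metrizable_space X" "locally_connected_space X"
    using assms by (auto simp: peano_continuum_def)
  obtain e :: "'a \<Rightarrow> nat \<Rightarrow> real" where e: "embedding_map X euclidean e"
    using compact_metrizable_embedding[OF X(1,2)] by blast
  define S where "S = e ` topspace X"
  have hom: "X homeomorphic_space top_of_set S"
    using e embedding_map_imp_homeomorphic_space unfolding S_def by blast
  have "compact S"
    using X(1) hom homeomorphic_compact_space by (metis compact_space_subtopology compact_imp_compactin_subtopology compactin_euclidean_iff compact_space_def topspace_euclidean_subtopology compactin_subtopology)
  then show ?thesis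
    using compact_locally_connected_imp_locally_path_connected[of S]
      homeomorphic_locally_connected_space[OF hom] homeomorphic_locally_path_connected_space[OF hom] X(3)
    by blast
qed

subsection \<open>Maps into spheres\<close>

lemma topspace_nsphere: "topspace (nsphere n) = {x. (\<Sum>i\<le>n. (x i)\<^sup>2) = 1 \<and> (\<forall>i>n. x i = 0)}"
  by (simp add: nsphere)

definition sphere_normalize :: "nat \<Rightarrow> (nat \<Rightarrow> real) \<Rightarrow> nat \<Rightarrow> real" where
  "sphere_normalize n v = (\<lambda>i. if i \<le> n then v i / sqrt (\<Sum>j\<le>n. (v j)\<^sup>2) else 0)"

lemma sphere_normalize_in_nsphere:
  assumes "(\<Sum>j\<le>n. (v j)\<^sup>2) \<noteq> 0"
  shows "sphere_normalize n v \<in> topspace (nsphere n)"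
proof -
  have "0 \<le> (\<Sum>j\<le>n. (v j)\<^sup>2)" by (simp add: sum_nonneg)
  then have "(\<Sum>i\<le>n. (sphere_normalize n v i)\<^sup>2) = (\<Sum>i\<le>n. (v i)\<^sup>2 / (\<Sum>j\<le>n. (v j)\<^sup>2))"
    by (intro sum.cong) (auto simp: sphere_normalize_def power_divide)
  also have "\<dots> = 1"
    using assms by (simp flip: sum_divide_distrib)
  finally show ?thesis
    by (simp add: topspace_nsphere sphere_normalize_def)
qed

lemma sphere_normalize_id: "x \<in> topspace (nsphere n) \<Longrightarrow> sphere_normalize n x = x"
  by (auto simp: topspace_nsphere sphere_normalize_def fun_eq_iff)

lemma continuous_map_into_nsphere:
  "continuous_map X (nsphere n) f \<longleftrightarrow>
    (\<forall>i\<le>n. continuous_map X euclideanreal (\<lambda>x. f x i)) \<and> (\<forall>x\<in>topspace X. f x \<in> topspace (nsphere n))"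
  (is "?L \<longleftrightarrow> ?R")
proof
  assume L: ?L
  then show ?R
    using continuous_map_compose[OF L continuous_map_nsphere_projection]
    by (auto simp: o_def dest: continuous_map_image_subset_topspace)
next
  assume R: ?R
  have "continuous_map X euclideanreal (\<lambda>x. f x i)" for i
  proof (cases "i \<le> n")
    case False
    then have "\<forall>x\<in>topspace X. f x i = 0"
      using R by (simp add: topspace_nsphere)
    then show ?thesis
      using continuous_map_eq[of X euclideanreal "\<lambda>_. 0" "\<lambda>x. f x i"] by simp
  qed (use R in auto)
  then show ?L
    using R by (simp add: nsphere continuous_map_in_subtopology continuous_map_componentwise_UNIV Pi_iff)
qed

lemma continuous_map_sphere_normalize:
  assumes "\<And>i. i \<le> n \<Longrightarrow> continuous_map X euclideanreal (\<lambda>x. F x i)"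
    and "\<And>x. x \<in> topspace X \<Longrightarrow> (\<Sum>j\<le>n. (F x j)\<^sup>2) \<noteq> 0"
  shows "continuous_map X (nsphere n) (\<lambda>x. sphere_normalize n (F x))"
  unfolding continuous_map_into_nsphere
proof (intro conjI allI impI ballI sphere_normalize_in_nsphere assms)
  fix i assume i: "i \<le> n"
  have "continuous_map X euclideanreal (\<lambda>x. F x i / sqrt (\<Sum>j\<le>n. (F x j)\<^sup>2))"
    using assms i by (intro continuous_intros) auto
  then show "continuous_map X euclideanreal (\<lambda>x. sphere_normalize n (F x) i)"
    using i by (simp add: sphere_normalize_def)
qed

text \<open>If the segment from F x to G x passed through 0, pairing that point with F x would give
  a vanishing sum of nonnegative terms, hence t = 0 and F x = 0, against the positive inner
  product.\<close>

lemma homotopic_sphere_normalize: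
  assumes F: "\<And>i. i \<le> n \<Longrightarrow> continuous_map X euclideanreal (\<lambda>x. F x i)"
    and G: "\<And>i. i \<le> n \<Longrightarrow> continuous_map X euclideanreal (\<lambda>x. G x i)"
    and pos: "\<And>x. x \<in> topspace X \<Longrightarrow> 0 < (\<Sum>i\<le>n. F x i * G x i)"
  shows "homotopic_with (\<lambda>_. True) X (nsphere n) (\<lambda>x. sphere_normalize n (F x)) (\<lambda>x. sphere_normalize n (G x))"
proof -
  let ?P = "prod_topology (top_of_set {0..1::real}) X"
  define H where "H = (\<lambda>(t::real, x) i. (1 - t) * F x i + t * G x i)"
  have "continuous_map ?P (nsphere n) (\<lambda>z. sphere_normalize n (H z))"
  proof (rule continuous_map_sphere_normalize)
    fix i assume i: "i \<le> n"
    have t: "continuous_map ?P euclideanreal fst"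
      using continuous_map_fst continuous_map_into_fulltopology by blast
    have "continuous_map ?P euclideanreal (\<lambda>z. F (snd z) i)" "continuous_map ?P euclideanreal (\<lambda>z. G (snd z) i)"
      using continuous_map_compose[OF continuous_map_snd F[OF i]] continuous_map_compose[OF continuous_map_snd G[OF i]]
      by (auto simp: o_def)
    then show "continuous_map ?P euclideanreal (\<lambda>z. H z i)"
      unfolding H_def case_prod_unfold using t by (intro continuous_intros)
  next
    fix z assume z: "z \<in> topspace ?P"
    obtain t x where tx: "z = (t, x)" "0 \<le> t" "t \<le> 1" "x \<in> topspace X" using z by auto
    show "(\<Sum>j\<le>n. (H z j)\<^sup>2) \<noteq> 0"
    proof
      assume "(\<Sum>j\<le>n. (H z j)\<^sup>2) = 0"
      then have "H z j = 0" if "j \<le> n" for j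
        using that by (simp add: sum_nonneg_eq_0_iff)
      then have *: "(1 - t) * F x j + t * G x j = 0" if "j \<le> n" for j
        using that by (simp add: H_def tx)
      have "0 = (\<Sum>j\<le>n. ((1 - t) * F x j + t * G x j) * F x j)"
        using * by simp
      also have "\<dots> = (1 - t) * (\<Sum>j\<le>n. (F x j)\<^sup>2) + t * (\<Sum>j\<le>n. F x j * G x j)"
        by (simp add: sum_distrib_left algebra_simps power2_eq_square flip: sum.distrib)
      finally have 0: "0 = (1 - t) * (\<Sum>j\<le>n. (F x j)\<^sup>2) + t * (\<Sum>j\<le>n. F x j * G x j)" .
      have "0 \<le> (1 - t) * (\<Sum>j\<le>n. (F x j)\<^sup>2)" "0 \<le> t * (\<Sum>j\<le>n. F x j * G x j)"
        using tx pos[OF tx(4)] by (auto intro!: mult_nonneg_nonneg sum_nonneg)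
      then have "t * (\<Sum>j\<le>n. F x j * G x j) = 0" using 0 by linarith
      then have "t = 0" using pos[OF tx(4)] by auto
      then have "\<And>j. j \<le> n \<Longrightarrow> F x j = 0" using * by simp
      then show False using pos[OF tx(4)] by simp
    qed
  qed
  then show ?thesis
    unfolding homotopic_with_def by (intro exI[of _ "\<lambda>z. sphere_normalize n (H z)"]) (auto simp: H_def)
qed

text \<open>The homotopy extension property of the pair of the sphere and its basepoint: the cap
  \<open>x 0 \<ge> 1/2\<close> is first collapsed to the basepoint and then used to run along the path.\<close>

lemma move_basepoint:
  assumes g: "continuous_map (nsphere n) X g" and \<gamma>: "pathin X \<gamma>" "\<gamma> 0 = g sphere_base"
  obtains g' where "continuous_map (nsphere n) X g'" "g' sphere_base = \<gamma> 1"
    "g' ` topspace (nsphere n) \<subseteq> g ` topspace (nsphere n) \<union> \<gamma> ` {0..1}"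
    "homotopic_with (\<lambda>_. True) (nsphere n) X g g'"
proof -
  let ?S = "nsphere n"
  let ?P = "prod_topology (top_of_set {0..1::real}) ?S"
  have proj: "continuous_map ?S euclideanreal (\<lambda>x. x i)" for i
    by (rule continuous_map_nsphere_projection)
  \<comment> \<open>Damping the other coordinates sends the cap to the positive first axis, while F
    x keeps a positive inner product with x; so normalizing gives a self-map homotopic to the
    identity.\<close>
  define F where "F = (\<lambda>(x :: nat \<Rightarrow> real) i. if i = 0 then x 0 else max 0 (1/2 - x 0) * x i)"
  have F: "continuous_map ?S euclideanreal (\<lambda>x. F x i)" for i
    using proj unfolding F_def by (cases "i = 0") (auto intro!: continuous_intros)
  have pos: "0 < (\<Sum>i\<le>n. F x i * x i)" if x: "x \<in> topspace ?S" for x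
  proof -
    have nn: "0 \<le> F x i * x i" for i
    proof -
      have "F x i * x i = (if i = 0 then (x 0)\<^sup>2 else max 0 (1/2 - x 0) * (x i)\<^sup>2)"
        by (simp add: F_def power2_eq_square)
      then show ?thesis by simp
    qed
    have "\<exists>i\<le>n. 0 < F x i * x i"
    proof (cases "x 0 = 0")
      case False
      then show ?thesis by (intro exI[of _ 0]) (simp add: F_def flip: power2_eq_square)
    next
      case True
      have "\<exists>i\<le>n. x i \<noteq> 0"
      proof (rule ccontr)
        assume "\<not> (\<exists>i\<le>n. x i \<noteq> 0)"
        then have "(\<Sum>i\<le>n. (x i)\<^sup>2) = 0" by simp
        then show False using x by (simp add: topspace_nsphere)
      qed
      then obtain i where i: "i \<le> n" "x i \<noteq> 0" by blast
      then have "F x i * x i = 1/2 * (x i)\<^sup>2"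
        using True by (cases "i = 0") (simp_all add: F_def power2_eq_square)
      moreover have "0 < 1/2 * (x i)\<^sup>2" using i by simp
      ultimately show ?thesis
        using i(1) by (intro exI[of _ i]) linarith
    qed
    then obtain i where "i \<le> n" "0 < F x i * x i" by blast
    then show ?thesis
      using nn by (intro sum_pos2[of "{..n}" i]) auto
  qed
  define \<phi> where "\<phi> = (\<lambda>x. sphere_normalize n (F x))"
  have hom: "homotopic_with (\<lambda>_. True) ?S ?S (\<lambda>x. sphere_normalize n x) \<phi>"
    unfolding \<phi>_def using pos by (intro homotopic_sphere_normalize proj F) (simp add: mult.commute)
  have hom: "homotopic_with (\<lambda>_. True) ?S ?S id \<phi>"
    by (rule homotopic_with_eq[OF hom]) (auto simp: sphere_normalize_id)
  have hom1: "homotopic_with (\<lambda>_. True) ?S X g (g \<circ> \<phi>)"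
    using homotopic_with_compose_continuous_map_left[OF hom g] by simp
  have \<phi>: "continuous_map ?S ?S \<phi>"
    using hom homotopic_with_imp_continuous_maps by blast
  have half: "\<phi> x = sphere_base" if x: "x 0 \<ge> 1/2" for x
  proof -
    have "F x i = (if i = 0 then x 0 else 0)" for i
      using x by (simp add: F_def)
    then have Fx: "F x = (\<lambda>i. if i = 0 then x 0 else 0)" by auto
    have "(\<Sum>j\<le>n. (F x j)\<^sup>2) = (\<Sum>j\<le>n. if j = 0 then (x 0)\<^sup>2 else 0)"
      by (intro sum.cong) (auto simp: Fx)
    also have "\<dots> = (x 0)\<^sup>2" by simp
    finally show ?thesis
      using x by (auto simp: \<phi>_def sphere_normalize_def fun_eq_iff Fx sphere_base_def)
  qed
  \<comment> \<open>Clamping extends the path to the whole line, so that continuity of H can be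
    checked without bounds on its argument.\<close>
  define \<gamma>' where "\<gamma>' = (\<lambda>t. \<gamma> (max 0 (min 1 t)))"
  have \<gamma>': "continuous_map euclideanreal X \<gamma>'"
  proof -
    have "continuous_map euclideanreal (top_of_set {0..1}) (\<lambda>t::real. max 0 (min 1 t))"
      by (auto simp: continuous_map_in_subtopology intro!: continuous_intros)
    then show ?thesis
      using \<gamma>(1) continuous_map_compose unfolding \<gamma>'_def pathin_def o_def by fastforce
  qed
  \<comment> \<open>On the cap, 2 * x 0 - 1 grows from 0 at the rim to 1 at the basepoint, so at
    time t the cap traces the path up to time t.\<close>
  define H where "H = (\<lambda>z::real \<times> (nat \<Rightarrow> real). if snd z 0 \<le> 1/2 then (g \<circ> \<phi>) (snd z) else \<gamma>' (fst z * (2 * snd z 0 - 1)))"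
  have "continuous_map ?P X H"
    unfolding H_def
  proof (rule continuous_map_cases_le)
    show c0: "continuous_map ?P euclideanreal (\<lambda>z. snd z 0)"
      using continuous_map_compose[OF continuous_map_snd proj] by (simp add: o_def)
    show "continuous_map (subtopology ?P {x \<in> topspace ?P. snd x 0 \<le> 1/2}) X (\<lambda>z. (g \<circ> \<phi>) (snd z))"
      using continuous_map_compose[OF continuous_map_snd continuous_map_compose[OF \<phi> g]]
      by (intro continuous_map_from_subtopology) (simp add: o_def)
    have "continuous_map ?P euclideanreal fst"
      using continuous_map_fst continuous_map_into_fulltopology by blast
    then have "continuous_map ?P euclideanreal (\<lambda>z. fst z * (2 * snd z 0 - 1))"
      using c0 by (intro continuous_intros) auto
    then show "continuous_map (subtopology ?P {x \<in> topspace ?P. 1/2 \<le> snd x 0}) X (\<lambda>z. \<gamma>' (fst z * (2 * snd z 0 - 1)))"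
      using continuous_map_compose[OF _ \<gamma>'] by (intro continuous_map_from_subtopology) (simp add: o_def)
    show "(g \<circ> \<phi>) (snd z) = \<gamma>' (fst z * (2 * snd z 0 - 1))" if "z \<in> topspace ?P" "snd z 0 = 1/2" for z
    proof -
      have 0: "fst z * (2 * snd z 0 - 1) = 0" using that(2) by simp
      show ?thesis
        unfolding 0 using half[of "snd z"] that(2) \<gamma>(2) by (simp add: \<gamma>'_def)
    qed
  qed auto
  then have "homotopic_with (\<lambda>_. True) ?S X (\<lambda>x. H (0, x)) (\<lambda>x. H (1, x))"
    unfolding homotopic_with_def by auto
  moreover have "H (0, x) = (g \<circ> \<phi>) x" for x
    using half[of x] \<gamma>(2) by (auto simp: H_def \<gamma>'_def)
  ultimately have hom2: "homotopic_with (\<lambda>_. True) ?S X (g \<circ> \<phi>) (\<lambda>x. H (1, x))"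
    by (simp add: o_def)
  show thesis
  proof
    show "homotopic_with (\<lambda>_. True) ?S X g (\<lambda>x. H (1, x))"
      using hom1 hom2 homotopic_with_trans by blast
    then show "continuous_map ?S X (\<lambda>x. H (1, x))"
      using homotopic_with_imp_continuous_maps by blast
    show "H (1, sphere_base) = \<gamma> 1"
      by (simp add: H_def sphere_base_def \<gamma>'_def)
    show "(\<lambda>x. H (1, x)) ` topspace ?S \<subseteq> g ` topspace ?S \<union> \<gamma> ` {0..1}"
      using \<phi> by (auto simp: H_def \<gamma>'_def continuous_map_def image_iff)
  qed
qed

subsection \<open>The wild set is closed\<close>

text \<open>The finiteness hypothesis is the neighbourhood condition at the wedge point, so the maps
  glue to a continuous map of the earring.\<close>

lemma wild_pointI:
  fixes g :: "nat \<Rightarrow> (nat \<Rightarrow> real) \<Rightarrow> 'a"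
  assumes "x \<in> topspace X" "\<And>j. essential n X (g j)" "\<And>j. g j sphere_base = x"
    and fin: "\<And>U. \<lbrakk>openin X U; x \<in> U\<rbrakk> \<Longrightarrow> finite {j. \<not> g j ` topspace (nsphere n) \<subseteq> U}"
  shows "wild_point n X x"
proof -
  define f where "f = (\<lambda>p :: (nat \<times> (nat \<Rightarrow> real)) option. case p of None \<Rightarrow> x | Some (j, y) \<Rightarrow> g j y)"
  have f: "f (earring_incl j y) = g j y" for j y
    using assms(3) by (simp add: f_def earring_incl_def)
  have g: "continuous_map (nsphere n) X (g j)" for j
    using assms(2) by (simp add: essential_def)
  have "continuous_map (earring n) X f"
    unfolding continuous_map_def
  proof (intro conjI allI impI)
    show "f \<in> topspace (earring n) \<rightarrow> topspace X"
    proof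
      fix p assume "p \<in> topspace (earring n)"
      then obtain j y where "y \<in> topspace (nsphere n)" "p = earring_incl j y"
        by (auto simp: topspace_earring)
      then show "f p \<in> topspace X"
        using continuous_map_image_subset_topspace[OF g[of j]] by (auto simp: f)
    qed
    fix U assume U: "openin X U"
    let ?V = "{p \<in> topspace (earring n). f p \<in> U}"
    have V: "earring_incl j y \<in> ?V \<longleftrightarrow> g j y \<in> U" if "y \<in> topspace (nsphere n)" for j y
      using that by (auto simp: topspace_earring f)
    then have "{y \<in> topspace (nsphere n). earring_incl j y \<in> ?V} = {y \<in> topspace (nsphere n). g j y \<in> U}" for j
      by blast
    then have "\<forall>j. openin (nsphere n) {y \<in> topspace (nsphere n). earring_incl j y \<in> ?V}"
      using g U by (simp add: continuous_map_def)
    moreover have "finite {j. \<not> earring_incl j ` topspace (nsphere n) \<subseteq> ?V}" if "None \<in> ?V"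
    proof -
      have "x \<in> U" using that by (simp add: f_def)
      moreover have "{j. \<not> earring_incl j ` topspace (nsphere n) \<subseteq> ?V} = {j. \<not> g j ` topspace (nsphere n) \<subseteq> U}"
        using V by (auto simp: image_subset_iff)
      ultimately show ?thesis using fin[OF U] by simp
    qed
    ultimately show "openin (earring n) ?V"
      unfolding openin_earring earring_open_def by (auto simp: topspace_earring)
  qed
  moreover have "f \<circ> earring_incl j = g j" for j
    using f by auto
  moreover have "f None = x" by (simp add: f_def)
  ultimately show ?thesis
    using assms(1,2) unfolding wild_point_def fully_essential_def by auto
qed

text \<open>The preimage of U contains all but finitely many of infinitely many spheres, hence at
  least one.\<close>

lemma wild_pointD:
  assumes "wild_point n X x" "openin X U" "x \<in> U"
  obtains g where "essential n X g" "g sphere_base = x" "g ` topspace (nsphere n) \<subseteq> U"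
proof -
  obtain f where f: "continuous_map (earring n) X f" "\<And>j. essential n X (f \<circ> earring_incl j)" "f None = x"
    using assms(1) unfolding wild_point_def fully_essential_def by blast
  let ?V = "{p \<in> topspace (earring n). f p \<in> U}"
  have "openin (earring n) ?V"
    using f(1) assms(2) by (simp add: continuous_map_def)
  moreover have "None \<in> topspace (earring n)"
    using sphere_base_in_nsphere[of n] by (force simp: topspace_earring earring_incl_def)
  ultimately have "finite {j. \<not> earring_incl j ` topspace (nsphere n) \<subseteq> ?V}"
    using f(3) assms(3) by (simp add: openin_earring earring_open_def)
  then obtain j where "earring_incl j ` topspace (nsphere n) \<subseteq> ?V"
    using infinite_UNIV_nat by (metis (mono_tags, lifting) UNIV_eq_I mem_Collect_eq)
  then show thesis
    using f by (intro that[of "f \<circ> earring_incl j"]) (auto simp: image_subset_iff earring_incl_def[of j sphere_base])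
qed

lemma null_homotopic_homotopic:
  assumes "homotopic_with (\<lambda>_. True) X Y f g"
  shows "null_homotopic X Y f \<longleftrightarrow> null_homotopic X Y g"
  using assms unfolding null_homotopic_def by (meson homotopic_with_sym homotopic_with_trans)

lemma closedin_wild_set:
  assumes "locally_path_connected_space X" "metrizable_space X"
  shows "closedin X (wild_set n X)"
proof -
  obtain M d where M: "Metric_space M d" and X: "X = Metric_space.mtopology M d"
    using assms(2) unfolding metrizable_space_def by blast
  interpret Metric_space M d by (rule M)
  have sub: "wild_set n X \<subseteq> topspace X"
    by (auto simp: wild_set_def wild_point_def)
  have "X closure_of wild_set n X \<subseteq> wild_set n X"
  proof
    fix x assume x: "x \<in> X closure_of wild_set n X"
    then have xM: "x \<in> M" using X by (simp add: in_closure_of)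
    have "\<exists>g. essential n X g \<and> g sphere_base = x \<and> g ` topspace (nsphere n) \<subseteq> mball x (inverse (Suc j))" for j
    proof -
      have "openin X (mball x (inverse (Suc j)))" "x \<in> mball x (inverse (Suc j))"
        using X xM by auto
      \<comment> \<open>One path connected neighbourhood serves both the sphere at w and the path
        from w to x, so the moved sphere does not leave the ball.\<close>
      then obtain U where U: "openin X U" "path_connectedin X U" "x \<in> U" "U \<subseteq> mball x (inverse (Suc j))"
        using assms(1) unfolding locally_path_connected_space by metis
      obtain w where w: "w \<in> U" "wild_point n X w"
        using x U by (auto simp: in_closure_of wild_set_def)
      obtain g where g: "essential n X g" "g sphere_base = w" "g ` topspace (nsphere n) \<subseteq> U"
        using wild_pointD[OF w(2) U(1) w(1)] by blast
      obtain \<gamma> where \<gamma>: "pathin X \<gamma>" "\<gamma> ` {0..1} \<subseteq> U" "\<gamma> 0 = w" "\<gamma> 1 = x"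
        using U(2) w(1) U(3) unfolding path_connectedin by blast
      obtain g' where g': "continuous_map (nsphere n) X g'" "g' sphere_base = \<gamma> 1"
        "g' ` topspace (nsphere n) \<subseteq> g ` topspace (nsphere n) \<union> \<gamma> ` {0..1}"
        "homotopic_with (\<lambda>_. True) (nsphere n) X g g'"
        using move_basepoint[of n X g \<gamma>] g \<gamma> by (metis essential_def)
      have "essential n X g'"
        using g(1) g'(1) null_homotopic_homotopic[OF g'(4)] by (simp add: essential_def)
      then show ?thesis
        using g' g(3) \<gamma> U(4) by blast
    qed
    then obtain g where g: "\<And>j. essential n X (g j)" "\<And>j. g j sphere_base = x"
      "\<And>j. g j ` topspace (nsphere n) \<subseteq> mball x (inverse (Suc j))"
      by metis
    have "wild_point n X x"
    proof (rule wild_pointI[where g = g])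
      fix U assume U: "openin X U" "x \<in> U"
      then obtain r where r: "0 < r" "mball x r \<subseteq> U"
        unfolding X by (meson openin_mtopology)
      obtain N where N: "inverse (Suc N) < r"
        using reals_Archimedean[OF r(1)] by blast
      have "g j ` topspace (nsphere n) \<subseteq> U" if "N \<le> j" for j
      proof -
        have "inverse (real (Suc j)) \<le> inverse (real (Suc N))"
          using that by (intro le_imp_inverse_le) auto
        then have "mball x (inverse (Suc j)) \<subseteq> mball x r"
          using N by (clarsimp simp only: in_mball subset_iff) linarith
        then show ?thesis using g(3)[of j] r by blast
      qed
      then have "{j. \<not> g j ` topspace (nsphere n) \<subseteq> U} \<subseteq> {..<N}"
        by (metis (mono_tags, lifting) lessThan_iff linorder_not_le mem_Collect_eq subsetI)
      then show "finite {j. \<not> g j ` topspace (nsphere n) \<subseteq> U}"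
        using finite_subset by blast
    qed (use g xM X in auto)
    then show "x \<in> wild_set n X" by (simp add: wild_set_def)
  qed
  then show ?thesis
    using sub by (meson closure_of_subset_eq)
qed

lemma nsphere_top_of_set: "nsphere n = top_of_set (topspace (nsphere n))"
  by (simp add: nsphere euclidean_product_topology)
subsection \<open>Stereographic projection\<close>

text \<open>The pole is the basepoint, so that an attached sphere without its attaching point
  becomes a cell.\<close>

definition stereo :: "nat \<Rightarrow> (nat \<Rightarrow> real) \<Rightarrow> nat \<Rightarrow> real" where
  "stereo n x = (\<lambda>i. if i < n then x (Suc i) / (1 - x 0) else 0)"

definition stereo_inv :: "nat \<Rightarrow> (nat \<Rightarrow> real) \<Rightarrow> nat \<Rightarrow> real" where
  "stereo_inv n y = (\<lambda>i. if i = 0 then ((\<Sum>j<n. (y j)\<^sup>2) - 1) / ((\<Sum>j<n. (y j)\<^sup>2) + 1)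
     else if i \<le> n then 2 * y (i - 1) / ((\<Sum>j<n. (y j)\<^sup>2) + 1) else 0)"

lemma nsphere_sum_Suc: "x \<in> topspace (nsphere n) \<Longrightarrow> (\<Sum>i<n. (x (Suc i))\<^sup>2) = 1 - (x 0)\<^sup>2"
  by (simp add: topspace_nsphere sum.atMost_shift)

lemma nsphere_first_coordinate:
  assumes "x \<in> topspace (nsphere n)"
  shows "\<bar>x i\<bar> \<le> 1" "x 0 = 1 \<longleftrightarrow> x = sphere_base"
proof -
  have "(x i)\<^sup>2 \<le> 1"
  proof (cases "i \<le> n")
    case True
    then have "(x i)\<^sup>2 \<le> (\<Sum>i\<le>n. (x i)\<^sup>2)"
      by (intro member_le_sum) auto
    then show ?thesis using assms by (simp add: topspace_nsphere)
  qed (use assms in \<open>simp add: topspace_nsphere\<close>)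
  then show "\<bar>x i\<bar> \<le> 1" by (simp add: abs_square_le_1)
  show "x 0 = 1 \<longleftrightarrow> x = sphere_base"
  proof
    assume 1: "x 0 = 1"
    then have "(\<Sum>i<n. (x (Suc i))\<^sup>2) = 0" using nsphere_sum_Suc[OF assms] by simp
    then have "x (Suc i) = 0" if "i < n" for i
      using that by (simp add: sum_nonneg_eq_0_iff)
    moreover have "x (Suc i) = 0" if "\<not> i < n" for i
      using assms that by (simp add: topspace_nsphere)
    ultimately have "x (Suc i) = 0" for i by blast
    then show "x = sphere_base"
      using 1 by (auto simp: fun_eq_iff sphere_base_def gr0_conv_Suc)
  qed (simp add: sphere_base_def)
qed

text \<open>The length depends only on the height \<open>x 0\<close>. This recovers
  \<open>x 0\<close> in the inverse formula and later shows that points near the pole project far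
  out.\<close>

lemma stereo_norm:
  assumes "x \<in> topspace (nsphere n)" "x \<noteq> sphere_base"
  shows "(\<Sum>i<n. (stereo n x i)\<^sup>2) = (1 + x 0) / (1 - x 0)"
proof -
  have ne: "1 - x 0 \<noteq> 0" using nsphere_first_coordinate[OF assms(1)] assms(2) by auto
  have "(\<Sum>i<n. (stereo n x i)\<^sup>2) = (\<Sum>i<n. (x (Suc i))\<^sup>2 / (1 - x 0)\<^sup>2)"
    by (intro sum.cong) (auto simp: stereo_def power_divide)
  also have "\<dots> = (1 - (x 0)\<^sup>2) / (1 - x 0)\<^sup>2"
    by (simp add: nsphere_sum_Suc[OF assms(1)] flip: sum_divide_distrib)
  also have "1 - (x 0)\<^sup>2 = (1 + x 0) * (1 - x 0)"
    by (simp add: algebra_simps power2_eq_square)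
  also have "\<dots> / (1 - x 0)\<^sup>2 = (1 + x 0) / (1 - x 0)"
    using ne by (simp add: power2_eq_square)
  finally show ?thesis .
qed

lemma stereo_inv_in_nsphere: "stereo_inv n y \<in> topspace (nsphere n)"
proof -
  define s where "s = (\<Sum>j<n. (y j)\<^sup>2)"
  have s: "0 \<le> s" by (simp add: s_def sum_nonneg)
  have "(\<Sum>i\<le>n. (stereo_inv n y i)\<^sup>2) = ((s - 1) / (s + 1))\<^sup>2 + (\<Sum>i<n. (2 / (s + 1))\<^sup>2 * (y i)\<^sup>2)"
    unfolding sum.atMost_shift
    by (intro arg_cong2[of _ _ _ _ "(+)"] sum.cong) (auto simp: stereo_inv_def s_def power_divide power_mult_distrib)
  also have "\<dots> = ((s - 1) / (s + 1))\<^sup>2 + (2 / (s + 1))\<^sup>2 * s"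
    by (simp add: s_def sum_distrib_left)
  also have "\<dots> = ((s - 1)\<^sup>2 + 4 * s) / (s + 1)\<^sup>2"
    by (simp add: power_divide add_divide_distrib)
  also have "(s - 1)\<^sup>2 + 4 * s = (s + 1)\<^sup>2"
    by (simp add: power2_eq_square algebra_simps)
  finally have "(\<Sum>i\<le>n. (stereo_inv n y i)\<^sup>2) = 1" using s by simp
  then show ?thesis by (simp add: topspace_nsphere stereo_inv_def)
qed

lemma stereo_inv_stereo:
  assumes "x \<in> topspace (nsphere n)" "x \<noteq> sphere_base"
  shows "stereo_inv n (stereo n x) = x"
proof
  fix i
  have ne: "1 - x 0 \<noteq> 0" using nsphere_first_coordinate[OF assms(1)] assms(2) by auto
  have s: "(1 + x 0) / (1 - x 0) - 1 = 2 * x 0 / (1 - x 0)" "(1 + x 0) / (1 - x 0) + 1 = 2 / (1 - x 0)"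
    using ne by (simp_all add: field_simps)
  have "i = 0 \<or> (\<exists>j. i = Suc j \<and> j < n) \<or> i > n" by (cases i) auto
  then show "stereo_inv n (stereo n x) i = x i"
    using ne assms(1)
    by (elim disjE exE)
       (auto simp: stereo_inv_def stereo_norm[OF assms] s, auto simp: stereo_def topspace_nsphere)
qed

lemma stereo_stereo_inv:
  assumes "\<And>i. i \<ge> n \<Longrightarrow> y i = 0"
  shows "stereo n (stereo_inv n y) = y"
proof
  fix i
  define s where "s = (\<Sum>j<n. (y j)\<^sup>2)"
  have s: "0 \<le> s" by (simp add: s_def sum_nonneg)
  have *: "1 - (s - 1) / (s + 1) = 2 / (s + 1)" using s by (simp add: field_simps)
  show "stereo n (stereo_inv n y) i = y i"
    using assms[of i] s by (auto simp: stereo_def stereo_inv_def * simp flip: s_def)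
qed

lemma stereo_inv_neq_base: "stereo_inv n y \<noteq> sphere_base"
proof
  assume "stereo_inv n y = sphere_base"
  then have "stereo_inv n y 0 = 1" by (simp add: sphere_base_def)
  moreover have "0 \<le> (\<Sum>j<n. (y j)\<^sup>2)" by (simp add: sum_nonneg)
  ultimately show False by (simp add: stereo_inv_def field_simps)
qed

lemma homeomorphic_maps_stereo:
  "homeomorphic_maps (subtopology (nsphere n) (- {sphere_base})) (Euclidean_space n) (stereo n) (stereo_inv n)"
  unfolding homeomorphic_maps_def
proof (intro conjI ballI)
  let ?X = "subtopology (nsphere n) (- {sphere_base})"
  have X: "topspace ?X = topspace (nsphere n) - {sphere_base}" by auto
  have proj: "continuous_map ?X euclideanreal (\<lambda>x. x i)" for i
    using continuous_map_nsphere_projection continuous_map_from_subtopology by blast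
  have "continuous_map ?X euclideanreal (\<lambda>x. x (Suc i) / (1 - x 0))" for i
    using nsphere_first_coordinate by (intro continuous_intros proj) (auto simp: X)
  then show "continuous_map ?X (Euclidean_space n) (stereo n)"
    unfolding stereo_def by (simp add: continuous_map_componentwise_Euclidean_space)
  have proj': "continuous_map (Euclidean_space n) euclideanreal (\<lambda>y. y i)" for i
    unfolding Euclidean_space_def
    by (intro continuous_map_from_subtopology continuous_map_product_projection) auto
  have ne: "(\<Sum>j<n. (y j)\<^sup>2) + 1 \<noteq> 0" for y :: "nat \<Rightarrow> real"
    using sum_nonneg[of "{..<n}" "\<lambda>j. (y j)\<^sup>2"] by auto
  have "continuous_map (Euclidean_space n) euclideanreal (\<lambda>y. stereo_inv n y i)" for i
    unfolding stereo_inv_def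
    by (cases "i = 0"; cases "i \<le> n") (simp_all, (intro continuous_intros proj' ne | simp)+)
  then show "continuous_map (Euclidean_space n) ?X (stereo_inv n)"
    by (auto simp: continuous_map_in_subtopology continuous_map_into_nsphere stereo_inv_in_nsphere stereo_inv_neq_base)
  show "stereo_inv n (stereo n x) = x" if "x \<in> topspace ?X" for x
    using that X by (intro stereo_inv_stereo) auto
  show "stereo n (stereo_inv n y) = y" if "y \<in> topspace (Euclidean_space n)" for y
    using that by (intro stereo_stereo_inv) (auto simp: topspace_Euclidean_space)
qed

subsection \<open>Stars of the Kuhn triangulation\<close>

text \<open>With u = y / \<epsilon> - v the conditions say that the numbers 0, u 0, ..., u (n - 1)
  spread over less than 1. In the first n coordinates this is the open star of the vertex \<epsilon>
  * v in the Kuhn triangulation of mesh \<epsilon>.\<close>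

definition kuhn_star :: "nat \<Rightarrow> real \<Rightarrow> (nat \<Rightarrow> int) \<Rightarrow> (nat \<Rightarrow> real) set" where
  "kuhn_star n \<epsilon> v = {y. (\<forall>i<n. \<bar>y i / \<epsilon> - v i\<bar> < 1) \<and> (\<forall>i<n. \<forall>j<n. (y i / \<epsilon> - v i) - (y j / \<epsilon> - v j) < 1)}"

lemma open_kuhn_star: "open (kuhn_star n \<epsilon> v)"
proof -
  have c: "continuous_on UNIV (\<lambda>y::nat \<Rightarrow> real. y i / \<epsilon> - v i)" for i
    unfolding divide_inverse by (intro continuous_intros continuous_on_product_coordinates)
  have "kuhn_star n \<epsilon> v = (\<Inter>i\<in>{..<n}. {y. \<bar>y i / \<epsilon> - v i\<bar> < 1}) \<inter>
      (\<Inter>i\<in>{..<n}. \<Inter>j\<in>{..<n}. {y. (y i / \<epsilon> - v i) - (y j / \<epsilon> - v j) < 1})"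
    unfolding kuhn_star_def by auto
  moreover have "open \<dots>"
    by (intro open_Int open_INT ballI finite_lessThan open_Collect_less continuous_intros c)
  ultimately show ?thesis by simp
qed

lemma kuhn_star_cover: "y \<in> kuhn_star n \<epsilon> (\<lambda>i. if i < n then \<lfloor>y i / \<epsilon>\<rfloor> else 0)"
proof -
  have frac: "0 \<le> r - \<lfloor>r\<rfloor>" "r - \<lfloor>r\<rfloor> < 1" for r :: real by linarith+
  show ?thesis
    unfolding kuhn_star_def using frac by (auto simp: abs_less_iff) (smt (verit) frac)+
qed

lemma kuhn_star_dist:
  assumes "0 < \<epsilon>" "y \<in> kuhn_star n \<epsilon> v" "z \<in> kuhn_star n \<epsilon> v" "i < n"
  shows "\<bar>y i - z i\<bar> < 2 * \<epsilon>"
proof -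
  have "\<bar>y i / \<epsilon> - v i\<bar> < 1" "\<bar>z i / \<epsilon> - v i\<bar> < 1"
    using assms by (auto simp: kuhn_star_def)
  then have "\<bar>y i / \<epsilon> - z i / \<epsilon>\<bar> < 2" by linarith
  then have "\<bar>(y i - z i) / \<epsilon>\<bar> < 2" by (simp add: diff_divide_distrib)
  then show ?thesis using assms(1) by (simp add: abs_divide field_simps)
qed

text \<open>The smallest shift t \<ge> 0 that makes all differences nonnegative keeps them below 1,
  since each is below 1 and any two differ by less than 1.\<close>

lemma kuhn_star_floor:
  assumes "y \<in> kuhn_star n \<epsilon> v"
  obtains t where "0 \<le> t" "t < 1" "\<And>i. i < n \<Longrightarrow> v i = \<lfloor>y i / \<epsilon> + t\<rfloor>"
proof -
  define d where "d = (\<lambda>i. y i / \<epsilon> - v i)"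
  have d: "\<And>i. i < n \<Longrightarrow> \<bar>d i\<bar> < 1" "\<And>i j. i < n \<Longrightarrow> j < n \<Longrightarrow> d i - d j < 1"
    using assms by (auto simp: kuhn_star_def d_def)
  define T where "T = insert 0 ((\<lambda>i. - d i) ` {..<n})"
  define t where "t = Max T"
  have T: "finite T" "T \<noteq> {}" by (auto simp: T_def)
  have t: "t \<in> T" "\<And>u. u \<in> T \<Longrightarrow> u \<le> t"
    using T by (auto simp: t_def)
  show thesis
  proof
    show "0 \<le> t" using t(2) by (auto simp: T_def)
    show "t < 1" using t(1) d(1) by (force simp: T_def abs_less_iff)
    fix i assume i: "i < n"
    have "- d i \<le> t" using t(2) i by (auto simp: T_def)
    moreover have "d i + t < 1"
      using t(1) d i by (auto simp: T_def abs_less_iff)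
    ultimately show "v i = \<lfloor>y i / \<epsilon> + t\<rfloor>"
      by (intro floor_unique[symmetric]) (auto simp: d_def)
  qed
qed

text \<open>The centers of the stars containing \<open>y\<close> are the vectors of floors of \<open>y / \<epsilon> + t\<close> for
  \<open>0 \<le> t < 1\<close>. They form a chain, and each coordinate jumps at most once.\<close>

lemma card_kuhn_stars:
  defines "Z n \<equiv> {v :: nat \<Rightarrow> int. \<forall>i\<ge>n. v i = 0}"
  shows "finite {v \<in> Z n. y \<in> kuhn_star n \<epsilon> v}" "card {v \<in> Z n. y \<in> kuhn_star n \<epsilon> v} \<le> Suc n"
proof -
  let ?A = "{v \<in> Z n. y \<in> kuhn_star n \<epsilon> v}"
  \<comment> \<open>The coordinate sum takes at most n + 1 values on these vectors and is injective
    on them: a larger t gives a pointwise larger or equal vector, and equal sums then force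
    equality.\<close>
  let ?s = "\<lambda>v :: nat \<Rightarrow> int. \<Sum>i<n. v i"
  let ?low = "\<Sum>i<n. \<lfloor>y i / \<epsilon>\<rfloor>"
  have "?s v \<in> {?low..?low + int n}" if "v \<in> ?A" for v
  proof -
    have "y \<in> kuhn_star n \<epsilon> v" using that by blast
    then obtain t where t: "0 \<le> t" "t < 1" "\<And>i. i < n \<Longrightarrow> v i = \<lfloor>y i / \<epsilon> + t\<rfloor>"
      by (rule kuhn_star_floor) blast
    have "?low \<le> ?s v"
      using t by (intro sum_mono) (auto intro!: floor_mono)
    moreover have "?s v \<le> (\<Sum>i<n. \<lfloor>y i / \<epsilon>\<rfloor> + 1)"
    proof (rule sum_mono)
      fix i assume "i \<in> {..<n}"
      then have "v i = \<lfloor>y i / \<epsilon> + t\<rfloor>" using t by simp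
      then show "v i \<le> \<lfloor>y i / \<epsilon>\<rfloor> + 1" using t(2) by linarith
    qed
    ultimately show ?thesis by (simp add: sum.distrib)
  qed
  then have im: "?s ` ?A \<subseteq> {?low..?low + int n}" by blast
  have inj: "inj_on ?s ?A"
  proof (rule inj_onI)
    have le: "v = w" if vw: "v \<in> ?A" "w \<in> ?A" "?s v = ?s w"
      and t: "\<And>i. i < n \<Longrightarrow> v i = \<lfloor>y i / \<epsilon> + t\<rfloor>" "\<And>i. i < n \<Longrightarrow> w i = \<lfloor>y i / \<epsilon> + u\<rfloor>" "t \<le> u" for v w t u
    proof
      have "v i \<le> w i" if "i < n" for i
        using t that by (auto intro!: floor_mono)
      then have eq: "v i = w i" if "i < n" for i
        using that by (intro sum_mono_inv[OF vw(3)]) auto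
      show "v i = w i" for i
        using vw eq by (cases "i < n") (auto simp: Z_def)
    qed
    fix v w assume vw: "v \<in> ?A" "w \<in> ?A" "?s v = ?s w"
    have "y \<in> kuhn_star n \<epsilon> v" "y \<in> kuhn_star n \<epsilon> w" using vw by auto
    then obtain t u where t: "\<And>i. i < n \<Longrightarrow> v i = \<lfloor>y i / \<epsilon> + t\<rfloor>" "\<And>i. i < n \<Longrightarrow> w i = \<lfloor>y i / \<epsilon> + u\<rfloor>"
      by (metis kuhn_star_floor)
    show "v = w"
    proof (cases "t \<le> u")
      case True
      then show ?thesis using le[OF vw t] by blast
    next
      case False
      then show ?thesis using le[OF vw(2,1) vw(3)[symmetric] t(2,1)] by simp
    qed
  qed
  show "finite ?A" using inj im by (meson finite_atLeastAtMost_int finite_imageD finite_subset)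
  have "card ?A = card (?s ` ?A)" using inj by (simp add: card_image)
  also have "\<dots> \<le> card {?low..?low + int n}" using im by (intro card_mono) auto
  finally show "card ?A \<le> Suc n" by simp
qed

subsection \<open>Refinements of bounded order\<close>

text \<open>The order k is one more than the dimension. The family \<U> consists of ambient sets, so
  it can be kept fixed while S varies.\<close>

definition refinable :: "nat \<Rightarrow> 'a::topological_space set \<Rightarrow> 'a set set \<Rightarrow> bool" where
  "refinable k S \<U> \<longleftrightarrow> (\<exists>\<V>. (\<forall>V\<in>\<V>. openin (top_of_set S) V) \<and> \<Union>\<V> = S \<and>
      (\<forall>V\<in>\<V>. \<exists>U\<in>\<U>. V \<subseteq> U) \<and> (\<forall>x\<in>S. finite {V\<in>\<V>. x \<in> V} \<and> card {V\<in>\<V>. x \<in> V} \<le> k))"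

text \<open>Indices are counted instead of sets; coinciding members only lower the order.\<close>

lemma refinableI:
  assumes "\<And>j. j \<in> J \<Longrightarrow> openin (top_of_set S) (W j)" "S \<subseteq> (\<Union>j\<in>J. W j)"
    "\<And>j. j \<in> J \<Longrightarrow> \<exists>U\<in>\<U>. W j \<subseteq> U"
    "\<And>x. x \<in> S \<Longrightarrow> finite {j\<in>J. x \<in> W j} \<and> card {j\<in>J. x \<in> W j} \<le> k"
  shows "refinable k S \<U>"
  unfolding refinable_def
proof (intro exI[of _ "W ` J"] conjI ballI)
  show "\<Union>(W ` J) = S"
    using assms(1,2) openin_imp_subset by blast
  fix x assume x: "x \<in> S"
  have eq: "{V \<in> W ` J. x \<in> V} = W ` {j\<in>J. x \<in> W j}" by blast
  show "finite {V \<in> W ` J. x \<in> V}" "card {V \<in> W ` J. x \<in> V} \<le> k"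
    unfolding eq using assms(4)[OF x] card_image_le[of "{j\<in>J. x \<in> W j}" W] by auto
qed (use assms in auto)

section \<open>Covering dimension of subspaces\<close>

text \<open>Relatively open covers are traded for ambient open ones, against which refinements on
  different subsets can be compared.\<close>

lemma covering_dim_le_iff_refinable:
  assumes "-1 \<le> m"
  shows "covering_dim_le (top_of_set S) m \<longleftrightarrow>
    (\<forall>\<U>. (\<forall>U\<in>\<U>. open U) \<and> S \<subseteq> \<Union>\<U> \<longrightarrow> refinable (nat (m + 1)) S \<U>)"
    (is "?L \<longleftrightarrow> ?R")
proof -
  have card: "int c \<le> m + 1 \<longleftrightarrow> c \<le> nat (m + 1)" for c
    using assms by linarith
  show ?thesis
  proof
    assume L: ?L
    show ?R
    proof (intro allI impI)
      fix \<U> assume U: "(\<forall>U\<in>\<U>. open U) \<and> S \<subseteq> \<Union>\<U>"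
      let ?U = "(\<lambda>U. S \<inter> U) ` \<U>"
      have "(\<forall>U\<in>?U. openin (top_of_set S) U) \<and> \<Union>?U = topspace (top_of_set S)"
        using U by auto
      from spec[OF L[unfolded covering_dim_le_def], THEN mp, OF this]
      obtain \<V> where V: "\<forall>V\<in>\<V>. openin (top_of_set S) V" "\<Union>\<V> = topspace (top_of_set S)"
        "\<forall>V\<in>\<V>. \<exists>U\<in>?U. V \<subseteq> U"
        "\<forall>x\<in>topspace (top_of_set S). finite {V\<in>\<V>. x \<in> V} \<and> int (card {V\<in>\<V>. x \<in> V}) \<le> m + 1"
        by (elim exE conjE)
      have "\<forall>V\<in>\<V>. \<exists>U\<in>\<U>. V \<subseteq> U"
      proof
        fix V assume "V \<in> \<V>"
        then obtain A where "A \<in> \<U>" "V \<subseteq> S \<inter> A" using V(3) by auto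
        then show "\<exists>U\<in>\<U>. V \<subseteq> U" by blast
      qed
      then show "refinable (nat (m + 1)) S \<U>"
        unfolding refinable_def using V by (intro exI[of _ \<V>]) (simp add: card)
    qed
  next
    assume R: ?R
    show ?L
      unfolding covering_dim_le_def
    proof (intro allI impI)
      fix \<U> assume U: "(\<forall>U\<in>\<U>. openin (top_of_set S) U) \<and> \<Union>\<U> = topspace (top_of_set S)"
      let ?U = "{T. open T \<and> S \<inter> T \<in> \<U>}"
      have "S \<subseteq> \<Union>?U"
      proof
        fix x assume "x \<in> S"
        then obtain A where "A \<in> \<U>" "x \<in> A" using U by auto
        moreover from this U obtain T where "open T" "A = S \<inter> T" unfolding openin_open by metis
        ultimately have "T \<in> ?U" "x \<in> T" by auto
        then show "x \<in> \<Union>?U" by (rule UnionI)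
      qed
      then have "(\<forall>U\<in>?U. open U) \<and> S \<subseteq> \<Union>?U" by simp
      then have "refinable (nat (m + 1)) S ?U" by (rule spec[OF R, THEN mp])
      from this[unfolded refinable_def]
      obtain \<V> where V: "\<forall>V\<in>\<V>. openin (top_of_set S) V" "\<Union>\<V> = S"
        "\<forall>V\<in>\<V>. \<exists>U\<in>?U. V \<subseteq> U" "\<forall>x\<in>S. finite {V\<in>\<V>. x \<in> V} \<and> card {V\<in>\<V>. x \<in> V} \<le> nat (m + 1)"
        by (elim exE conjE)
      have "\<forall>V\<in>\<V>. \<exists>U\<in>\<U>. V \<subseteq> U"
      proof
        fix V assume "V \<in> \<V>"
        then obtain T where "S \<inter> T \<in> \<U>" "V \<subseteq> T" using V(3) by auto
        moreover have "V \<subseteq> S" using V(2) \<open>V \<in> \<V>\<close> by auto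
        ultimately show "\<exists>U\<in>\<U>. V \<subseteq> U" by blast
      qed
      then show "\<exists>\<V>. (\<forall>V\<in>\<V>. openin (top_of_set S) V) \<and> \<Union>\<V> = topspace (top_of_set S) \<and>
            (\<forall>V\<in>\<V>. \<exists>U\<in>\<U>. V \<subseteq> U) \<and>
            (\<forall>x\<in>topspace (top_of_set S). finite {V\<in>\<V>. x \<in> V} \<and> int (card {V\<in>\<V>. x \<in> V}) \<le> m + 1)"
        using V by (intro exI[of _ \<V>]) (simp add: card)
    qed
  qed
qed

text \<open>Open sets of Y are traces of open sets of X, and the complement of the closed image
  completes them to a cover of X; it vanishes on pulling back.\<close>

lemma covering_dim_le_closed_embedding:
  assumes f: "embedding_map Y X f" "closedin X (f ` topspace Y)" and X: "covering_dim_le X m"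
  shows "covering_dim_le Y m"
  unfolding covering_dim_le_def
proof (intro allI impI)
  fix \<U> assume U: "(\<forall>U\<in>\<U>. openin Y U) \<and> \<Union>\<U> = topspace Y"
  have cont: "continuous_map Y X f"
    using f(1) unfolding embedding_map_def
    by (meson continuous_map_into_fulltopology homeomorphic_imp_continuous_map)
  have inj: "inj_on f (topspace Y)"
    using f(1) unfolding embedding_map_def by (rule homeomorphic_imp_injective_map)
  show "\<exists>\<V>. (\<forall>V\<in>\<V>. openin Y V) \<and> \<Union>\<V> = topspace Y \<and> (\<forall>V\<in>\<V>. \<exists>U\<in>\<U>. V \<subseteq> U) \<and>
      (\<forall>x\<in>topspace Y. finite {V\<in>\<V>. x \<in> V} \<and> int (card {V\<in>\<V>. x \<in> V}) \<le> m + 1)"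
  \<comment> \<open>The complement of the image has empty preimage, and the refinement condition
    still asks for a member of \<U> around it.\<close>
  proof (cases "\<U> = {}")
    case True
    then show ?thesis using U by (intro exI[of _ "{}"]) auto
  next
    case False
    let ?pre = "\<lambda>V. {y \<in> topspace Y. f y \<in> V}"
    let ?U = "{T. openin X T \<and> (\<exists>U\<in>\<U>. ?pre T \<subseteq> U)}"
    have "\<Union>?U = topspace X"
    proof
      show "\<Union>?U \<subseteq> topspace X" using openin_subset by blast
      show "topspace X \<subseteq> \<Union>?U"
      proof
        fix x assume x: "x \<in> topspace X"
        show "x \<in> \<Union>?U"
        proof (cases "x \<in> f ` topspace Y")
          case False
          have "openin X (topspace X - f ` topspace Y)" using f(2) by blast
          moreover have "?pre (topspace X - f ` topspace Y) = {}" by auto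
          ultimately show ?thesis using x False \<open>\<U> \<noteq> {}\<close> by blast
        next
          case True
          then obtain y where y: "y \<in> topspace Y" "x = f y" by blast
          then obtain A where A: "A \<in> \<U>" "y \<in> A" using U by blast
          then have "openin (subtopology X (f ` topspace Y)) (f ` A)"
            using U f(1) unfolding embedding_map_def homeomorphic_map_def
            by (metis homeomorphic_imp_open_map homeomorphic_map_def open_map_def)
          then obtain T where T: "openin X T" "f ` A = T \<inter> f ` topspace Y"
            unfolding openin_subtopology by blast
          have "?pre T \<subseteq> A"
          proof
            fix z assume z: "z \<in> ?pre T"
            then have "f z \<in> f ` A" using T by auto
            then obtain a where a: "a \<in> A" "f z = f a" by blast
            have "a \<in> topspace Y" using a(1) A(1) U by blast
            then have "z = a" using inj a(2) z by (auto dest: inj_onD)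
            then show "z \<in> A" using a by simp
          qed
          moreover have "x \<in> T" using T A y by blast
          ultimately show ?thesis using T(1) A(1) by blast
        qed
      qed
    qed
    then have "(\<forall>U\<in>?U. openin X U) \<and> \<Union>?U = topspace X" by blast
    from spec[OF X[unfolded covering_dim_le_def], THEN mp, OF this]
    obtain \<V> where V: "\<forall>V\<in>\<V>. openin X V" "\<Union>\<V> = topspace X" "\<forall>V\<in>\<V>. \<exists>U\<in>?U. V \<subseteq> U"
      "\<forall>x\<in>topspace X. finite {V\<in>\<V>. x \<in> V} \<and> int (card {V\<in>\<V>. x \<in> V}) \<le> m + 1"
      by (elim exE conjE)
    show ?thesis
    proof (intro exI[of _ "?pre ` \<V>"] conjI ballI)
      show "openin Y V" if "V \<in> ?pre ` \<V>" for V
        using that V(1) cont by (auto simp: continuous_map_def)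
      show "\<Union>(?pre ` \<V>) = topspace Y"
      proof -
        have "\<exists>V\<in>\<V>. f y \<in> V" if "y \<in> topspace Y" for y
          using V(2) continuous_map_image_subset_topspace[OF cont] that by blast
        then show ?thesis by auto
      qed
      show "\<exists>U\<in>\<U>. V \<subseteq> U" if V': "V \<in> ?pre ` \<V>" for V
      proof -
        obtain T where "T \<in> \<V>" "V = ?pre T" using V' by blast
        moreover obtain T' where "T' \<in> ?U" "T \<subseteq> T'" using bspec[OF V(3) \<open>T \<in> \<V>\<close>] by (elim bexE)
        moreover have "\<exists>U\<in>\<U>. ?pre T' \<subseteq> U" using \<open>T' \<in> ?U\<close> by simp
        ultimately show ?thesis by (smt (verit) mem_Collect_eq subset_iff)
      qed
      fix y assume y: "y \<in> topspace Y"
      then have fy: "f y \<in> topspace X" using cont continuous_map_image_subset_topspace by blast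
      have sub: "{V \<in> ?pre ` \<V>. y \<in> V} = ?pre ` {V\<in>\<V>. f y \<in> V}" using y by auto
      have fin: "finite {V\<in>\<V>. f y \<in> V}" using V(4) fy by blast
      then show "finite {V \<in> ?pre ` \<V>. y \<in> V}" unfolding sub by blast
      have "card {V \<in> ?pre ` \<V>. y \<in> V} \<le> card {V\<in>\<V>. f y \<in> V}"
        unfolding sub using fin by (rule card_image_le)
      then show "int (card {V \<in> ?pre ` \<V>. y \<in> V}) \<le> m + 1"
        using V(4) fy by fastforce
    qed
  qed
qed

lemma covering_dim_le_homeomorphic:
  assumes "X homeomorphic_space Y"
  shows "covering_dim_le X m \<longleftrightarrow> covering_dim_le Y m"
proof -
  obtain f g where fg: "homeomorphic_map X Y f" "homeomorphic_map Y X g"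
    using assms homeomorphic_space homeomorphic_space_sym by metis
  then have "closedin Y (f ` topspace X)" "closedin X (g ` topspace Y)"
    by (simp_all add: homeomorphic_imp_surjective_map)
  then show ?thesis
    using covering_dim_le_closed_embedding[of X Y f m] covering_dim_le_closed_embedding[of Y X g m] fg
    by (auto simp: embedding_map_def homeomorphic_imp_surjective_map)
qed

section \<open>Refinements on unions of closed sets\<close>

text \<open>The complement of T in the union consists of a piece closed in A and a piece closed in
  K, hence is closed.\<close>

lemma openin_Un_closed:
  assumes "closed A" "closed K" "T \<subseteq> A \<union> K"
    "openin (top_of_set A) (T \<inter> A)" "openin (top_of_set K) (T \<inter> K)"
  shows "openin (top_of_set (A \<union> K)) T"
proof -
  have "closed (A - T \<inter> A)" "closed (K - T \<inter> K)"
    using closedin_closed_trans[OF closedin_diff[OF closedin_topspace assms(4)]]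
      closedin_closed_trans[OF closedin_diff[OF closedin_topspace assms(5)]] assms(1,2) by simp_all
  then have "closed ((A - T \<inter> A) \<union> (K - T \<inter> K))" by blast
  moreover have "(A - T \<inter> A) \<union> (K - T \<inter> K) = (A \<union> K) - T" by blast
  ultimately have "closed ((A \<union> K) - T)" by simp
  then have "openin (top_of_set (A \<union> K)) ((A \<union> K) \<inter> - ((A \<union> K) - T))"
    by (metis closed_def openin_open_Int)
  moreover have "(A \<union> K) \<inter> - ((A \<union> K) - T) = T" using assms(3) by blast
  ultimately show ?thesis by simp
qed

text \<open>Near each \<open>a \<in> A \<inter> K\<close> the members of the refinement on \<open>A\<close> containing \<open>a\<close> are extended by a
  small ball in \<open>K\<close>. A member \<open>v a\<close> of the refinement on \<open>K\<close> containing \<open>a\<close> is merged into one of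
  them, and the remaining members avoid these balls.\<close>

lemma refinable_Un_finite_Int:
  fixes A K :: "'a::metric_space set"
  assumes cl: "closed A" "closed K" and fin: "finite (A \<inter> K)"
    and U: "\<And>U. U \<in> \<U> \<Longrightarrow> open U" "A \<union> K \<subseteq> \<Union>\<U>" and A: "refinable k A \<U>"
    and K: "\<And>\<U>. \<lbrakk>\<And>U. U \<in> \<U> \<Longrightarrow> open U; K \<subseteq> \<Union>\<U>\<rbrakk> \<Longrightarrow> refinable k K \<U>"
  shows "refinable k (A \<union> K) \<U>"
proof -
  define F where "F = A \<inter> K"
  have F: "finite F" "F \<subseteq> A" "F \<subseteq> K" using fin by (auto simp: F_def)
  from A[unfolded refinable_def]
  obtain \<W> where W': "\<forall>w\<in>\<W>. openin (top_of_set A) w" "\<Union>\<W> = A" "\<forall>w\<in>\<W>. \<exists>U\<in>\<U>. w \<subseteq> U"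
    "\<forall>x\<in>A. finite {w\<in>\<W>. x \<in> w} \<and> card {w\<in>\<W>. x \<in> w} \<le> k"
    by (elim exE conjE)
  note W = bspec[OF W'(1)] W'(2) bspec[OF W'(3)] bspec[OF W'(4)]
  obtain u where u: "\<And>w. w \<in> \<W> \<Longrightarrow> u w \<in> \<U>" "\<And>w. w \<in> \<W> \<Longrightarrow> w \<subseteq> u w"
    using W(3) by metis
  have "\<exists>w\<in>\<W>. a \<in> w" if "a \<in> F" for a using that F(2) W(2) by blast
  then obtain \<omega> where \<omega>: "\<And>a. a \<in> F \<Longrightarrow> \<omega> a \<in> \<W>" "\<And>a. a \<in> F \<Longrightarrow> a \<in> \<omega> a" by metis
  \<comment> \<open>Only the sets of the first kind contain points of F, and each contains at most
    one. So a member through a lies in \<open>u (\<omega> a)\<close> and avoids the rest of F, as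
    the merging requires.\<close>
  define \<U>' where "\<U>' = (\<lambda>a. u (\<omega> a) - (F - {a})) ` F \<union> (\<lambda>U. U - F) ` \<U>"
  have K': "refinable k K \<U>'"
  proof (rule K)
    show "open T" if "T \<in> \<U>'" for T
      using that U(1) u(1) \<omega>(1) F(1) unfolding \<U>'_def
      by (auto intro!: open_Diff finite_imp_closed)
    show "K \<subseteq> \<Union>\<U>'"
    proof
      fix x assume x: "x \<in> K"
      show "x \<in> \<Union>\<U>'"
      proof (cases "x \<in> F")
        case True
        then have "x \<in> u (\<omega> x)" using \<omega> u(2)[OF \<omega>(1)] by auto
        moreover have "u (\<omega> x) - (F - {x}) \<in> \<U>'" using True by (simp add: \<U>'_def)
        ultimately show ?thesis by (intro UnionI[of "u (\<omega> x) - (F - {x})"]) auto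
      next
        case False
        moreover obtain U where "U \<in> \<U>" "x \<in> U" using x U(2) by blast
        moreover from this have "U - F \<in> \<U>'" by (simp add: \<U>'_def)
        ultimately show ?thesis by (intro UnionI[of "U - F"]) auto
      qed
    qed
  qed
  from K'[unfolded refinable_def]
  obtain \<V> where V': "\<forall>V\<in>\<V>. openin (top_of_set K) V" "\<Union>\<V> = K" "\<forall>V\<in>\<V>. \<exists>U\<in>\<U>'. V \<subseteq> U"
    "\<forall>x\<in>K. finite {V\<in>\<V>. x \<in> V} \<and> card {V\<in>\<V>. x \<in> V} \<le> k"
    by (elim exE conjE)
  note V = bspec[OF V'(1)] V'(2) bspec[OF V'(3)] bspec[OF V'(4)]
  have "\<exists>V\<in>\<V>. a \<in> V" if "a \<in> F" for a using that F(3) V(2) by blast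
  then obtain v where v: "\<And>a. a \<in> F \<Longrightarrow> v a \<in> \<V>" "\<And>a. a \<in> F \<Longrightarrow> a \<in> v a" by metis
  have vF: "b = a" if "a \<in> F" "b \<in> F" "b \<in> v a" for a b
    using V(3)[OF v(1)[OF that(1)]] v(2)[OF that(1)] that unfolding \<U>'_def by blast
  have vu: "v a \<subseteq> u (\<omega> a)" if a: "a \<in> F" for a
    using V(3)[OF v(1)[OF a]] v(2)[OF a] a unfolding \<U>'_def by blast
  have Vu: "\<exists>U\<in>\<U>. V \<subseteq> U" if "V \<in> \<V>" for V
    using V(3)[OF that] u(1) \<omega>(1) unfolding \<U>'_def by blast
  \<comment> \<open>Each condition holds for all small r > 0, and there are finitely many of them,
    as each point of F lies in finitely many members of \<W>.\<close>
  have "\<exists>r>0. (\<forall>a\<in>F. K \<inter> cball a r \<subseteq> v a) \<and> (\<forall>a\<in>F. \<forall>b\<in>F. a \<noteq> b \<longrightarrow> 2 * r < dist a b) \<and>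
      (\<forall>a\<in>F. \<forall>w\<in>{w\<in>\<W>. a \<in> w}. ball a r \<subseteq> u w)"
  proof -
    have small: "\<forall>\<^sub>F r in at_right 0. r < c" if "0 < c" for c :: real
      using that eventually_at_right_less[of 0] by (simp add: eventually_at_right_field) blast
    have "\<forall>\<^sub>F r in at_right 0. K \<inter> cball a r \<subseteq> v a" if a: "a \<in> F" for a
    proof -
      have "openin (top_of_set K) (v a)" using V(1) v(1)[OF a] by blast
      then obtain e where "0 < e" "ball a e \<inter> K \<subseteq> v a"
        using v(2)[OF a] by (meson openin_contains_ball)
      then show ?thesis
        using small[of e] by (auto elim!: eventually_mono)
    qed
    moreover have "\<forall>\<^sub>F r in at_right 0. a \<noteq> b \<longrightarrow> 2 * r < dist a b" for a b :: 'a
    proof (cases "a = b")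
      case False
      then show ?thesis using small[of "dist a b / 2"] by (auto elim!: eventually_mono)
    qed simp
    moreover have "\<forall>\<^sub>F r in at_right 0. ball a r \<subseteq> u w" if w: "w \<in> {w\<in>\<W>. a \<in> w}" for a w
    proof -
      have "open (u w)" "a \<in> u w" using w u U(1) by auto
      then obtain e where "0 < e" "ball a e \<subseteq> u w"
        by (meson open_contains_ball)
      then show ?thesis
        using small[of e] by (force elim!: eventually_mono)
    qed
    moreover have "\<forall>\<^sub>F r in at_right (0::real). 0 < r"
      by (rule eventually_at_right_less)
    moreover have "finite {w\<in>\<W>. a \<in> w}" if "a \<in> F" for a
      using W(4) F(2) that by blast
    ultimately have "\<forall>\<^sub>F r in at_right 0. 0 < r \<and> (\<forall>a\<in>F. K \<inter> cball a r \<subseteq> v a) \<and>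
        (\<forall>a\<in>F. \<forall>b\<in>F. a \<noteq> b \<longrightarrow> 2 * r < dist a b) \<and> (\<forall>a\<in>F. \<forall>w\<in>{w\<in>\<W>. a \<in> w}. ball a r \<subseteq> u w)"
      using F(1) by (intro eventually_conj eventually_ball_finite ballI) auto
    then show ?thesis
      using eventually_happens'[OF trivial_limit_at_right_real] by blast
  qed
  then obtain r where r': "0 < r" "\<forall>a\<in>F. K \<inter> cball a r \<subseteq> v a"
    "\<forall>a\<in>F. \<forall>b\<in>F. a \<noteq> b \<longrightarrow> 2 * r < dist a b" "\<forall>a\<in>F. \<forall>w\<in>{w\<in>\<W>. a \<in> w}. ball a r \<subseteq> u w"
    by (elim exE conjE)
  have r: "0 < r" "\<And>a. a \<in> F \<Longrightarrow> K \<inter> cball a r \<subseteq> v a"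
    "\<And>a b. \<lbrakk>a \<in> F; b \<in> F; a \<noteq> b\<rbrakk> \<Longrightarrow> 2 * r < dist a b"
    "\<And>a w. \<lbrakk>a \<in> F; w \<in> \<W>; a \<in> w\<rbrakk> \<Longrightarrow> ball a r \<subseteq> u w"
    using r' by simp_all
  have sep: "a = b" if "a \<in> F" "b \<in> F" "x \<in> cball a r" "x \<in> cball b r" for a b x
  proof (rule ccontr)
    assume "a \<noteq> b"
    then have "2 * r < dist a b" using r(3) that by blast
    then show False using that(3,4) dist_triangle2[of a b x] by simp
  qed
  have vinj: "a = b" if "a \<in> F" "b \<in> F" "v a = v b" for a b
  proof -
    have "b \<in> v a" using v(2)[OF that(2)] unfolding that(3) .
    then show ?thesis using vF[OF that(1,2)] by simp
  qed
  \<comment> \<open>After this only \<open>m (v a)\<close> can meet the closed ball at a, so near a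
    no member of the refinement on K is left besides the merged one.\<close>
  define m where "m V = V - (\<Union>a\<in>{a\<in>F. V \<noteq> v a}. cball a r)" for V
  have mV: "m V \<subseteq> V" for V by (auto simp: m_def)
  have mo: "openin (top_of_set K) (m V)" if "V \<in> \<V>" for V
  proof -
    have "closed (\<Union>a\<in>{a\<in>F. V \<noteq> v a}. cball a r)"
      using F(1) by (intro closed_UN) auto
    then have "openin (top_of_set K) (V \<inter> - (\<Union>a\<in>{a\<in>F. V \<noteq> v a}. cball a r))"
      using V(1)[OF that] by (intro openin_Int_open open_Compl)
    then show ?thesis by (simp only: m_def Diff_eq)
  qed
  have mF: "b = a" if "a \<in> F" "b \<in> F" "b \<in> m (v a)" for a b
    using vF that mV by blast
  have mF': "V = v b" if "V \<in> \<V>" "b \<in> F" "b \<in> m V" for V b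
    using that r(1) by (auto simp: m_def)
  define ext where "ext w = w \<union> (\<Union>a\<in>F \<inter> w. K \<inter> ball a r) \<union> (\<Union>a\<in>{a\<in>F. \<omega> a = w}. m (v a))" for w
  \<comment> \<open>The sum type keeps the two families apart as indices; the members
    \<open>v a\<close> are left out, since \<open>ext\<close> has absorbed them.\<close>
  define J where "J = Inl ` \<W> \<union> Inr ` (\<V> - v ` F)"
  define G where "G = case_sum ext m"
  show ?thesis
  proof (rule refinableI[where J = J and W = G])
    fix j assume "j \<in> J"
    then consider (l) w where "w \<in> \<W>" "j = Inl w" | (r) V where "V \<in> \<V>" "V \<notin> v ` F" "j = Inr V"
      by (auto simp: J_def)
    then show "openin (top_of_set (A \<union> K)) (G j)"
    proof cases
      case l
      have wA: "w \<subseteq> A" using W(2) l(1) by blast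
      have "ext w \<inter> A = w"
      proof
        show "w \<subseteq> ext w \<inter> A" using wA by (auto simp: ext_def)
        show "ext w \<inter> A \<subseteq> w"
        proof
          fix x assume x: "x \<in> ext w \<inter> A"
          then consider "x \<in> w" | a where "a \<in> F" "a \<in> w" "x \<in> K" "x \<in> ball a r"
            | a where "a \<in> F" "\<omega> a = w" "x \<in> m (v a)"
            by (auto simp: ext_def)
          then show "x \<in> w"
          proof cases
            case 2
            then have "x \<in> F" using x by (simp add: F_def)
            then have "x = a" using sep[of x a x] 2 r(1) by auto
            then show ?thesis using 2 by simp
          next
            case 3
            then have "x \<in> F" using x mV[of "v a"] V(2) v(1) by (auto simp: F_def)
            then have "x = a" using mF 3 by blast
            then show ?thesis using 3 \<omega>(2) by blast
          qed
        qed
      qed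
      moreover have "ext w \<inter> K = (\<Union>a\<in>F \<inter> w. K \<inter> ball a r) \<union> (\<Union>a\<in>{a\<in>F. \<omega> a = w}. m (v a))"
      proof -
        have "w \<inter> K \<subseteq> (\<Union>a\<in>F \<inter> w. K \<inter> ball a r)"
          using wA r(1) by (auto simp: F_def)
        moreover have "m (v a) \<subseteq> K" if "a \<in> F" for a
          using mV V(2) v(1)[OF that] by blast
        ultimately show ?thesis unfolding ext_def by blast
      qed
      moreover have "openin (top_of_set K) \<dots>"
        using mo v(1) by (intro openin_Un openin_Union) auto
      moreover have "ext w \<subseteq> A \<union> K"
        unfolding ext_def using wA mV V(2) v(1) by blast
      ultimately show ?thesis
        using openin_Un_closed[OF cl, of "ext w"] W(1)[OF l(1)] by (simp add: G_def l)
    next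
      case r
      have "m V \<inter> A = {}"
      proof -
        have "False" if "x \<in> m V" "x \<in> A" for x
        proof -
          have "x \<in> F" using that mV V(2) r(1) by (auto simp: F_def)
          then show False using mF'[OF r(1) _ that(1)] r(2) by blast
        qed
        then show ?thesis by blast
      qed
      moreover have "m V \<subseteq> K" using mV V(2) r(1) by blast
      ultimately show ?thesis
        using openin_Un_closed[OF cl, of "m V"] mo[OF r(1)] by (simp add: G_def r Int_absorb2 le_supI2)
    qed
  next
    show "A \<union> K \<subseteq> (\<Union>j\<in>J. G j)"
    proof
      fix x assume "x \<in> A \<union> K"
      show "x \<in> (\<Union>j\<in>J. G j)"
      proof (cases "x \<in> A")
        case True
        then obtain w where "w \<in> \<W>" "x \<in> w" using W(2) by blast
        then have "Inl w \<in> J" "x \<in> G (Inl w)" by (auto simp: J_def G_def ext_def)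
        then show ?thesis by blast
      next
        case False
        then have xK: "x \<in> K" using \<open>x \<in> A \<union> K\<close> by blast
        have *: ?thesis if "a \<in> F" "x \<in> m (v a)" for a
        proof -
          have "Inl (\<omega> a) \<in> J" "x \<in> G (Inl (\<omega> a))" using that \<omega>(1) by (auto simp: J_def G_def ext_def)
          then show ?thesis by blast
        qed
        show ?thesis
        proof (cases "\<exists>a\<in>F. x \<in> cball a r")
          case True
          then obtain a where a: "a \<in> F" "x \<in> cball a r" by blast
          then have "x \<in> m (v a)"
            using r(2)[OF a(1)] xK sep[OF _ a(1) _ a(2)] unfolding m_def by blast
          then show ?thesis using * a by blast
        next
          case False
          obtain V where V': "V \<in> \<V>" "x \<in> V" using V(2) xK by blast
          then have xm: "x \<in> m V" using False by (auto simp: m_def)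
          show ?thesis
          proof (cases "V \<in> v ` F")
            case True
            then show ?thesis using * xm by blast
          next
            case False
            then have "Inr V \<in> J" "x \<in> G (Inr V)" using V' xm by (auto simp: J_def G_def)
            then show ?thesis by blast
          qed
        qed
      qed
    qed
  next
    fix j assume "j \<in> J"
    then consider (l) w where "w \<in> \<W>" "j = Inl w" | (r) V where "V \<in> \<V>" "j = Inr V"
      by (auto simp: J_def)
    then show "\<exists>U\<in>\<U>. G j \<subseteq> U"
    proof cases
      case l
      have "m (v a) \<subseteq> u w" if "a \<in> F" "\<omega> a = w" for a
        using vu[OF that(1)] mV that(2) by blast
      then have "ext w \<subseteq> u w"
        unfolding ext_def using u(2)[OF l(1)] r(4)[OF _ l(1)] by blast
      then show ?thesis using u(1)[OF l(1)] by (auto simp: G_def l)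
    next
      case r
      then show ?thesis using Vu[OF r(1)] mV[of V] by (auto simp: G_def)
    qed
  next
    fix x assume x: "x \<in> A \<union> K"
    have bound: "finite {j\<in>J. x \<in> G j} \<and> card {j\<in>J. x \<in> G j} \<le> k"
      if "{j\<in>J. x \<in> G j} \<subseteq> g ` B" "finite B" "card B \<le> k" for g and B :: "'a set set"
      using that by (meson card_image_le card_mono finite_imageI finite_subset le_trans)
    have cases: "(\<exists>w\<in>\<W>. j = Inl w \<and> x \<in> ext w) \<or> (\<exists>V\<in>\<V> - v ` F. j = Inr V \<and> x \<in> m V)"
      if "j \<in> J" "x \<in> G j" for j
      using that by (auto simp: J_def G_def)
    have extD: "x \<in> w \<or> (\<exists>a\<in>F. a \<in> w \<and> x \<in> ball a r) \<or> (\<exists>a\<in>F. \<omega> a = w \<and> x \<in> m (v a))" if "x \<in> ext w" for w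
      using that by (auto simp: ext_def)
    \<comment> \<open>In the ball around a, only the extensions of members through a can contain x,
      so the count at a carries over.\<close>
    have near: "finite {j\<in>J. x \<in> G j} \<and> card {j\<in>J. x \<in> G j} \<le> k" if a: "a \<in> F" "x \<in> cball a r" and xK: "x \<in> K" "x \<in> A \<longrightarrow> x = a" for a
    proof (rule bound)
      show "finite {w\<in>\<W>. a \<in> w}" "card {w\<in>\<W>. a \<in> w} \<le> k" using W(4) F(2) a(1) by blast+
      show "{j\<in>J. x \<in> G j} \<subseteq> Inl ` {w\<in>\<W>. a \<in> w}"
      proof
        fix j assume "j \<in> {j\<in>J. x \<in> G j}"
        then have "j \<in> J" "x \<in> G j" by simp_all
        from cases[OF this]
        consider w where "w \<in> \<W>" "j = Inl w" "x \<in> ext w" | V where "V \<in> \<V> - v ` F" "x \<in> m V"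
          by blast
        then show "j \<in> Inl ` {w\<in>\<W>. a \<in> w}"
        proof cases
          case 1
          from extD[OF 1(3)] have "a \<in> w"
          proof (elim disjE bexE conjE)
            assume "x \<in> w"
            then show ?thesis using xK(2) W(2) 1(1) by auto
          next
            fix b assume "b \<in> F" "b \<in> w" "x \<in> ball b r"
            then show ?thesis using sep[OF a(1) _ a(2), of b] by auto
          next
            fix b assume b: "b \<in> F" "\<omega> b = w" "x \<in> m (v b)"
            then have "v b = v a" using a by (auto simp: m_def)
            then show ?thesis using vinj a(1) b \<omega>(2) by blast
          qed
          then show ?thesis using 1 by blast
        next
          case 2
          then show ?thesis using a by (auto simp: m_def)
        qed
      qed
    qed
    show "finite {j\<in>J. x \<in> G j} \<and> card {j\<in>J. x \<in> G j} \<le> k"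
    proof (cases "x \<in> A")
      case True
      show ?thesis
      proof (cases "x \<in> K")
        case True
        then show ?thesis using near[of x] \<open>x \<in> A\<close> r(1) by (auto simp: F_def)
      next
        case False
        show ?thesis
        proof (rule bound)
          show "finite {w\<in>\<W>. x \<in> w}" "card {w\<in>\<W>. x \<in> w} \<le> k" using W(4) True by blast+
          have "m V \<subseteq> K" if "V \<in> \<V>" for V using mV V(2) that by blast
          then have "x \<notin> m V" if "V \<in> \<V>" for V using False that by blast
          then have no: "\<not> (\<exists>V\<in>\<V> - v ` F. j = Inr V \<and> x \<in> m V)" "\<not> (\<exists>a\<in>F. \<omega> a = w \<and> x \<in> m (v a))" for j w
            using v(1) by auto
          show "{j\<in>J. x \<in> G j} \<subseteq> Inl ` {w\<in>\<W>. x \<in> w}"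
          proof
            fix j assume "j \<in> {j\<in>J. x \<in> G j}"
            then have "j \<in> J" "x \<in> G j" by simp_all
            from cases[OF this] no(1)[of j] obtain w where w: "w \<in> \<W>" "j = Inl w" "x \<in> ext w" by auto
            have "x \<in> w"
              using w(3) False no(2)[of w] by (auto simp: ext_def)
            then show "j \<in> Inl ` {w\<in>\<W>. x \<in> w}" using w by simp
          qed
        qed
      qed
    next
      case False
      then have xK: "x \<in> K" using x by blast
      show ?thesis
      proof (cases "\<exists>a\<in>F. x \<in> cball a r")
        case True
        then show ?thesis using near xK False by blast
      next
        case far: False
        \<comment> \<open>Away from A and the balls, each member on K through x accounts for one
          index, a merged one for the extension that absorbed it.\<close>
        define g where "g V = (if V \<in> v ` F then Inl (\<omega> (the_inv_into F v V)) else Inr V)" for V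
        have vi: "inj_on v F" using vinj by (auto intro: inj_onI)
        show ?thesis
        proof (rule bound)
          show "finite {V\<in>\<V>. x \<in> V}" "card {V\<in>\<V>. x \<in> V} \<le> k" using V(4) xK by blast+
          show "{j\<in>J. x \<in> G j} \<subseteq> g ` {V\<in>\<V>. x \<in> V}"
          proof
            fix j assume "j \<in> {j\<in>J. x \<in> G j}"
            then have "j \<in> J" "x \<in> G j" by simp_all
            from cases[OF this]
            consider w where "w \<in> \<W>" "j = Inl w" "x \<in> ext w" | V where "V \<in> \<V> - v ` F" "j = Inr V" "x \<in> m V"
              by blast
            then show "j \<in> g ` {V\<in>\<V>. x \<in> V}"
            proof cases
              case 1
              have "x \<notin> w" using W(2) 1(1) False by blast
              then obtain a where a: "a \<in> F" "\<omega> a = w" "x \<in> m (v a)"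
                using extD[OF 1(3)] far by (auto simp: less_imp_le)
              then have "g (v a) = j" using 1(2) vi by (simp add: g_def the_inv_into_f_f)
              moreover have "v a \<in> {V\<in>\<V>. x \<in> V}" using a mV v(1) by blast
              ultimately show ?thesis by blast
            next
              case 2
              then have "g V = j" "V \<in> {V\<in>\<V>. x \<in> V}" using mV by (auto simp: g_def)
              then show ?thesis by blast
            qed
          qed
        qed
      qed
    qed
  qed
qed

text \<open>A point of a member \<open>W\<close> receives half the radius of a ball that meets the base set inside \<open>W\<close>.
  If finitely many of the enlarged members share a point, the center with the smallest radius lies in
  all the original members, so the order does not grow.\<close>

lemma refinable_neighbourhood:
  fixes S :: "'a::metric_space set"
  assumes S: "refinable k S \<U>" and U: "\<And>U. U \<in> \<U> \<Longrightarrow> open U"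
  obtains G where "open G" "S \<subseteq> G" "\<And>T. T \<subseteq> G \<Longrightarrow> refinable k T \<U>"
proof -
  from S[unfolded refinable_def]
  obtain \<W> where W': "\<forall>w\<in>\<W>. openin (top_of_set S) w" "\<Union>\<W> = S" "\<forall>w\<in>\<W>. \<exists>U\<in>\<U>. w \<subseteq> U"
    "\<forall>x\<in>S. finite {w\<in>\<W>. x \<in> w} \<and> card {w\<in>\<W>. x \<in> w} \<le> k"
    by (elim exE conjE)
  obtain u where u: "\<And>w. w \<in> \<W> \<Longrightarrow> u w \<in> \<U>" "\<And>w. w \<in> \<W> \<Longrightarrow> w \<subseteq> u w"
    using W'(3) by metis
  have "\<forall>w\<in>\<W>. \<forall>x\<in>w. \<exists>r>0. ball x r \<inter> S \<subseteq> w"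
    using W'(1) unfolding openin_contains_ball by blast
  then obtain r where r: "\<And>w x. \<lbrakk>w \<in> \<W>; x \<in> w\<rbrakk> \<Longrightarrow> 0 < r w x" "\<And>w x. \<lbrakk>w \<in> \<W>; x \<in> w\<rbrakk> \<Longrightarrow> ball x (r w x) \<inter> S \<subseteq> w"
    by metis
  define E where "E w = u w \<inter> (\<Union>x\<in>w. ball x (r w x / 2))" for w
  have E: "open (E w)" "w \<subseteq> E w" "E w \<subseteq> u w" if "w \<in> \<W>" for w
    using that u U r(1) unfolding E_def by (auto intro!: open_Int)
  have common: "\<exists>c\<in>S. \<forall>w\<in>\<F>. c \<in> w" if F: "\<F> \<subseteq> \<W>" "finite \<F>" "\<F> \<noteq> {}" "\<forall>w\<in>\<F>. x \<in> E w" for \<F> x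
  proof -
    have "\<forall>w\<in>\<F>. \<exists>c\<in>w. dist c x < r w c / 2"
      using F(4) by (auto simp: E_def)
    then obtain c where c: "\<And>w. w \<in> \<F> \<Longrightarrow> c w \<in> w" "\<And>w. w \<in> \<F> \<Longrightarrow> dist (c w) x < r w (c w) / 2"
      by metis
    define w0 where "w0 = arg_min_on (\<lambda>w. r w (c w)) \<F>"
    have w0: "w0 \<in> \<F>" "\<And>w. w \<in> \<F> \<Longrightarrow> r w0 (c w0) \<le> r w (c w)"
      using F(2,3) arg_min_if_finite[of \<F> "\<lambda>w. r w (c w)"] by (auto simp: w0_def not_less)
    have cS: "c w0 \<in> S" using c(1)[OF w0(1)] w0(1) F(1) W'(2) by blast
    have "c w0 \<in> w" if w: "w \<in> \<F>" for w
    proof -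
      have "dist (c w) (c w0) < r w (c w)"
        using c(2)[OF w] c(2)[OF w0(1)] w0(2)[OF w] dist_triangle2[of "c w" "c w0" x] by linarith
      then show ?thesis
        using r(2)[OF subsetD[OF F(1) w] c(1)[OF w]] cS by auto
    qed
    then show ?thesis using cS by blast
  qed
  \<comment> \<open>Finiteness is not known in advance; the smallest radius is taken over finite
    subfamilies, and their bounded size gives it.\<close>
  have order: "finite {w\<in>\<W>. x \<in> E w} \<and> card {w\<in>\<W>. x \<in> E w} \<le> k" for x
  proof (rule finite_if_finite_subsets_card_bdd)
    fix \<F> assume F: "\<F> \<subseteq> {w\<in>\<W>. x \<in> E w}" "finite \<F>"
    show "card \<F> \<le> k"
    proof (cases "\<F> = {}")
      case False
      then obtain c where c: "c \<in> S" "\<forall>w\<in>\<F>. c \<in> w"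
        using common[of \<F> x] F by blast
      then have "\<F> \<subseteq> {w\<in>\<W>. c \<in> w}" using F by blast
      then show ?thesis
        using W'(4) c(1) by (meson card_mono order_trans)
    qed simp
  qed
  show thesis
  proof
    show "open (\<Union>w\<in>\<W>. E w)" using E by blast
    show "S \<subseteq> (\<Union>w\<in>\<W>. E w)" using E(2) W'(2) by blast
    fix T assume T: "T \<subseteq> (\<Union>w\<in>\<W>. E w)"
    show "refinable k T \<U>"
    proof (rule refinableI[where J = \<W> and W = "\<lambda>w. T \<inter> E w"])
      fix w assume w: "w \<in> \<W>"
      show "openin (top_of_set T) (T \<inter> E w)" using E(1)[OF w] by (rule openin_open_Int)
      show "\<exists>U\<in>\<U>. T \<inter> E w \<subseteq> U" using E(3)[OF w] u(1)[OF w] by blast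
    next
      show "T \<subseteq> (\<Union>w\<in>\<W>. T \<inter> E w)" using T by blast
      fix x assume "x \<in> T"
      then have "{w\<in>\<W>. x \<in> T \<inter> E w} = {w\<in>\<W>. x \<in> E w}" by blast
      then show "finite {w\<in>\<W>. x \<in> T \<inter> E w} \<and> card {w\<in>\<W>. x \<in> T \<inter> E w} \<le> k"
        using order by simp
    qed
  qed
qed

subsection \<open>Compact sets with a null family attached\<close>

text \<open>The diameters tend to 0, expressed by pairwise distances so that no boundedness has to
  be presupposed.\<close>

definition null_family :: "'i set \<Rightarrow> ('i \<Rightarrow> 'a::metric_space set) \<Rightarrow> bool" where
  "null_family I K \<longleftrightarrow> (\<forall>e>0. finite {i\<in>I. \<not> (\<forall>x\<in>K i. \<forall>y\<in>K i. dist x y < e)})"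

lemma null_familyD: "null_family I K \<Longrightarrow> 0 < e \<Longrightarrow> finite {i\<in>I. \<not> (\<forall>x\<in>K i. \<forall>y\<in>K i. dist x y < e)}"
  by (simp add: null_family_def)

lemma null_family_subset:
  assumes "null_family I K" "J \<subseteq> I"
  shows "null_family J K"
  unfolding null_family_def
proof (intro allI impI)
  fix e :: real assume "0 < e"
  show "finite {i\<in>J. \<not> (\<forall>x\<in>K i. \<forall>y\<in>K i. dist x y < e)}"
    using assms(2) by (intro finite_subset[OF _ null_familyD[OF assms(1) \<open>0 < e\<close>]]) auto
qed

text \<open>G contains a uniform neighbourhood of the compact set C, and this takes in every
  sufficiently small member that meets C.\<close>

lemma null_family_neighbourhood:
  assumes "compact C" "null_family I K" "\<And>i. i \<in> I \<Longrightarrow> K i \<inter> C \<noteq> {}" "open G" "C \<subseteq> G"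
  shows "finite {i\<in>I. \<not> K i \<subseteq> G}"
proof -
  obtain e where e: "0 < e" "(\<Union>x\<in>C. ball x e) \<subseteq> G"
    using compact_subset_open_imp_ball_epsilon_subset[OF assms(1,4,5)] by blast
  have "K i \<subseteq> G" if i: "i \<in> I" "\<forall>x\<in>K i. \<forall>y\<in>K i. dist x y < e" for i
  proof -
    obtain c where "c \<in> K i" "c \<in> C" using assms(3)[OF i(1)] by blast
    then have "K i \<subseteq> ball c e" using i(2) by auto
    then show ?thesis using e(2) \<open>c \<in> C\<close> by blast
  qed
  then have "{i\<in>I. \<not> K i \<subseteq> G} \<subseteq> {i\<in>I. \<not> (\<forall>x\<in>K i. \<forall>y\<in>K i. dist x y < e)}" by blast
  then show ?thesis
    using assms(2) e(1) unfolding null_family_def by (meson finite_subset)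
qed

text \<open>The union of a finite subcover of C is a neighbourhood of C, so only finitely many
  compact members remain to be covered.\<close>

lemma compact_null_family_Un:
  assumes "compact C" "null_family I K" "\<And>i. i \<in> I \<Longrightarrow> K i \<inter> C \<noteq> {}" "\<And>i. i \<in> I \<Longrightarrow> compact (K i)"
  shows "compact (C \<union> (\<Union>i\<in>I. K i))"
proof (rule compactI)
  fix \<G> assume G: "\<forall>B\<in>\<G>. open B" "C \<union> (\<Union>i\<in>I. K i) \<subseteq> \<Union>\<G>"
  then have "C \<subseteq> \<Union>\<G>" by blast
  then obtain \<H> where H: "\<H> \<subseteq> \<G>" "finite \<H>" "C \<subseteq> \<Union>\<H>"
    using assms(1) G(1) by (meson compactE)
  define J where "J = {i\<in>I. \<not> K i \<subseteq> \<Union>\<H>}"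
  have "open (\<Union>\<H>)" using H(1) G(1) by blast
  then have J: "finite J" "J \<subseteq> I"
    using null_family_neighbourhood[OF assms(1,2,3) _ H(3)] by (auto simp: J_def)
  then have "compact (\<Union>i\<in>J. K i)" using assms(4) by (intro compact_UN) auto
  moreover have "(\<Union>i\<in>J. K i) \<subseteq> \<Union>\<G>" using G(2) J(2) by blast
  ultimately obtain \<H>' where H': "\<H>' \<subseteq> \<G>" "finite \<H>'" "(\<Union>i\<in>J. K i) \<subseteq> \<Union>\<H>'"
    using G(1) by (meson compactE)
  have "C \<union> (\<Union>i\<in>I. K i) \<subseteq> \<Union>(\<H> \<union> \<H>')"
    using H(3) H'(3) unfolding J_def by blast
  then show "\<exists>\<C>'\<subseteq>\<G>. finite \<C>' \<and> C \<union> (\<Union>i\<in>I. K i) \<subseteq> \<Union>\<C>'"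
    using H H' by (intro exI[of _ "\<H> \<union> \<H>'"]) blast
qed

lemma refinable_null_family_Un:
  fixes C :: "'a::metric_space set"
  assumes C: "compact C" and K: "null_family I K" "\<And>i. i \<in> I \<Longrightarrow> K i \<inter> C \<noteq> {}" "\<And>i. i \<in> I \<Longrightarrow> compact (K i)"
    and fin: "\<And>i. i \<in> I \<Longrightarrow> finite (K i \<inter> C)" and dis: "\<And>i j. \<lbrakk>i \<in> I; j \<in> I; i \<noteq> j\<rbrakk> \<Longrightarrow> K i \<inter> K j \<subseteq> C"
    and refC: "\<And>\<U>. \<lbrakk>\<And>U. U \<in> \<U> \<Longrightarrow> open U; C \<subseteq> \<Union>\<U>\<rbrakk> \<Longrightarrow> refinable k C \<U>"
    and refK: "\<And>i \<U>. \<lbrakk>i \<in> I; \<And>U. U \<in> \<U> \<Longrightarrow> open U; K i \<subseteq> \<Union>\<U>\<rbrakk> \<Longrightarrow> refinable k (K i) \<U>"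
    and U: "\<And>U. U \<in> \<U> \<Longrightarrow> open U" "C \<union> (\<Union>i\<in>I. K i) \<subseteq> \<Union>\<U>"
  shows "refinable k (C \<union> (\<Union>i\<in>I. K i)) \<U>"
proof -
  have "refinable k C \<U>" using refC U by blast
  then obtain G where G: "open G" "C \<subseteq> G" "\<And>T. T \<subseteq> G \<Longrightarrow> refinable k T \<U>"
    using refinable_neighbourhood U(1) by metis
  define J where "J = {i\<in>I. \<not> K i \<subseteq> G}"
  have J: "finite J" "J \<subseteq> I"
    using null_family_neighbourhood[OF C K(1,2) G(1,2)] by (auto simp: J_def)
  \<comment> \<open>The members inside G enter all at once; the finitely many others are attached
    one at a time, where \<open>dis\<close> confines each intersection to C.\<close>
  have "refinable k (C \<union> (\<Union>i\<in>(I - J) \<union> H. K i)) \<U>" if "finite H" "H \<subseteq> J" for H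
    using that
  proof (induction H rule: finite_induct)
    case empty
    have "C \<union> (\<Union>i\<in>(I - J) \<union> {}. K i) \<subseteq> G" using G(2) by (auto simp: J_def)
    then show ?case by (rule G(3))
  next
    case (insert h H)
    let ?A = "C \<union> (\<Union>i\<in>(I - J) \<union> H. K i)"
    have h: "h \<in> I" "h \<notin> (I - J) \<union> H" and sub: "(I - J) \<union> H \<subseteq> I"
      using insert J(2) by auto
    have "compact ?A"
      using sub null_family_subset[OF K(1) sub] K by (intro compact_null_family_Un C) auto
    moreover have "finite (?A \<inter> K h)"
    proof (rule finite_subset[OF _ fin[OF h(1)]])
      show "?A \<inter> K h \<subseteq> K h \<inter> C"
        using dis[OF h(1)] h(2) sub by blast
    qed
    moreover have "?A \<union> K h \<subseteq> \<Union>\<U>"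
      using U(2) sub h(1) by blast
    moreover have "refinable k ?A \<U>"
      using insert.IH insert.prems by simp
    moreover have "refinable k (K h) \<U>'" if "\<And>U. U \<in> \<U>' \<Longrightarrow> open U" "K h \<subseteq> \<Union>\<U>'" for \<U>'
      using refK[OF h(1) that] by blast
    moreover have "closed (K h)" using K(3)[OF h(1)] by (rule compact_imp_closed)
    ultimately have "refinable k (?A \<union> K h) \<U>"
      using compact_imp_closed[of ?A] by - (rule refinable_Un_finite_Int[OF _ _ _ U(1)]; (assumption | blast))
    moreover have "?A \<union> K h = C \<union> (\<Union>i\<in>(I - J) \<union> insert h H. K i)" by blast
    ultimately show ?case by simp
  qed
  from this[OF J(1) order_refl] show ?thesis
    using J(2) by (simp add: Un_absorb2)
qed

text \<open>This is Sierpinski's property S, which is equivalent to local connectedness for compact sets.\<close>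

definition property_S :: "'a::metric_space set \<Rightarrow> bool" where
  "property_S S \<longleftrightarrow> (\<forall>e>0. \<exists>\<A>. finite \<A> \<and> \<Union>\<A> = S \<and> (\<forall>A\<in>\<A>. connected A \<and> (\<forall>x\<in>A. \<forall>y\<in>A. dist x y < e)))"

text \<open>Around x discard the closures of the pieces that do not have x in their closure. Any
  other point lies in a piece B with x in its closure, and \<open>insert x B\<close> is connected
  and small. This is connectedness im kleinen, which suffices when it holds at every point.\<close>

lemma property_S_imp_locally_connected:
  assumes S: "property_S S"
  shows "locally_connected_space (top_of_set S)"
  unfolding locally_connected_space_im_kleinen
proof (intro allI impI)
  fix V x assume V: "openin (top_of_set S) V \<and> x \<in> V"
  then obtain e where e: "0 < e" "S \<inter> ball x e \<subseteq> V"
    by (metis inf_commute openin_contains_ball)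
  have xS: "x \<in> S" using V openin_imp_subset by blast
  obtain \<A> where A: "finite \<A>" "\<Union>\<A> = S" "\<And>A. A \<in> \<A> \<Longrightarrow> connected A"
    "\<And>A x y. \<lbrakk>A \<in> \<A>; x \<in> A; y \<in> A\<rbrakk> \<Longrightarrow> dist x y < e / 2"
    using S[unfolded property_S_def, rule_format, of "e/2"] e(1) by (metis half_gt_zero)
  define F where "F = (\<Union>A\<in>{A\<in>\<A>. x \<notin> closure A}. closure A)"
  have F: "closed F" unfolding F_def using A(1) by (intro closed_UN) auto
  define U where "U = V \<inter> - F"
  have "openin (top_of_set S) U" "x \<in> U" "U \<subseteq> V"
    using V openin_Int_open[OF _ open_Compl[OF F]] unfolding U_def by (auto simp: F_def)
  moreover have "\<exists>C. connectedin (top_of_set S) C \<and> C \<subseteq> V \<and> x \<in> C \<and> y \<in> C" if y: "y \<in> U" for y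
  proof -
    have "y \<in> S" using y V openin_imp_subset unfolding U_def by blast
    then obtain B where B: "B \<in> \<A>" "y \<in> B" using A(2) by blast
    then have xB: "x \<in> closure B"
      using y closure_subset by (auto simp: U_def F_def)
    have "connected (insert x B)"
      using connected_intermediate_closure[OF A(3)[OF B(1)], of "insert x B"] xB closure_subset[of B] by blast
    moreover have "insert x B \<subseteq> S" using B(1) A(2) xS by blast
    moreover have "z \<in> V" if "z \<in> B" for z
    proof -
      obtain b where "b \<in> B" "dist b x < e / 2"
        using xB e(1) by (meson closure_approachable half_gt_zero)
      then have "dist x z < e"
        using A(4)[OF B(1) \<open>b \<in> B\<close> that] dist_triangle3[of x z b] by linarith
      then show ?thesis using e(2) that B(1) A(2) by auto
    qed
    ultimately show ?thesis
      using B(2) V by (intro exI[of _ "insert x B"]) (auto simp: connectedin_subtopology)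
  qed
  ultimately show "\<exists>U. openin (top_of_set S) U \<and> x \<in> U \<and> U \<subseteq> V \<and>
      (\<forall>y\<in>U. \<exists>C. connectedin (top_of_set S) C \<and> C \<subseteq> V \<and> x \<in> C \<and> y \<in> C)"
    by blast
qed

text \<open>The union of all small connected sets through t is itself connected and small; finitely
  many t suffice by compactness and uniform local connectedness.\<close>

lemma compact_locally_connected_imp_property_S:
  assumes S: "compact S" "locally_connected_space (top_of_set S)"
  shows "property_S S"
  unfolding property_S_def
proof (intro allI impI)
  fix e :: real assume "0 < e"
  obtain d where d: "0 < d" "\<And>x y. \<lbrakk>x \<in> S; y \<in> S; dist x y < d\<rbrakk> \<Longrightarrow>
      \<exists>A\<subseteq>S. connected A \<and> x \<in> A \<and> y \<in> A \<and> (\<forall>u\<in>A. \<forall>v\<in>A. dist u v < e/2)"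
    using compact_uniformly_locally_connected[OF S, of "e/2"] \<open>0 < e\<close> by (metis half_gt_zero)
  obtain T where T: "finite T" "T \<subseteq> S" "S \<subseteq> (\<Union>t\<in>T. ball t d)"
    using compactE_image[OF S(1), of S "\<lambda>t. ball t d"] d(1) by (metis UN_I centre_in_ball open_ball subsetI)
  define A where "A t = \<Union>{A. A \<subseteq> S \<and> connected A \<and> t \<in> A \<and> (\<forall>u\<in>A. \<forall>v\<in>A. dist u v < e/2)}" for t
  have "connected (A t)" for t
    unfolding A_def by (rule connected_Union) auto
  moreover have "dist x y < e" if "x \<in> A t" "y \<in> A t" for x y t
  proof -
    have "dist t x < e/2" "dist t y < e/2" using that by (auto simp: A_def)
    then show ?thesis using dist_triangle_half_r by blast
  qed
  moreover have "\<Union>(A ` T) = S"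
  proof
    show "\<Union>(A ` T) \<subseteq> S" by (auto simp: A_def)
    show "S \<subseteq> \<Union>(A ` T)"
    proof
      fix x assume x: "x \<in> S"
      then obtain t where t: "t \<in> T" "dist t x < d" using T(3) by auto
      then have "x \<in> A t" using d(2)[of t x] x T(2) by (auto simp: A_def)
      then show "x \<in> \<Union>(A ` T)" using t(1) by blast
    qed
  qed
  ultimately show "\<exists>\<A>. finite \<A> \<and> \<Union>\<A> = S \<and> (\<forall>A\<in>\<A>. connected A \<and> (\<forall>x\<in>A. \<forall>y\<in>A. dist x y < e))"
    using T(1) by (intro exI[of _ "A ` T"]) auto
qed

text \<open>Every \<open>Q y\<close> runs from the hub t to y, and the members through y hang on it,
  so all parts share t.\<close>

lemma connected_star:
  assumes "\<And>y. y \<in> D \<Longrightarrow> connected (Q y) \<and> t \<in> Q y \<and> y \<in> Q y" "\<And>i. i \<in> I \<Longrightarrow> connected (K i)"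
  shows "connected (\<Union>y\<in>D. Q y \<union> (\<Union>i\<in>{i\<in>I. y \<in> K i}. K i))"
proof (rule connected_Union)
  fix S assume "S \<in> (\<lambda>y. Q y \<union> (\<Union>i\<in>{i\<in>I. y \<in> K i}. K i)) ` D"
  then obtain y where y: "y \<in> D" "S = Q y \<union> (\<Union>i\<in>{i\<in>I. y \<in> K i}. K i)" by blast
  have "S = \<Union>(insert (Q y) (K ` {i\<in>I. y \<in> K i}))" using y(2) by blast
  also have "connected \<dots>"
    using assms y(1) by (intro connected_Union) auto
  finally show "connected S" .
next
  show "\<Inter>((\<lambda>y. Q y \<union> (\<Union>i\<in>{i\<in>I. y \<in> K i}. K i)) ` D) \<noteq> {}"
  proof (cases "D = {}")
    case False
    have "t \<in> \<Inter>((\<lambda>y. Q y \<union> (\<Union>i\<in>{i\<in>I. y \<in> K i}. K i)) ` D)"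
      using assms(1) by blast
    then show ?thesis by blast
  qed simp
qed

text \<open>Close points of C are joined in the whole union, since C itself may be disconnected. A
  piece collects such joins from a net point t together with the small members through their ends;
  the finitely many large members are cut up by their own property S.\<close>

lemma property_S_null_family_Un:
  fixes C :: "'a::metric_space set"
  defines "X \<equiv> \<lambda>I K. C \<union> (\<Union>i\<in>I. K i)"
  assumes C: "compact C" and K: "null_family I K" "\<And>i. i \<in> I \<Longrightarrow> K i \<inter> C \<noteq> {}"
      "\<And>i. i \<in> I \<Longrightarrow> connected (K i)" "\<And>i. i \<in> I \<Longrightarrow> property_S (K i)"
    and Q: "\<And>e. 0 < e \<Longrightarrow> \<exists>d>0. \<forall>x\<in>C. \<forall>y\<in>C. dist x y < d \<longrightarrow>
      (\<exists>Q\<subseteq>X I K. connected Q \<and> x \<in> Q \<and> y \<in> Q \<and> (\<forall>u\<in>Q. \<forall>v\<in>Q. dist u v < e))"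
  shows "property_S (X I K)"
  unfolding property_S_def
proof (intro allI impI)
  fix e :: real assume e: "0 < e"
  then obtain d where d: "0 < d" "\<forall>x\<in>C. \<forall>y\<in>C. dist x y < d \<longrightarrow>
      (\<exists>Q\<subseteq>X I K. connected Q \<and> x \<in> Q \<and> y \<in> Q \<and> (\<forall>u\<in>Q. \<forall>v\<in>Q. dist u v < e/8))"
    using Q[of "e/8"] by auto
  \<comment> \<open>Two summands of e/8, from t to an attaching point y and from y along a small
    member, give the radius e/4 of a piece.\<close>
  define d' where "d' = min d (e/8)"
  have d': "0 < d'" "d' \<le> d" "d' \<le> e/8" using d(1) e by (auto simp: d'_def)
  obtain T where T: "finite T" "T \<subseteq> C" "C \<subseteq> (\<Union>t\<in>T. ball t d')"
    using compactE_image[OF C, of C "\<lambda>t. ball t d'"] d'(1) by (metis UN_I centre_in_ball open_ball subsetI)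
  obtain q where q: "\<And>x y. \<lbrakk>x \<in> C; y \<in> C; dist x y < d\<rbrakk> \<Longrightarrow> q x y \<subseteq> X I K \<and> connected (q x y) \<and> x \<in> q x y \<and> y \<in> q x y
      \<and> (\<forall>u\<in>q x y. \<forall>v\<in>q x y. dist u v < e/8)"
    using d(2) by metis
  define I' where "I' = {i\<in>I. \<forall>x\<in>K i. \<forall>y\<in>K i. dist x y < e/8}"
  have fin: "finite (I - I')"
  proof -
    have "I - I' = {i\<in>I. \<not> (\<forall>x\<in>K i. \<forall>y\<in>K i. dist x y < e/8)}" by (auto simp: I'_def)
    moreover have "finite \<dots>" using null_familyD[OF K(1), of "e/8"] e by simp
    ultimately show ?thesis by simp
  qed
  define B where "B t = (\<Union>y\<in>C \<inter> ball t d'. q t y \<union> (\<Union>i\<in>{i\<in>I'. y \<in> K i}. K i))" for t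
  have B: "connected (B t)" "B t \<subseteq> X I K" "\<And>x. x \<in> B t \<Longrightarrow> dist t x < e/4" if t: "t \<in> T" for t
  proof -
    have tC: "t \<in> C" using t T(2) by blast
    have q': "q t y \<subseteq> X I K \<and> connected (q t y) \<and> t \<in> q t y \<and> y \<in> q t y \<and> (\<forall>u\<in>q t y. \<forall>v\<in>q t y. dist u v < e/8)"
      if "y \<in> C \<inter> ball t d'" for y
      using that d'(2) by (intro q tC) auto
    show "connected (B t)"
      unfolding B_def using q' K(3) by (intro connected_star) (auto simp: I'_def)
    show "B t \<subseteq> X I K"
    proof
      fix x assume "x \<in> B t"
      then obtain y where y: "y \<in> C \<inter> ball t d'" "x \<in> q t y \<or> (\<exists>i\<in>I'. x \<in> K i)"
        unfolding B_def by blast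
      then show "x \<in> X I K"
        using q'[OF y(1)] by (auto simp: I'_def X_def)
    qed
    fix x assume "x \<in> B t"
    then obtain y where y: "y \<in> C \<inter> ball t d'" "x \<in> q t y \<or> (\<exists>i\<in>I'. y \<in> K i \<and> x \<in> K i)"
      unfolding B_def by blast
    from y(2) show "dist t x < e/4"
    proof
      assume "x \<in> q t y"
      then have "dist t x < e/8" using q'[OF y(1)] by blast
      then show ?thesis using e by simp
    next
      assume "\<exists>i\<in>I'. y \<in> K i \<and> x \<in> K i"
      then have "dist y x < e/8" by (auto simp: I'_def)
      then show ?thesis using y(1) d'(3) dist_triangle[of t x y] by auto
    qed
  qed
  have "\<forall>i\<in>I - I'. \<exists>\<A>. finite \<A> \<and> \<Union>\<A> = K i \<and> (\<forall>A\<in>\<A>. connected A \<and> (\<forall>x\<in>A. \<forall>y\<in>A. dist x y < e))"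
    using K(4) e unfolding property_S_def by blast
  then obtain a where a: "\<And>i. i \<in> I - I' \<Longrightarrow> finite (a i)" "\<And>i. i \<in> I - I' \<Longrightarrow> \<Union>(a i) = K i"
    "\<And>i A. \<lbrakk>i \<in> I - I'; A \<in> a i\<rbrakk> \<Longrightarrow> connected A \<and> (\<forall>x\<in>A. \<forall>y\<in>A. dist x y < e)"
    by metis
  define \<A> where "\<A> = B ` T \<union> (\<Union>i\<in>I - I'. a i)"
  have "finite \<A>" unfolding \<A>_def using T(1) fin a(1) by blast
  moreover have "\<Union>\<A> = X I K"
  proof
    show "\<Union>\<A> \<subseteq> X I K"
      unfolding \<A>_def using B(2) a(2) by (fastforce simp: X_def)
    show "X I K \<subseteq> \<Union>\<A>"
    proof
      have inB: "\<exists>t\<in>T. y \<in> C \<inter> ball t d'" if "y \<in> C" for y using T(3) that by blast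
      fix x assume "x \<in> X I K"
      then consider "x \<in> C" | i where "i \<in> I'" "x \<in> K i" | i where "i \<in> I - I'" "x \<in> K i"
        unfolding X_def by blast
      then show "x \<in> \<Union>\<A>"
      proof cases
        case 1
        then obtain t where t: "t \<in> T" "x \<in> C \<inter> ball t d'" using inB by blast
        then have "x \<in> q t x" using q[of t x] T(2) d'(2) by auto
        then have "x \<in> B t" using t(2) unfolding B_def by blast
        then show ?thesis using t(1) by (auto simp: \<A>_def)
      next
        case 2
        then have "K i \<inter> C \<noteq> {}" using K(2)[of i] by (simp add: I'_def)
        then obtain y where y: "y \<in> K i" "y \<in> C" by blast
        then obtain t where t: "t \<in> T" "y \<in> C \<inter> ball t d'" using inB by blast
        then have "x \<in> B t" using 2 y(1) unfolding B_def by blast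
        then show ?thesis using t(1) by (auto simp: \<A>_def)
      next
        case 3
        then have "x \<in> \<Union>(a i)" using a(2) by simp
        then show ?thesis using 3(1) by (auto simp: \<A>_def)
      qed
    qed
  qed
  moreover have "connected A \<and> (\<forall>x\<in>A. \<forall>y\<in>A. dist x y < e)" if "A \<in> \<A>" for A
    using that unfolding \<A>_def
  proof
    assume "A \<in> B ` T"
    then obtain t where t: "t \<in> T" "A = B t" by blast
    have "dist x y < e" if "x \<in> B t" "y \<in> B t" for x y
      using B(3)[OF t(1) that(1)] B(3)[OF t(1) that(2)] dist_triangle3[of x y t] e by linarith
    then show ?thesis using B(1) t by blast
  next
    assume "A \<in> (\<Union>i\<in>I - I'. a i)"
    then show ?thesis using a(3) by blast
  qed
  ultimately show "\<exists>\<A>. finite \<A> \<and> \<Union>\<A> = X I K \<and> (\<forall>A\<in>\<A>. connected A \<and> (\<forall>x\<in>A. \<forall>y\<in>A. dist x y < e))"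
    by (intro exI[of _ \<A>] conjI) simp_all
qed

lemma connected_null_family_Un:
  assumes "t \<in> C" "\<And>i. i \<in> I \<Longrightarrow> K i \<inter> C \<noteq> {}" "\<And>i. i \<in> I \<Longrightarrow> connected (K i)"
    and Q: "\<And>y. y \<in> C \<Longrightarrow> \<exists>Q\<subseteq>C \<union> (\<Union>i\<in>I. K i). connected Q \<and> t \<in> Q \<and> y \<in> Q"
  shows "connected (C \<union> (\<Union>i\<in>I. K i))"
proof -
  have "\<forall>y\<in>C. \<exists>Q. Q \<subseteq> C \<union> (\<Union>i\<in>I. K i) \<and> connected Q \<and> t \<in> Q \<and> y \<in> Q"
    using Q by blast
  from bchoice[OF this] obtain q where "\<forall>y\<in>C. q y \<subseteq> C \<union> (\<Union>i\<in>I. K i) \<and> connected (q y) \<and> t \<in> q y \<and> y \<in> q y"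
    by (elim exE)
  note q = bspec[OF this]
  have "C \<union> (\<Union>i\<in>I. K i) = (\<Union>y\<in>C. q y \<union> (\<Union>i\<in>{i\<in>I. y \<in> K i}. K i))"
  proof (intro equalityI subsetI)
    fix x assume "x \<in> C \<union> (\<Union>i\<in>I. K i)"
    then consider "x \<in> C" | i where "i \<in> I" "x \<in> K i" by blast
    then show "x \<in> (\<Union>y\<in>C. q y \<union> (\<Union>i\<in>{i\<in>I. y \<in> K i}. K i))"
    proof cases
      case 1
      then show ?thesis using q by blast
    next
      case 2
      then obtain y where "y \<in> C" "y \<in> K i" using assms(2) by blast
      then show ?thesis using 2 by blast
    qed
  next
    fix x assume "x \<in> (\<Union>y\<in>C. q y \<union> (\<Union>i\<in>{i\<in>I. y \<in> K i}. K i))"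
    then show "x \<in> C \<union> (\<Union>i\<in>I. K i)" using q by blast
  qed
  moreover have "connected (\<Union>y\<in>C. q y \<union> (\<Union>i\<in>{i\<in>I. y \<in> K i}. K i))"
    using q assms(3) by (intro connected_star) auto
  ultimately show ?thesis by simp
qed

subsection \<open>The metric of the sequence space\<close>

lemma summable_dist_fun: "summable (\<lambda>n. (1/2)^n * min (dist (x (from_nat n :: 'a::countable)) (y (from_nat n) :: 'b::metric_space)) 1)"
  by (rule summable_comparison_test'[of "\<lambda>n. (1/2)^n"]) (auto simp: summable_geometric_iff)

lemma dist_fun_mono:
  fixes x y x' y' :: "nat \<Rightarrow> real"
  assumes "\<And>i. \<bar>x i - y i\<bar> \<le> \<bar>x' i - y' i\<bar>"
  shows "dist x y \<le> dist x' y'"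
  unfolding dist_fun_def
  using assms by (intro suminf_le summable_dist_fun mult_left_mono min.mono) (auto simp: dist_real_def)

text \<open>The weights of the metric add up to 2.\<close>

lemma dist_fun_le:
  fixes x y :: "nat \<Rightarrow> real"
  assumes "\<And>i. \<bar>x i - y i\<bar> \<le> c"
  shows "dist x y \<le> 2 * c"
proof -
  have c: "0 \<le> c" using assms[of 0] by linarith
  have s: "(\<lambda>n. (1/2)^n * c) sums (2 * c)"
    using sums_mult2[OF geometric_sums[of "1/2::real"], of c] by simp
  have "dist x y \<le> suminf (\<lambda>n. (1/2)^n * c)"
    unfolding dist_fun_def
  proof (intro suminf_le summable_dist_fun)
    show "(1/2)^n * min (dist (x (from_nat n)) (y (from_nat n))) 1 \<le> (1/2)^n * c" for n
      using assms[of "from_nat n"] by (intro mult_left_mono) (auto simp: dist_real_def)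
    show "summable (\<lambda>n. (1/2)^n * c)" using s by (rule sums_summable)
  qed
  then show ?thesis using s by (simp add: sums_iff)
qed

lemma dist_fun_le_2: "dist x y \<le> (2::real)" for x y :: "nat \<Rightarrow> real"
proof -
  have s: "(\<lambda>n. (1/2)^n) sums (2::real)"
    using geometric_sums[of "1/2::real"] by simp
  have "dist x y \<le> suminf (\<lambda>n. (1/2)^n)"
    unfolding dist_fun_def
    by (intro suminf_le summable_dist_fun sums_summable[OF s]) (simp add: mult_le_cancel_left1)
  then show ?thesis using s by (simp add: sums_iff)
qed

lemma continuous_on_coordinate [continuous_intros]: "continuous_on S (\<lambda>x::nat \<Rightarrow> real. x i)"
  by (rule continuous_on_subset[OF continuous_on_product_coordinates]) simp

lemma compact_cube: "compact {x :: nat \<Rightarrow> real. \<forall>i. a i \<le> x i \<and> x i \<le> b i}"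
proof -
  have "{x. \<forall>i. a i \<le> x i \<and> x i \<le> b i} = PiE UNIV (\<lambda>i. {a i..b i})" by auto
  moreover have "compactin (powertop_real UNIV) (PiE UNIV (\<lambda>i. {a i..b i}))"
    by (simp add: compactin_PiE)
  ultimately show ?thesis by (simp add: euclidean_product_topology)
qed

subsection \<open>Topology of spheres\<close>

lemma compact_nsphere: "compact (topspace (nsphere n))"
proof -
  have "closed {x::nat \<Rightarrow> real. (\<Sum>i\<le>n. (x i)\<^sup>2) = 1 \<and> (\<forall>i>n. x i = 0)}"
    by (intro closed_Collect_conj closed_Collect_all closed_Collect_imp closed_Collect_eq continuous_intros open_Collect_const)
  then have cl: "closed (topspace (nsphere n))" by (simp add: topspace_nsphere)
  have "topspace (nsphere n) \<subseteq> {x. \<forall>i. - 1 \<le> x i \<and> x i \<le> 1}"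
    using nsphere_first_coordinate(1) by (fastforce simp: abs_le_iff)
  then have eq: "topspace (nsphere n) \<inter> {x. \<forall>i. - 1 \<le> x i \<and> x i \<le> 1} = topspace (nsphere n)" by blast
  show ?thesis
    using closed_Int_compact[OF cl compact_cube[of "\<lambda>_. -1" "\<lambda>_. 1"]] unfolding eq .
qed

text \<open>Normalizing retracts the open set of nonzero vectors of Euclidean space onto the sphere,
  and local connectedness passes to retracts.\<close>

lemma locally_connected_nsphere: "locally_connected_space (nsphere n)"
proof -
  let ?E = "Euclidean_space (Suc n)"
  let ?Y = "subtopology ?E {x. (\<Sum>j\<le>n. (x j)\<^sup>2) \<noteq> 0}"
  have proj: "continuous_map ?E euclideanreal (\<lambda>x. x i)" for i
    unfolding Euclidean_space_def
    by (intro continuous_map_from_subtopology continuous_map_product_projection) auto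
  have "openin ?E {x \<in> topspace ?E. (\<Sum>j\<le>n. (x j)\<^sup>2) \<in> - {0}}"
    by (intro openin_continuous_map_preimage[of _ euclideanreal] continuous_intros proj) auto
  moreover have "{x \<in> topspace ?E. (\<Sum>j\<le>n. (x j)\<^sup>2) \<in> - {0}} = topspace ?E \<inter> {x. (\<Sum>j\<le>n. (x j)\<^sup>2) \<noteq> 0}" by auto
  ultimately have "openin ?E (topspace ?E \<inter> {x. (\<Sum>j\<le>n. (x j)\<^sup>2) \<noteq> 0})" by simp
  then have "locally_connected_space (subtopology ?E (topspace ?E \<inter> {x. (\<Sum>j\<le>n. (x j)\<^sup>2) \<noteq> 0}))"
    by (intro locally_connected_space_open_subset locally_path_connected_imp_locally_connected_space
        locally_path_connected_Euclidean_space)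
  then have Y: "locally_connected_space ?Y"
    by (simp add: subtopology_restrict)
  have "continuous_map ?Y (nsphere n) (\<lambda>x. sphere_normalize n x)"
    by (intro continuous_map_sphere_normalize continuous_map_from_subtopology proj) auto
  moreover have "continuous_map (nsphere n) ?Y (\<lambda>x. x)"
    unfolding continuous_map_in_subtopology nsphere_def by (auto intro!: continuous_map_from_subtopology)
  ultimately have "retraction_maps ?Y (nsphere n) (\<lambda>x. sphere_normalize n x) (\<lambda>x. x)"
    by (auto simp: retraction_maps_def sphere_normalize_id)
  then show ?thesis
    using locally_connected_space_retraction_map_image[of ?Y "nsphere n"] Y unfolding retraction_map_def by blast
qed

text \<open>The sphere without its pole is the image of a cell, and it covers the sphere together
  with its antipodal copy. The two meet in p, a point other than the two poles, which exists because
  n is at least 1.\<close>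

lemma connected_nsphere:
  assumes "1 \<le> n"
  shows "connected (topspace (nsphere n))"
proof -
  let ?S = "topspace (nsphere n)"
  define A where "A = ?S - {sphere_base}"
  have sub: "stereo_inv n ` topspace (Euclidean_space n) = A"
  proof
    show "stereo_inv n ` topspace (Euclidean_space n) \<subseteq> A"
      by (auto simp: A_def stereo_inv_in_nsphere stereo_inv_neq_base)
    show "A \<subseteq> stereo_inv n ` topspace (Euclidean_space n)"
    proof
      fix x assume "x \<in> A"
      then have "x = stereo_inv n (stereo n x)" by (simp add: A_def stereo_inv_stereo)
      moreover have "stereo n x \<in> topspace (Euclidean_space n)"
        by (simp add: topspace_Euclidean_space stereo_def)
      ultimately show "x \<in> stereo_inv n ` topspace (Euclidean_space n)" by blast
    qed
  qed
  have "continuous_map (Euclidean_space n) (nsphere n) (stereo_inv n)"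
    using homeomorphic_maps_stereo continuous_map_into_fulltopology unfolding homeomorphic_maps_def by blast
  then have "connectedin (nsphere n) A"
    using connectedin_continuous_map_image connected_Euclidean_space sub by (metis connectedin_topspace)
  then have A: "connected A"
    by (metis connectedin_iff_connected connectedin_subtopology nsphere_top_of_set)
  define m where "m = (\<lambda>(x::nat \<Rightarrow> real) i. - x i)"
  have "continuous_on A m"
    unfolding m_def by (intro continuous_on_coordinatewise_then_product continuous_intros)
  then have mA: "connected (m ` A)" using A by (rule connected_continuous_image)
  have mS: "m x \<in> ?S" if "x \<in> ?S" for x using that by (simp add: m_def topspace_nsphere)
  define p :: "nat \<Rightarrow> real" where "p = (\<lambda>i. if i = 1 then 1 else 0)"
  have "p \<in> ?S"
    using assms by (simp add: p_def topspace_nsphere if_distrib[of "\<lambda>x. x\<^sup>2"] cong: if_cong)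
  then have "p \<in> A" "m p \<in> A"
    using mS by (auto simp: A_def p_def m_def sphere_base_def fun_eq_iff)
  moreover have "m (m p) = p" by (simp add: m_def)
  ultimately have "p \<in> A" "p \<in> m ` A" by (auto intro: image_eqI[of _ _ "m p"])
  then have "connected (A \<union> m ` A)"
    using A mA by (intro connected_Un) auto
  moreover have "A \<union> m ` A = ?S"
  proof
    show "A \<union> m ` A \<subseteq> ?S" using mS by (auto simp: A_def)
    have "m sphere_base \<in> A"
      using mS[OF sphere_base_in_nsphere] by (auto simp: A_def m_def sphere_base_def fun_eq_iff)
    moreover have "m (m sphere_base) = sphere_base" by (simp add: m_def)
    ultimately have "sphere_base \<in> m ` A" by (metis image_eqI)
    then show "?S \<subseteq> A \<union> m ` A" by (auto simp: A_def)
  qed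
  ultimately show ?thesis by simp
qed

lemma not_null_homotopic_id_nsphere: "\<not> null_homotopic (nsphere n) (nsphere n) id"
  using non_contractible_space_nsphere[of n] by (simp add: null_homotopic_def contractible_space_def id_def)

subsection \<open>Dimension of spheres\<close>

text \<open>Kuhn stars are pulled back by stereographic projection. All stars that miss the compact
  set \<open>L\<close> are merged with the pole into one member inside \<open>U0\<close>; merging
  cannot raise the order n + 1 of the stars.\<close>

lemma refinable_nsphere:
  assumes U: "\<And>U. U \<in> \<U> \<Longrightarrow> open U" "topspace (nsphere n) \<subseteq> \<Union>\<U>"
  shows "refinable (Suc n) (topspace (nsphere n)) \<U>"
proof -
  let ?S = "topspace (nsphere n)"
  let ?s = sphere_base
  have sS: "?s \<in> ?S" by (rule sphere_base_in_nsphere)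
  obtain U0 where U0: "U0 \<in> \<U>" "?s \<in> U0" using sS U(2) by blast
  define L where "L = ?S - U0"
  have L: "compact L" unfolding L_def using compact_nsphere U(1)[OF U0(1)] by (rule compact_diff)
  have less1: "x 0 < 1" if "x \<in> ?S" "x \<noteq> ?s" for x
    using nsphere_first_coordinate(1)[OF that(1), of 0] that(2) nsphere_first_coordinate(2)[OF that(1)] by linarith
  \<comment> \<open>Coordinates on the sphere are at most 1 in modulus, so R bounds every coordinate
    of the projection of \<open>L\<close>.\<close>
  obtain R where R: "0 < R" "\<And>x. x \<in> L \<Longrightarrow> 1 / (1 - x 0) \<le> R"
  proof (cases "L = {}")
    case True
    then show thesis using that[of 1] by auto
  next
    case False
    have "continuous_on L (\<lambda>x. x 0)" by (intro continuous_intros)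
    then obtain z where z: "z \<in> L" "\<forall>x\<in>L. x 0 \<le> z 0"
      using continuous_attains_sup[OF L False] by blast
    have "z 0 < 1" using z(1) U0(2) by (intro less1) (auto simp: L_def)
    then show thesis
      using z by (intro that[of "1 / (1 - z 0)"]) (auto intro!: divide_left_mono mult_pos_pos)
  qed
  obtain \<mu> where \<mu>: "0 < \<mu>" "\<And>x. x \<in> ?S \<Longrightarrow> \<exists>U\<in>\<U>. ball x \<mu> \<subseteq> U"
    using Heine_Borel_lemma[OF compact_nsphere U(2) U(1)] by blast
  \<comment> \<open>The stars that meet \<open>L\<close> have width at most 2 in each coordinate, so
    a cube of half-width R + 2 contains their projections; on it \<open>stereo_inv\<close> is
    uniformly continuous.\<close>
  define B where "B = {y :: nat \<Rightarrow> real. \<forall>i. (if i < n then - (R + 2) else 0) \<le> y i \<and> y i \<le> (if i < n then R + 2 else 0)}"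
  have B: "y \<in> B \<longleftrightarrow> (\<forall>i<n. \<bar>y i\<bar> \<le> R + 2) \<and> (\<forall>i\<ge>n. y i = 0)" for y
  proof -
    have "(\<forall>i. (if i < n then - (R + 2) else 0) \<le> y i \<and> y i \<le> (if i < n then R + 2 else 0))
      \<longleftrightarrow> (\<forall>i. if i < n then \<bar>y i\<bar> \<le> R + 2 else y i = 0)"
      by (intro all_cong1) (auto simp: abs_le_iff)
    then show ?thesis unfolding B_def by (simp add: not_less) (metis not_less)
  qed
  have cB: "compact B" unfolding B_def by (rule compact_cube)
  have ne: "(\<Sum>j<n. (y j)\<^sup>2) + 1 \<noteq> 0" for y :: "nat \<Rightarrow> real"
    using sum_nonneg[of "{..<n}" "\<lambda>j. (y j)\<^sup>2"] by auto
  have "continuous_on B (\<lambda>y. stereo_inv n y i)" for i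
    unfolding stereo_inv_def by (cases "i = 0"; cases "i \<le> n") (simp_all, (intro continuous_intros ballI ne | simp)+)
  then have "continuous_on B (stereo_inv n)"
    by (intro continuous_on_coordinatewise_then_product)
  then have "uniformly_continuous_on B (stereo_inv n)"
    using cB by (rule compact_uniformly_continuous)
  then obtain \<eta> where \<eta>: "0 < \<eta>" "\<And>y z. \<lbrakk>y \<in> B; z \<in> B; dist z y < \<eta>\<rbrakk> \<Longrightarrow> dist (stereo_inv n z) (stereo_inv n y) < \<mu>"
    unfolding uniformly_continuous_on_def using \<mu>(1) by metis
  \<comment> \<open>Points of one star differ by at most 2 * \<epsilon> in each coordinate, hence by
    at most 4 * \<epsilon> in the metric; 5 makes the comparison with \<eta> strict.\<close>
  define \<epsilon> where "\<epsilon> = min 1 (\<eta> / 5)"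
  have \<epsilon>: "0 < \<epsilon>" "\<epsilon> \<le> 1" "4 * \<epsilon> < \<eta>" using \<eta>(1) by (auto simp: \<epsilon>_def)
  define Z where "Z = {v :: nat \<Rightarrow> int. \<forall>i\<ge>n. v i = 0}"
  define P where "P v = {x \<in> ?S - {?s}. stereo n x \<in> kuhn_star n \<epsilon> v}" for v
  define M where "M = {v \<in> Z. P v \<inter> L \<noteq> {}}"
  define V where "V = case_option ({?s} \<union> (\<Union>v\<in>Z - M. P v)) P"
  have LS: "L \<subseteq> ?S - {?s}" using U0(2) by (auto simp: L_def)
  have stL: "\<bar>stereo n x i\<bar> \<le> R" if "x \<in> L" "i < n" for x i
  proof -
    have x: "x \<in> ?S" "x 0 < 1" using that LS less1 by auto
    have "\<bar>stereo n x i\<bar> = \<bar>x (Suc i)\<bar> * (1 / (1 - x 0))"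
      using that x by (simp add: stereo_def abs_divide)
    also have "\<dots> \<le> 1 * (1 / (1 - x 0))"
      using nsphere_first_coordinate(1)[OF x(1)] x(2) by (intro mult_right_mono) auto
    also have "\<dots> \<le> R" using R(2)[OF that(1)] by simp
    finally show ?thesis .
  qed
  have st0: "stereo n x i = 0" if "i \<ge> n" for x i using that by (simp add: stereo_def)
  have M: "\<bar>stereo n x i\<bar> < R + 2" if "v \<in> M" "x \<in> P v" "i < n" for v x i
  proof -
    have "P v \<inter> L \<noteq> {}" using that(1) by (simp add: M_def)
    then obtain z where z: "z \<in> L" "z \<in> P v" by blast
    have "\<bar>stereo n x i - stereo n z i\<bar> < 2 * \<epsilon>"
      using that z by (intro kuhn_star_dist[of \<epsilon> _ n v]) (auto simp: P_def \<epsilon>)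
    then show ?thesis using stL[OF z(1) that(3)] \<epsilon>(2) by linarith
  qed
  have Pcover: "\<exists>v\<in>Z. x \<in> P v" if "x \<in> ?S - {?s}" for x
    using that kuhn_star_cover[of "stereo n x" n \<epsilon>]
    by (intro bexI[of _ "\<lambda>i. if i < n then \<lfloor>stereo n x i / \<epsilon>\<rfloor> else 0"]) (auto simp: P_def Z_def)
  have Popen: "openin (top_of_set ?S) (P v)" for v
  proof -
    have "continuous_map (subtopology (nsphere n) (- {?s})) euclidean (stereo n)"
      using homeomorphic_maps_stereo[of n] unfolding homeomorphic_maps_def Euclidean_space_def euclidean_product_topology
      by (auto dest: continuous_map_into_fulltopology)
    then have "openin (subtopology (nsphere n) (- {?s})) {x \<in> topspace (subtopology (nsphere n) (- {?s})). stereo n x \<in> kuhn_star n \<epsilon> v}"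
      using open_kuhn_star[of n \<epsilon> v] by (intro openin_continuous_map_preimage) auto
    moreover have "{x \<in> topspace (subtopology (nsphere n) (- {?s})). stereo n x \<in> kuhn_star n \<epsilon> v} = P v"
      by (auto simp: P_def)
    moreover have "openin (nsphere n) (?S \<inter> - {?s})"
      by (subst nsphere_top_of_set) (intro openin_open_Int, auto)
    ultimately have "openin (nsphere n) (P v)"
      by (metis openin_trans_full subtopology_restrict)
    then show ?thesis by (metis nsphere_top_of_set)
  qed
  show ?thesis
  proof (rule refinableI[where J = "insert None (Some ` M)" and W = V])
    fix j assume "j \<in> insert None (Some ` M)"
    then consider "j = None" | v where "j = Some v" "v \<in> M" by blast
    then show "openin (top_of_set ?S) (V j)"
    proof cases
      case 1
      \<comment> \<open>By \<open>stereo_norm\<close> this is the pole together with the points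
        whose projection has squared length above n times the square of R + 2, out of reach of all
        stars in \<open>M\<close>. It is the neighbourhood of the pole that makes
        \<open>V None\<close> open.\<close>
      define N where "N = ?S \<inter> {x. real n * (R + 2)\<^sup>2 * (1 - x 0) < 1 + x 0}"
      have "openin (top_of_set ?S) N"
        unfolding N_def by (intro openin_open_Int open_Collect_less continuous_intros)
      moreover have "?s \<in> N" using sS by (simp add: N_def sphere_base_def)
      moreover have "N \<subseteq> V None"
      proof
        fix x assume x: "x \<in> N"
        show "x \<in> V None"
        proof (cases "x = ?s")
          case False
          then have xS: "x \<in> ?S - {?s}" using x by (simp add: N_def)
          obtain v where v: "v \<in> Z" "x \<in> P v" using Pcover[OF xS] by blast
          have "v \<notin> M"
          proof
            assume "v \<in> M"
            have "(1 + x 0) / (1 - x 0) = (\<Sum>i<n. (stereo n x i)\<^sup>2)"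
              using xS by (subst stereo_norm) auto
            also have "\<dots> \<le> (\<Sum>i<n. (R + 2)\<^sup>2)"
            proof (rule sum_mono)
              fix i assume "i \<in> {..<n}"
              then have "\<bar>stereo n x i\<bar> \<le> R + 2" using M[OF \<open>v \<in> M\<close> v(2)] by (simp add: less_imp_le)
              then show "(stereo n x i)\<^sup>2 \<le> (R + 2)\<^sup>2" by (metis abs_ge_zero power2_abs power_mono)
            qed
            also have "\<dots> = real n * (R + 2)\<^sup>2" by simp
            finally have "1 + x 0 \<le> real n * (R + 2)\<^sup>2 * (1 - x 0)"
              using less1[of x] xS by (simp add: divide_le_eq)
            then show False using x by (simp add: N_def)
          qed
          then show ?thesis using v by (auto simp: V_def)
        qed (simp add: V_def)
      qed
      ultimately have "V None = N \<union> (\<Union>v\<in>Z - M. P v)" by (auto simp: V_def)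
      then show ?thesis
        using \<open>openin (top_of_set ?S) N\<close> Popen 1 by (auto intro!: openin_Un openin_Union)
    next
      case 2
      then show ?thesis using Popen by (simp add: V_def)
    qed
  next
    fix j assume "j \<in> insert None (Some ` M)"
    then consider "j = None" | v where "j = Some v" "v \<in> M" by blast
    then show "\<exists>U\<in>\<U>. V j \<subseteq> U"
    proof cases
      case 1
      have "P v \<subseteq> U0" if "v \<in> Z - M" for v
      proof -
        have "\<not> (v \<in> Z \<and> P v \<inter> L \<noteq> {})" using that by (simp add: M_def)
        then have "P v \<inter> L = {}" using that by blast
        then have "P v \<inter> (?S - U0) = {}" by (simp only: L_def)
        moreover have "P v \<subseteq> ?S" by (auto simp: P_def)
        ultimately show ?thesis by blast
      qed
      then have "V j \<subseteq> U0" using 1 U0(2) by (auto simp: V_def)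
      then show ?thesis using U0(1) by blast
    next
      case 2
      have "P v \<inter> L \<noteq> {}" using 2 by (simp add: M_def)
      then obtain z where z: "z \<in> L" "z \<in> P v" by blast
      then obtain U where U': "U \<in> \<U>" "ball z \<mu> \<subseteq> U" using \<mu>(2)[of z] LS by blast
      have "P v \<subseteq> ball z \<mu>"
      proof
        fix x assume x: "x \<in> P v"
        have "\<bar>stereo n x i - stereo n z i\<bar> \<le> 2 * \<epsilon>" for i
        proof (cases "i < n")
          case True
          then have "\<bar>stereo n x i - stereo n z i\<bar> < 2 * \<epsilon>"
            using x z by (intro kuhn_star_dist[of \<epsilon> _ n v]) (auto simp: P_def \<epsilon>)
          then show ?thesis by simp
        qed (use \<epsilon> in \<open>simp add: st0\<close>)
        then have "dist (stereo n x) (stereo n z) \<le> 2 * (2 * \<epsilon>)" by (rule dist_fun_le)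
        then have d: "dist (stereo n x) (stereo n z) < \<eta>" using \<epsilon>(3) by simp
        have "stereo n x \<in> B" "stereo n z \<in> B"
          unfolding B using M[OF 2(2) x] M[OF 2(2) z(2)] by (auto simp: st0 intro: less_imp_le)
        then have "dist (stereo_inv n (stereo n x)) (stereo_inv n (stereo n z)) < \<mu>"
          using \<eta>(2) d by blast
        moreover have "stereo_inv n (stereo n x) = x" "stereo_inv n (stereo n z) = z"
          using x z by (auto simp: P_def stereo_inv_stereo)
        ultimately show "x \<in> ball z \<mu>" by (simp add: dist_commute)
      qed
      then show ?thesis using U' 2 by (auto simp: V_def)
    qed
  next
    show "?S \<subseteq> (\<Union>j\<in>insert None (Some ` M). V j)"
    proof
      fix x assume x: "x \<in> ?S"
      show "x \<in> (\<Union>j\<in>insert None (Some ` M). V j)"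
      proof (cases "x = ?s")
        case False
        then obtain v where "v \<in> Z" "x \<in> P v" using Pcover x by blast
        then show ?thesis by (cases "v \<in> M") (auto simp: V_def)
      qed (simp add: V_def)
    qed
    fix x assume x: "x \<in> ?S"
    let ?J = "{j \<in> insert None (Some ` M). x \<in> V j}"
    show "finite ?J \<and> card ?J \<le> Suc n"
    proof (cases "x = ?s")
      case True
      then have "?J = {None}" by (auto simp: V_def P_def)
      then show ?thesis by simp
    next
      case False
      let ?A = "{v \<in> Z. stereo n x \<in> kuhn_star n \<epsilon> v}"
      have A: "finite ?A" "card ?A \<le> Suc n"
        unfolding Z_def by (rule card_kuhn_stars)+
      have "?J \<subseteq> (\<lambda>v. if v \<in> M then Some v else None) ` ?A"
      proof
        fix j assume j: "j \<in> ?J"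
        then consider "j = None" "x \<in> V None" | v where "j = Some v" "v \<in> M" "x \<in> P v" by (auto simp: V_def)
        then show "j \<in> (\<lambda>v. if v \<in> M then Some v else None) ` ?A"
        proof cases
          case 1
          then obtain v where "v \<in> Z - M" "x \<in> P v" using False by (auto simp: V_def)
          then show ?thesis using 1 by (intro image_eqI[of _ _ v]) (auto simp: P_def)
        next
          case 2
          then show ?thesis by (intro image_eqI[of _ _ v]) (auto simp: P_def M_def)
        qed
      qed
      then show ?thesis
        using A by (meson card_image_le card_mono finite_imageI finite_subset le_trans)
    qed
  qed
qed

section \<open>The lower bound for the dimension of spheres\<close>

text \<open>Elimination with the pivot \<open>b p\<close>: \<open>r\<close> clears the coordinate p
  of the other equations, and the value at p is then solved from the equation of b.\<close>

lemma homogeneous_system_solution: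
  fixes B :: "(nat \<Rightarrow> real) set"
  assumes "finite B" "finite I" "card B < card I"
  shows "\<exists>a. (\<exists>i\<in>I. a i \<noteq> 0) \<and> (\<forall>b\<in>B. (\<Sum>i\<in>I. a i * b i) = 0)"
proof -
  have "\<exists>a. (\<exists>i\<in>I. a i \<noteq> 0) \<and> (\<forall>b\<in>B. (\<Sum>i\<in>I. a i * b i) = 0)"
    if "finite B" "finite I" "card B \<le> k" "k < card I" for k and B :: "(nat \<Rightarrow> real) set" and I :: "nat set"
    using that
  proof (induction k arbitrary: B I)
    case 0
    then have "B = {}" "I \<noteq> {}" by auto
    then show ?case by (intro exI[of _ "\<lambda>_. 1 :: real"]) auto
  next
    case (Suc k)
    show ?case
    proof (cases "B = {}")
      case True
      moreover have "I \<noteq> {}" using Suc.prems by auto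
      ultimately show ?thesis by (intro exI[of _ "\<lambda>_. 1 :: real"]) auto
    next
      case ne: False
      then obtain b B0 where b: "B = insert b B0" "b \<notin> B0" by (meson all_not_in_conv mk_disjoint_insert)
      then have B0: "finite B0" "card B0 \<le> k" using Suc.prems by auto
      show ?thesis
      proof (cases "\<forall>i\<in>I. b i = 0")
        case True
        obtain a where "(\<exists>i\<in>I. a i \<noteq> 0) \<and> (\<forall>b\<in>B0. (\<Sum>i\<in>I. a i * b i) = 0)"
          using Suc.IH[of B0 I] B0 Suc.prems by auto
        then show ?thesis using True b(1) by (intro exI[of _ a]) auto
      next
        case False
        then obtain p where p: "p \<in> I" "b p \<noteq> 0" by blast
        define I' where "I' = I - {p}"
        define r where "r c = (\<lambda>i. c i - c p / b p * b i)" for c :: "nat \<Rightarrow> real"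
        have I': "finite I'" "I = insert p I'" "p \<notin> I'"
          using Suc.prems(2) p(1) by (auto simp: I'_def)
        have cI: "card I = Suc (card I')"
          using card.remove[OF Suc.prems(2) p(1)] by (simp add: I'_def)
        have card: "card (r ` B0) \<le> k" using card_image_le[OF B0(1), of r] B0(2) by simp
        have "\<exists>a. (\<exists>i\<in>I'. a i \<noteq> 0) \<and> (\<forall>b\<in>r ` B0. (\<Sum>i\<in>I'. a i * b i) = 0)"
          using B0 I' cI Suc.prems card by (intro Suc.IH) auto
        then obtain a where a: "\<exists>i\<in>I'. a i \<noteq> 0" "\<And>c. c \<in> B0 \<Longrightarrow> (\<Sum>i\<in>I'. a i * r c i) = 0" by blast
        define s where "s = (\<Sum>i\<in>I'. a i * b i)"
        define a' where "a' = a(p := - s / b p)"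
        have sum: "(\<Sum>i\<in>I. a' i * c i) = - s / b p * c p + (\<Sum>i\<in>I'. a i * c i)" for c
        proof -
          have "(\<Sum>i\<in>I'. a' i * c i) = (\<Sum>i\<in>I'. a i * c i)"
            using I'(3) by (intro sum.cong) (auto simp: a'_def)
          then show ?thesis using I' by (simp add: a'_def)
        qed
        have "(\<Sum>i\<in>I. a' i * b i) = 0"
          using p(2) by (simp add: sum s_def[symmetric])
        moreover have "(\<Sum>i\<in>I. a' i * c i) = 0" if "c \<in> B0" for c
        proof -
          have "0 = (\<Sum>i\<in>I'. a i * c i - c p / b p * (a i * b i))"
            using a(2)[OF that] by (simp add: r_def algebra_simps)
          also have "\<dots> = (\<Sum>i\<in>I'. a i * c i) - c p / b p * s"
            by (simp add: sum_subtractf sum_distrib_left s_def)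
          finally show ?thesis by (simp add: sum)
        qed
        moreover have "\<exists>i\<in>I. a' i \<noteq> 0" using a(1) I' by (auto simp: a'_def)
        ultimately show ?thesis using b(1) by (intro exI[of _ a']) auto
      qed
    qed
  qed
  from this[OF assms(1,2) order_refl assms(3)] show ?thesis .
qed

text \<open>If the order of a refinement by pieces of open hemispheres were at most \<open>n\<close>, a partition of unity
  would give a map homotopic to the identity whose values are positive combinations of at most \<open>n\<close>
  centers. Its image misses the direction of some point of the moment curve.\<close>

lemma covering_dim_le_nsphere_imp:
  assumes "covering_dim_le (nsphere n) m" "-1 \<le> m"
  shows "int n \<le> m"
proof (rule ccontr)
  assume "\<not> int n \<le> m"
  then have kn: "nat (m + 1) \<le> n" by linarith
  let ?S = "topspace (nsphere n)"
  have clS: "closed ?S" using compact_nsphere by (rule compact_imp_closed)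
  define W where "W z = {y :: nat \<Rightarrow> real. 0 < (\<Sum>i\<le>n. y i * z i)}" for z :: "nat \<Rightarrow> real"
  have "open (W z)" for z
    unfolding W_def by (intro open_Collect_less continuous_intros)
  moreover have "z \<in> W z" if "z \<in> ?S" for z
    using that by (simp add: W_def topspace_nsphere power2_eq_square)
  moreover have "covering_dim_le (top_of_set ?S) m"
    using assms(1) by (metis nsphere_top_of_set)
  moreover have "(\<forall>U\<in>W ` ?S. open U) \<and> ?S \<subseteq> \<Union>(W ` ?S)"
    using calculation(1,2) by auto
  ultimately have "refinable (nat (m + 1)) ?S (W ` ?S)"
    unfolding covering_dim_le_iff_refinable[OF assms(2)] by simp
  from this[unfolded refinable_def]
  obtain \<V> where V: "\<forall>V\<in>\<V>. openin (top_of_set ?S) V" "\<Union>\<V> = ?S" "\<forall>V\<in>\<V>. \<exists>U\<in>W ` ?S. V \<subseteq> U"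
    "\<forall>x\<in>?S. finite {V\<in>\<V>. x \<in> V} \<and> card {V\<in>\<V>. x \<in> V} \<le> nat (m + 1)"
    by (elim exE conjE)
  have "\<forall>V\<in>\<V>. \<exists>T. open T \<and> V = ?S \<inter> T" using V(1) by (simp add: openin_open)
  then obtain T where T: "\<And>V. V \<in> \<V> \<Longrightarrow> open (T V)" "\<And>V. V \<in> \<V> \<Longrightarrow> V = ?S \<inter> T V" by metis
  have "?S \<subseteq> (\<Union>V\<in>\<V>. T V)" using V(2) T(2) by blast
  then obtain \<F> where F: "\<F> \<subseteq> \<V>" "finite \<F>" "?S \<subseteq> (\<Union>V\<in>\<F>. T V)"
    using compactE_image[OF compact_nsphere, of \<V> T] T(1) by blast
  have cov: "\<exists>V\<in>\<F>. x \<in> V" if x: "x \<in> ?S" for x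
  proof -
    obtain V where V': "V \<in> \<F>" "x \<in> T V" using F(3) x by blast
    then have "x \<in> V" using T(2)[of V] F(1) x by blast
    then show ?thesis using V'(1) by blast
  qed
  have "\<forall>V\<in>\<F>. \<exists>z. z \<in> ?S \<and> V \<subseteq> W z" using V(3) F(1) by blast
  then obtain p where p: "\<And>V. V \<in> \<F> \<Longrightarrow> p V \<in> ?S" "\<And>V. V \<in> \<F> \<Longrightarrow> V \<subseteq> W (p V)" by metis
  \<comment> \<open>\<open>infdist\<close> to the empty set is 0, so a member equal to the whole
    sphere is given the value 1.\<close>
  define \<phi> where "\<phi> V x = (if ?S - V = {} then 1 else infdist x (?S - V))" for V x
  have \<phi>0: "0 \<le> \<phi> V x" for V x by (simp add: \<phi>_def infdist_nonneg)
  have \<phi>: "0 < \<phi> V x \<longleftrightarrow> x \<in> V" if "V \<in> \<F>" "x \<in> ?S" for V x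
  proof (cases "?S - V = {}")
    case False
    have "openin (top_of_set ?S) V" using V(1) F(1) that(1) by blast
    then have "closedin (top_of_set ?S) (?S - V)" by (metis closedin_diff closedin_topspace topspace_euclidean_subtopology)
    then have "closed (?S - V)" using clS by (rule closedin_closed_trans)
    then have "infdist x (?S - V) = 0 \<longleftrightarrow> x \<in> ?S - V" using False in_closed_iff_infdist_zero by blast
    then show ?thesis using that(2) infdist_nonneg[of x "?S - V"] False by (auto simp: \<phi>_def)
  qed (use that in \<open>auto simp: \<phi>_def\<close>)
  have \<phi>z: "\<phi> V x = 0" if "V \<in> \<F>" "x \<in> ?S" "x \<notin> V" for V x
    using \<phi>[OF that(1,2)] \<phi>0[of V x] that(3) by linarith
  have \<phi>c: "continuous_on ?S (\<phi> V)" for V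
    by (cases "?S - V = {}") (simp_all add: \<phi>_def[abs_def] continuous_intros)
  define f where "f x = (\<lambda>i. \<Sum>V\<in>\<F>. \<phi> V x * p V i)" for x
  have fc: "continuous_map (nsphere n) euclideanreal (\<lambda>x. f x i)" for i
  proof -
    have "continuous_on ?S (\<lambda>x. f x i)"
      unfolding f_def by (intro continuous_intros \<phi>c)
    then show ?thesis by (subst nsphere_top_of_set) simp
  qed
  have comb: "(\<Sum>i\<le>n. f x i * c i) = (\<Sum>V\<in>\<F>. \<phi> V x * (\<Sum>i\<le>n. p V i * c i))" for x c
    unfolding f_def by (simp add: sum_distrib_left sum_distrib_right mult.assoc) (rule sum.swap)
  \<comment> \<open>A member through x lies in the hemisphere about its center, so all terms with
    nonzero weight are positive.\<close>
  have pos: "0 < (\<Sum>i\<le>n. f x i * x i)" if x: "x \<in> ?S" for x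
  proof -
    obtain V where V': "V \<in> \<F>" "x \<in> V" using cov x by blast
    have in': "0 < (\<Sum>i\<le>n. p U i * x i)" if "U \<in> \<F>" "x \<in> U" for U
      using p(2)[OF that(1)] that(2) by (auto simp: W_def mult.commute)
    have "0 < (\<Sum>V\<in>\<F>. \<phi> V x * (\<Sum>i\<le>n. p V i * x i))"
    proof (rule sum_pos2[OF F(2) V'(1)])
      show "0 < \<phi> V x * (\<Sum>i\<le>n. p V i * x i)" using \<phi>[OF V'(1) x] V' in' by simp
      show "0 \<le> \<phi> U x * (\<Sum>i\<le>n. p U i * x i)" if "U \<in> \<F>" for U
        using \<phi>z[OF that x] \<phi>0[of U x] in'[OF that] by (cases "x \<in> U") auto
    qed
    then show ?thesis by (simp add: comb)
  qed
  define g where "g x = sphere_normalize n (f x)" for x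
  have "homotopic_with (\<lambda>_. True) (nsphere n) (nsphere n) g (\<lambda>x. sphere_normalize n x)"
    unfolding g_def using pos by (intro homotopic_sphere_normalize fc continuous_map_nsphere_projection)
  then have hom: "homotopic_with (\<lambda>_. True) (nsphere n) (nsphere n) g id"
    by (rule homotopic_with_eq) (auto simp: sphere_normalize_id)
  \<comment> \<open>Any n centers lie in the kernel of a nonzero functional; choosing one for each
    such set of centers leaves finitely many hyperplanes to avoid.\<close>
  have "\<exists>a. (\<exists>i\<le>n. a i \<noteq> 0) \<and> (\<forall>V\<in>\<S>. (\<Sum>i\<le>n. a i * p V i) = 0)" if "\<S> \<in> {\<S>. \<S> \<subseteq> \<F> \<and> card \<S> \<le> n}" for \<S>
  proof -
    have S: "finite \<S>" "card \<S> \<le> n" using that F(2) finite_subset by auto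
    have "card (p ` \<S>) < card {..n}" using card_image_le[OF S(1), of p] S(2) by simp
    from homogeneous_system_solution[OF finite_imageI[OF S(1)] finite_atMost this]
    obtain a where "\<exists>i\<in>{..n}. a i \<noteq> 0" "\<forall>b\<in>p ` \<S>. (\<Sum>i\<le>n. a i * b i) = 0" by (elim exE conjE)
    then show ?thesis by (intro exI[of _ a]) auto
  qed
  then have "\<forall>\<S>\<in>{\<S>. \<S> \<subseteq> \<F> \<and> card \<S> \<le> n}. \<exists>a. (\<exists>i\<le>n. a i \<noteq> 0) \<and> (\<forall>V\<in>\<S>. (\<Sum>i\<le>n. a i * p V i) = 0)"
    by (rule ballI)
  from bchoice[OF this] obtain a where
    "\<forall>\<S>\<in>{\<S>. \<S> \<subseteq> \<F> \<and> card \<S> \<le> n}. (\<exists>i\<le>n. a \<S> i \<noteq> 0) \<and> (\<forall>V\<in>\<S>. (\<Sum>i\<le>n. a \<S> i * p V i) = 0)"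
    by (elim exE)
  note a' = bspec[OF this]
  have a1: "\<exists>i\<le>n. a \<S> i \<noteq> 0" if "\<S> \<in> {\<S>. \<S> \<subseteq> \<F> \<and> card \<S> \<le> n}" for \<S>
    by (rule conjunct1[OF a'[OF that]])
  have a2: "(\<Sum>i\<le>n. a \<S> i * p V i) = 0" if "\<S> \<in> {\<S>. \<S> \<subseteq> \<F> \<and> card \<S> \<le> n}" "V \<in> \<S>" for \<S> V
    by (rule bspec[OF conjunct2[OF a'[OF that(1)]] that(2)])
  have "finite {\<S>. \<S> \<subseteq> \<F> \<and> card \<S> \<le> n}" using F(2) by simp
  moreover have "finite {t :: real. (\<Sum>i\<le>n. a \<S> i * t ^ i) = 0}" if "\<S> \<in> {\<S>. \<S> \<subseteq> \<F> \<and> card \<S> \<le> n}" for \<S>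
    using a1[OF that] by (simp add: polyfun_finite_roots)
  ultimately have "finite (\<Union>\<S>\<in>{\<S>. \<S> \<subseteq> \<F> \<and> card \<S> \<le> n}. {t :: real. (\<Sum>i\<le>n. a \<S> i * t ^ i) = 0})"
    by (rule finite_UN_I)
  \<comment> \<open>A nonzero polynomial has finitely many roots, so some point of the moment curve
    lies on none of the hyperplanes.\<close>
  then obtain t :: real where t: "t \<notin> (\<Union>\<S>\<in>{\<S>. \<S> \<subseteq> \<F> \<and> card \<S> \<le> n}. {t :: real. (\<Sum>i\<le>n. a \<S> i * t ^ i) = 0})"
    using ex_new_if_finite[OF infinite_UNIV_char_0] by blast
  define u where "u = sphere_normalize n (\<lambda>i. t ^ i)"
  have tn: "0 < (\<Sum>i\<le>n. (t ^ i)\<^sup>2)"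
    by (rule sum_pos2[of _ 0]) auto
  have "u \<in> ?S" unfolding u_def using tn by (intro sphere_normalize_in_nsphere) simp
  moreover have "u \<notin> g ` ?S"
  proof
    assume "u \<in> g ` ?S"
    then obtain x where x: "x \<in> ?S" "g x = u" by blast
    define \<S> where "\<S> = {V\<in>\<F>. x \<in> V}"
    have "\<S> \<subseteq> {V\<in>\<V>. x \<in> V}" using F(1) by (auto simp: \<S>_def)
    then have "card \<S> \<le> nat (m + 1)" using V(4) x(1) by (meson card_mono order_trans)
    then have S: "\<S> \<in> {\<S>. \<S> \<subseteq> \<F> \<and> card \<S> \<le> n}" using kn by (auto simp: \<S>_def)
    have "(\<Sum>i\<le>n. f x i * a \<S> i) = (\<Sum>V\<in>\<F>. \<phi> V x * (\<Sum>i\<le>n. p V i * a \<S> i))" by (rule comb)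
    also have "\<dots> = 0"
    proof (intro sum.neutral ballI)
      fix V assume V': "V \<in> \<F>"
      show "\<phi> V x * (\<Sum>i\<le>n. p V i * a \<S> i) = 0"
        using \<phi>z[OF V' x(1)] a2[OF S, of V] V' by (cases "x \<in> V") (auto simp: \<S>_def mult.commute)
    qed
    finally have 0: "(\<Sum>i\<le>n. f x i * a \<S> i) = 0" .
    define s where "s = sqrt (\<Sum>j\<le>n. (f x j)\<^sup>2)"
    define s' where "s' = sqrt (\<Sum>j\<le>n. (t ^ j)\<^sup>2)"
    have s': "0 < s'" using tn by (simp add: s'_def)
    have s: "s \<noteq> 0"
    proof
      assume "s = 0"
      then have "f x j = 0" if "j \<le> n" for j
        using that by (simp add: s_def sum_nonneg_eq_0_iff)
      then show False using pos[OF x(1)] by simp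
    qed
    \<comment> \<open>If u were a value of g, the moment vector would be a multiple of
      \<open>f x\<close>, on which the functional chosen for the members through x vanishes.\<close>
    have "t ^ i / s' = f x i / s" if "i \<le> n" for i
      using fun_cong[OF x(2), of i] that by (simp add: g_def u_def sphere_normalize_def s_def s'_def)
    then have "t ^ i = s' / s * f x i" if "i \<le> n" for i
      using that s' s by (simp add: field_simps)
    then have "(\<Sum>i\<le>n. a \<S> i * t ^ i) = (\<Sum>i\<le>n. s' / s * (f x i * a \<S> i))"
      by (intro sum.cong) auto
    also have "\<dots> = s' / s * (\<Sum>i\<le>n. f x i * a \<S> i)" by (simp only: sum_distrib_left)
    finally have "(\<Sum>i\<le>n. a \<S> i * t ^ i) = 0" using 0 by simp
    then show False using t S by blast
  qed
  ultimately have "g ` ?S \<noteq> ?S" by blast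
  moreover have "continuous_map (nsphere n) (nsphere n) g"
    using hom homotopic_with_imp_continuous_maps by blast
  ultimately obtain c where "homotopic_with (\<lambda>_. True) (nsphere n) (nsphere n) g (\<lambda>_. c)"
    by (metis nullhomotopic_nonsurjective_sphere_map)
  then have "null_homotopic (nsphere n) (nsphere n) g" unfolding null_homotopic_def by blast
  then show False
    using null_homotopic_homotopic[OF hom] not_null_homotopic_id_nsphere by blast
qed

subsection \<open>Open cells and retracts\<close>

text \<open>Disjoint open pieces that cover the space exhibit it as a topological sum;
  \<open>to_nat\<close> supplies the natural numbers that \<open>countable_union_of_cells\<close>
  asks for as indices.\<close>

lemma homeomorphic_space_sum_topology:
  fixes c :: "'i::countable \<Rightarrow> 'a topology" and G :: "'i \<Rightarrow> 'b set"
  assumes G: "\<And>i. i \<in> I \<Longrightarrow> openin Y (G i)" "\<And>i. i \<in> I \<Longrightarrow> subtopology Y (G i) homeomorphic_space c i"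
    and dis: "\<And>i j. \<lbrakk>i \<in> I; j \<in> I; i \<noteq> j\<rbrakk> \<Longrightarrow> G i \<inter> G j = {}" and cov: "(\<Union>i\<in>I. G i) = topspace Y"
  shows "Y homeomorphic_space sum_topology (\<lambda>k. c (from_nat k)) (to_nat ` I)"
proof -
  have "\<forall>i\<in>I. \<exists>h. homeomorphic_map (c i) (subtopology Y (G i)) h"
    using G(2) homeomorphic_space homeomorphic_space_sym by blast
  from bchoice[OF this] obtain h where h: "\<forall>i\<in>I. homeomorphic_map (c i) (subtopology Y (G i)) (h i)"
    by (elim exE)
  let ?N = "to_nat ` I"
  let ?Z = "sum_topology (\<lambda>k. c (from_nat k)) ?N"
  define F where "F = (\<lambda>(k, y). h (from_nat k) y)"
  have im: "h i ` topspace (c i) = G i" if "i \<in> I" for i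
    using homeomorphic_imp_surjective_map[OF bspec[OF h that]] openin_subset[OF G(1)[OF that]] by auto
  have cont: "continuous_map (c i) Y (h i)" if "i \<in> I" for i
    using homeomorphic_imp_continuous_map[OF bspec[OF h that]] continuous_map_into_fulltopology by blast
  have inj: "inj_on (h i) (topspace (c i))" if "i \<in> I" for i
    using homeomorphic_imp_injective_map[OF bspec[OF h that]] .
  have opn: "openin Y (h i ` U)" if "i \<in> I" "openin (c i) U" for i U
  proof -
    have "openin (subtopology Y (G i)) (h i ` U)"
      using homeomorphic_imp_open_map[OF bspec[OF h that(1)]] that(2) by (simp add: open_map_def)
    then show ?thesis using G(1)[OF that(1)] openin_trans_full by blast
  qed
  have "homeomorphic_map ?Z Y F"
  proof (rule bijective_open_imp_homeomorphic_map)
    show "continuous_map ?Z Y F"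
      unfolding continuous_map_def
    proof (intro conjI allI impI)
      show "F \<in> topspace ?Z \<rightarrow> topspace Y"
        using im cov by (fastforce simp: F_def)
      fix U assume U: "openin Y U"
      show "openin ?Z {z \<in> topspace ?Z. F z \<in> U}"
        unfolding openin_sum_topology
      proof (intro conjI ballI)
        fix k assume k: "k \<in> ?N"
        then have "{y. (k, y) \<in> {z \<in> topspace ?Z. F z \<in> U}} = {y \<in> topspace (c (from_nat k)). h (from_nat k) y \<in> U}"
          by (auto simp: F_def)
        moreover have "openin (c (from_nat k)) \<dots>"
          using cont[of "from_nat k"] k U by (auto simp: continuous_map_def)
        ultimately show "openin (c (from_nat k)) {y. (k, y) \<in> {z \<in> topspace ?Z. F z \<in> U}}" by simp
      qed auto
    qed
    have img: "F ` U = (\<Union>i\<in>I. h i ` {y. (to_nat i, y) \<in> U})" if U: "openin ?Z U" for U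
    proof (intro equalityI subsetI)
      fix x assume "x \<in> F ` U"
      then obtain k y where ky: "(k, y) \<in> U" "x = F (k, y)" by auto
      then have "k \<in> ?N" using U unfolding openin_sum_topology by blast
      then obtain i where "i \<in> I" "k = to_nat i" by blast
      then show "x \<in> (\<Union>i\<in>I. h i ` {y. (to_nat i, y) \<in> U})" using ky by (auto simp: F_def)
    next
      fix x assume "x \<in> (\<Union>i\<in>I. h i ` {y. (to_nat i, y) \<in> U})"
      then obtain i y where "i \<in> I" "(to_nat i, y) \<in> U" "x = h i y" by blast
      then show "x \<in> F ` U" by (intro image_eqI[of _ _ "(to_nat i, y)"]) (auto simp: F_def)
    qed
    show "open_map ?Z Y F"
      unfolding open_map_def
    proof (intro allI impI)
      fix U assume U: "openin ?Z U"
      have "openin Y (h i ` {y. (to_nat i, y) \<in> U})" if "i \<in> I" for i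
      proof (rule opn[OF that])
        have "\<forall>k\<in>?N. openin (c (from_nat k)) {x. (k, x) \<in> U}"
          using U unfolding openin_sum_topology by (rule conjunct2)
        from bspec[OF this, of "to_nat i"] show "openin (c i) {y. (to_nat i, y) \<in> U}"
          using that by simp
      qed
      then show "openin Y (F ` U)" unfolding img[OF U] by (intro openin_Union) auto
    qed
    show "F ` topspace ?Z = topspace Y"
    proof -
      have "{y. (to_nat i, y) \<in> topspace ?Z} = topspace (c i)" if "i \<in> I" for i
        using that by auto
      then have "F ` topspace ?Z = (\<Union>i\<in>I. h i ` topspace (c i))"
        unfolding img[OF openin_topspace] by (intro SUP_cong) auto
      then show ?thesis using im cov by simp
    qed
    show "inj_on F (topspace ?Z)"
    proof (rule inj_onI)
      fix z w assume zw: "z \<in> topspace ?Z" "w \<in> topspace ?Z" "F z = F w"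
      then obtain i y j u where z: "z = (to_nat i, y)" "i \<in> I" "y \<in> topspace (c i)"
        and w: "w = (to_nat j, u)" "j \<in> I" "u \<in> topspace (c j)" by auto
      have "h i y = h j u" using zw(3) z(1) w(1) by (simp add: F_def)
      then have "i = j" using dis[OF z(2) w(2)] im[OF z(2)] im[OF w(2)] z(3) w(3) by blast
      then show "z = w" using inj[OF z(2)] \<open>h i y = h j u\<close> z w by (auto dest: inj_onD)
    qed
  qed
  then show ?thesis
    using homeomorphic_space homeomorphic_space_sym by blast
qed

lemma Euclidean_space_1_homeomorphic_interval:
  "top_of_set {0<..<1::real} homeomorphic_space Euclidean_space 1"
proof -
  have "{0<..<1::real} homeomorphic (UNIV :: real set)"
    by (rule homeomorphic_open_interval_UNIV) simp
  then obtain f g where "homeomorphism {0<..<1::real} (UNIV :: real set) f g"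
    unfolding homeomorphic_def by (elim exE)
  then have "homeomorphic_maps (top_of_set {0<..<1::real}) euclideanreal f g"
    by (auto simp: homeomorphism_def homeomorphic_maps_def continuous_map_in_subtopology)
  then have "top_of_set {0<..<1::real} homeomorphic_space euclideanreal"
    unfolding homeomorphic_space_def by (intro exI)
  moreover have "euclideanreal homeomorphic_space Euclidean_space 1"
    unfolding homeomorphic_space_def homeomorphic_maps_def
  proof (intro exI conjI ballI)
    show "continuous_map euclideanreal (Euclidean_space 1) (\<lambda>r i. if i < 1 then r else 0)"
      unfolding continuous_map_componentwise_Euclidean_space by simp
    show "continuous_map (Euclidean_space 1) euclideanreal (\<lambda>x. x 0)"
      unfolding Euclidean_space_def
      by (intro continuous_map_from_subtopology continuous_map_product_projection) auto
  qed (auto simp: topspace_Euclidean_space fun_eq_iff)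
  ultimately show ?thesis using homeomorphic_space_trans by blast
qed

text \<open>Some essential sphere at a wild point would lie in U, where it contracts.\<close>

lemma not_wild_point_in_contractible:
  assumes "openin X U" "contractible_space (subtopology X U)" "x \<in> U"
  shows "\<not> wild_point n X x"
proof
  assume "wild_point n X x"
  then obtain g where g: "essential n X g" "g ` topspace (nsphere n) \<subseteq> U"
    using wild_pointD[OF _ assms(1,3)] by metis
  then have "continuous_map (nsphere n) (subtopology X U) g"
    by (auto simp: essential_def continuous_map_in_subtopology)
  then obtain c where "homotopic_with (\<lambda>_. True) (nsphere n) (subtopology X U) g (\<lambda>_. c)"
    using nullhomotopic_into_contractible_space[OF _ assms(2)] by metis
  then have "homotopic_with (\<lambda>_. True) (nsphere n) X (id \<circ> g) (id \<circ> (\<lambda>_. c))"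
    by (rule homotopic_with_compose_continuous_map_left) (auto simp: continuous_map_from_subtopology)
  then have "null_homotopic (nsphere n) X g"
    unfolding null_homotopic_def by (auto simp: o_def)
  then show False using g(1) by (simp add: essential_def)
qed

text \<open>Composing with r turns a null-homotopy of f into one of the identity.\<close>

lemma essential_if_left_inverse:
  assumes "continuous_map (nsphere n) X f" "continuous_map X (nsphere n) r" "\<And>x. x \<in> topspace (nsphere n) \<Longrightarrow> r (f x) = x"
  shows "essential n X f"
  unfolding essential_def
proof (intro conjI notI assms(1))
  assume "null_homotopic (nsphere n) X f"
  then obtain c where "homotopic_with (\<lambda>_. True) (nsphere n) X f (\<lambda>_. c)" by (auto simp: null_homotopic_def)
  then have "homotopic_with (\<lambda>_. True) (nsphere n) (nsphere n) (r \<circ> f) (r \<circ> (\<lambda>_. c))"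
    by (rule homotopic_with_compose_continuous_map_left) (use assms in auto)
  then have "homotopic_with (\<lambda>_. True) (nsphere n) (nsphere n) id (\<lambda>_. r c)"
    by (rule homotopic_with_eq) (use assms(3) in auto)
  then show False
    using not_null_homotopic_id_nsphere by (auto simp: null_homotopic_def)
qed

lemma property_S_continuous_image:
  assumes "compact S" "property_S S" "continuous_on S f"
  shows "property_S (f ` S)"
  unfolding property_S_def
proof (intro allI impI)
  fix e :: real assume "0 < e"
  have "uniformly_continuous_on S f" using assms(1,3) by (simp add: compact_uniformly_continuous)
  then obtain d where d: "0 < d" "\<And>x y. \<lbrakk>x \<in> S; y \<in> S; dist y x < d\<rbrakk> \<Longrightarrow> dist (f y) (f x) < e"
    unfolding uniformly_continuous_on_def using \<open>0 < e\<close> by metis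
  from assms(2)[unfolded property_S_def, rule_format, OF d(1)]
  obtain \<A> where A: "finite \<A>" "\<Union>\<A> = S" "\<forall>A\<in>\<A>. connected A \<and> (\<forall>x\<in>A. \<forall>y\<in>A. dist x y < d)"
    by (elim exE conjE)
  show "\<exists>\<A>. finite \<A> \<and> \<Union>\<A> = f ` S \<and> (\<forall>A\<in>\<A>. connected A \<and> (\<forall>x\<in>A. \<forall>y\<in>A. dist x y < e))"
  proof (intro exI[of _ "(`) f ` \<A>"] conjI ballI)
    show "finite ((`) f ` \<A>)" "\<Union>((`) f ` \<A>) = f ` S" using A by auto
    fix B assume "B \<in> (`) f ` \<A>"
    then obtain A' where A': "A' \<in> \<A>" "B = f ` A'" by blast
    have sub: "A' \<subseteq> S" using A' A(2) by blast
    show "connected B"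
      unfolding A'(2) using A(3) A'(1) continuous_on_subset[OF assms(3) sub] by (simp add: connected_continuous_image)
    fix x y assume "x \<in> B" "y \<in> B"
    then show "dist x y < e" using d(2) A(3) A' sub by (auto simp: subset_iff)
  qed
qed

lemma connected_chain_UN:
  fixes A :: "nat \<Rightarrow> 'a::topological_space set"
  assumes "\<And>l. connected (A l)" "\<And>l. p l \<in> A l" "\<And>l. p (Suc l) \<in> A l"
  shows "connected (\<Union>l. A l)"
proof -
  have c: "connected (\<Union>l\<in>{..r}. A l)" for r
  proof (induction r)
    case (Suc r)
    have "p (Suc r) \<in> (\<Union>l\<in>{..r}. A l) \<inter> A (Suc r)" using assms(2,3) by auto
    then have "connected ((\<Union>l\<in>{..r}. A l) \<union> A (Suc r))"
      using Suc assms(1) by (intro connected_Un) auto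
    moreover have "(\<Union>l\<in>{..Suc r}. A l) = (\<Union>l\<in>{..r}. A l) \<union> A (Suc r)" by (auto simp: atMost_Suc)
    ultimately show ?case by simp
  qed (use assms(1) in simp)
  have "p 0 \<in> \<Inter>(range (\<lambda>r. \<Union>l\<in>{..r}. A l))" using assms(2) by auto
  then have "connected (\<Union>(range (\<lambda>r. \<Union>l\<in>{..r}. A l)))"
    using c by (intro connected_Union) blast+
  moreover have "\<Union>(range (\<lambda>r. \<Union>l\<in>{..r}. A l)) = (\<Union>l. A l)" by auto
  ultimately show ?thesis by simp
qed

section \<open>Dimension of compact images and the formula for the maximum\<close>

lemma covering_dim_le_mono:
  assumes "covering_dim_le X m" "m \<le> m'"
  shows "covering_dim_le X m'"
  unfolding covering_dim_le_def
proof (intro allI impI)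
  fix \<U> assume "(\<forall>U\<in>\<U>. openin X U) \<and> \<Union>\<U> = topspace X"
  from spec[OF assms(1)[unfolded covering_dim_le_def], THEN mp, OF this]
  obtain \<V> where "\<forall>V\<in>\<V>. openin X V" "\<Union>\<V> = topspace X" "\<forall>V\<in>\<V>. \<exists>U\<in>\<U>. V \<subseteq> U"
    and V: "\<forall>x\<in>topspace X. finite {V\<in>\<V>. x \<in> V} \<and> int (card {V\<in>\<V>. x \<in> V}) \<le> m + 1"
    by (elim exE conjE)
  moreover have "\<forall>x\<in>topspace X. finite {V\<in>\<V>. x \<in> V} \<and> int (card {V\<in>\<V>. x \<in> V}) \<le> m' + 1"
    using V assms(2) by fastforce
  ultimately show "\<exists>\<V>. (\<forall>V\<in>\<V>. openin X V) \<and> \<Union>\<V> = topspace X \<and> (\<forall>V\<in>\<V>. \<exists>U\<in>\<U>. V \<subseteq> U) \<and>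
      (\<forall>x\<in>topspace X. finite {V\<in>\<V>. x \<in> V} \<and> int (card {V\<in>\<V>. x \<in> V}) \<le> m' + 1)"
    by (intro exI[of _ \<V>] conjI)
qed

lemma covering_dim_le_nsphere: "covering_dim_le (nsphere n) (int n)"
proof -
  have "covering_dim_le (top_of_set (topspace (nsphere n))) (int n)"
    using refinable_nsphere[where n = n] by (subst covering_dim_le_iff_refinable) (auto simp: nat_add_distrib)
  then show ?thesis by (metis nsphere_top_of_set)
qed

lemma compact_embedding:
  fixes f :: "'a::topological_space \<Rightarrow> 'b::metric_space"
  assumes "compact S" "continuous_on S f" "inj_on f S"
  shows "embedding_map (top_of_set S) euclidean f"
proof -
  have "continuous_map (top_of_set S) euclidean f" using assms(2) by simp
  moreover have "closed_map (top_of_set S) euclidean f"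
    using assms(1) calculation continuous_imp_closed_map[of "top_of_set S" euclidean f] Hausdorff_space_euclidean
    by (simp add: compact_space_subtopology)
  ultimately show ?thesis
    using assms(3) by (simp add: injective_closed_imp_embedding_map)
qed

lemma covering_dim_le_compact_image:
  fixes f :: "'a::topological_space \<Rightarrow> 'b::metric_space"
  assumes "compact S" "continuous_on S f" "inj_on f S"
  shows "covering_dim_le (top_of_set (f ` S)) m \<longleftrightarrow> covering_dim_le (top_of_set S) m"
  using covering_dim_le_homeomorphic[OF embedding_map_imp_homeomorphic_space[OF compact_embedding[OF assms]], of m]
  by simp

lemma covering_dim_le_closed_subset:
  assumes "closed A" "A \<subseteq> S" "covering_dim_le (top_of_set S) m"
  shows "covering_dim_le (top_of_set A) m"
proof (rule covering_dim_le_closed_embedding[OF _ _ assms(3)])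
  show "embedding_map (top_of_set A) (top_of_set S) id"
    using assms(2) by (simp add: embedding_map_def homeomorphic_map_id subtopology_subtopology Int_absorb1)
  show "closedin (top_of_set S) (id ` topspace (top_of_set A))"
    using assms(1,2) by (simp add: closed_subset)
qed

text \<open>A quarter circle embeds the interval in the sphere as a closed subset, so the bound for
  spheres is reused.\<close>

lemma covering_dim_le_unit_interval:
  assumes "1 \<le> n"
  shows "covering_dim_le (top_of_set {0..1::real}) (int n)"
proof -
  define f where "f = (\<lambda>(t::real) (i::nat). if i = 0 then t else if i = 1 then sqrt (1 - t\<^sup>2) else 0)"
  have "continuous_on {0..1} (\<lambda>t. f t i)" for i
    unfolding f_def by (cases "i = 0"; cases "i = 1") (auto intro!: continuous_intros)
  then have c: "continuous_on {0..1} f"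
    by (intro continuous_on_coordinatewise_then_product)
  have "inj_on f {0..1}"
    by (rule inj_onI) (metis (full_types) f_def)
  then have "covering_dim_le (top_of_set (f ` {0..1})) (int n) \<longleftrightarrow> covering_dim_le (top_of_set {0..1::real}) (int n)"
    by (intro covering_dim_le_compact_image c) auto
  moreover have "f t \<in> topspace (nsphere n)" if "t \<in> {0..1}" for t
  proof -
    have "t\<^sup>2 \<le> 1" using that by (simp add: power_le_one)
    have "(\<Sum>i\<le>n. (f t i)\<^sup>2) = (\<Sum>i\<in>{0,1}. (f t i)\<^sup>2)"
      using assms by (intro sum.mono_neutral_right) (auto simp: f_def)
    also have "\<dots> = 1" using \<open>t\<^sup>2 \<le> 1\<close> by (simp add: f_def)
    finally show ?thesis using assms by (auto simp: topspace_nsphere f_def)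
  qed
  then have "f ` {0..1} \<subseteq> topspace (nsphere n)" by blast
  moreover have "closed (f ` {0..1})"
    using c compact_continuous_image compact_imp_closed by blast
  moreover have "covering_dim_le (top_of_set (topspace (nsphere n))) (int n)"
    using covering_dim_le_nsphere[of n] by (metis nsphere_top_of_set)
  ultimately show ?thesis
    using covering_dim_le_closed_subset by blast
qed

text \<open>The infimum ranges over integer bounds, so it is enough to know which integers bound X;
  arguing through values above the maximum also covers an infinite dimension of C.\<close>

lemma covering_dim_eq_max:
  assumes "\<And>m. -1 \<le> m \<Longrightarrow> covering_dim_le X m \<longleftrightarrow> covering_dim_le C m \<and> int n \<le> m"
  shows "covering_dim X = max (covering_dim C) (ereal (real n))"
proof (rule antisym)
  show "covering_dim X \<le> max (covering_dim C) (ereal (real n))"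
  proof -
    have "covering_dim X \<le> y" if y: "max (covering_dim C) (ereal (real n)) < y" for y
    proof -
      have "covering_dim C < y" "ereal (real n) < y" using y by auto
      then obtain m where m: "-1 \<le> m" "covering_dim_le C m" "ereal (real_of_int m) < y"
        unfolding covering_dim_def Inf_less_iff by auto
      define m' where "m' = max m (int n)"
      have "covering_dim_le X m'"
        using assms[of m'] m covering_dim_le_mono[OF m(2), of m'] by (auto simp: m'_def)
      then have "covering_dim X \<le> ereal (real_of_int m')"
        unfolding covering_dim_def using m(1) by (intro Inf_lower) (auto simp: m'_def)
      also have "\<dots> \<le> y"
        using m(3) \<open>ereal (real n) < y\<close> by (cases "m \<le> int n") (auto simp: m'_def max_def)
      finally show ?thesis .
    qed
    then show ?thesis by (meson dense_ge)
  qed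
  show "max (covering_dim C) (ereal (real n)) \<le> covering_dim X"
    unfolding covering_dim_def[of X]
  proof (rule Inf_greatest)
    fix z assume "z \<in> {ereal (real_of_int m) |m. - 1 \<le> m \<and> covering_dim_le X m}"
    then obtain m where m: "z = ereal (real_of_int m)" "-1 \<le> m" "covering_dim_le X m" by blast
    then have C: "covering_dim_le C m" "int n \<le> m" using assms by auto
    then have "covering_dim C \<le> z"
      unfolding covering_dim_def using m by (intro Inf_lower) auto
    then show "max (covering_dim C) (ereal (real n)) \<le> z" using C(2) m(1) by simp
  qed
qed

subsection \<open>The Peano continuum\<close>

type_synonym cell = "nat \<times> nat + nat \<times> nat \<times> nat"

text \<open>The compact set \<open>D\<close> lives in the coordinates above \<open>Suc n\<close>. The cell \<open>Inl (k, l)\<close> is a sphere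
  attached at \<open>d k\<close>, and \<open>Inr (k, i, j)\<close> is an arc from \<open>d i\<close> to \<open>d j\<close>. They leave \<open>D\<close> in the
  coordinates \<open>0, ..., n\<close> with size \<open>scale c\<close>. Off \<open>D\<close> the coordinate \<open>0\<close> does not vanish on a cell,
  and its quotient with the coordinate \<open>Suc n\<close> is \<open>scale c\<close>, so the cells are disjoint there.\<close>

locale earring_complex =
  fixes n :: nat and D :: "(nat \<Rightarrow> real) set" and d :: "nat \<Rightarrow> nat \<Rightarrow> real" and m :: "nat \<Rightarrow> nat"
  assumes n: "1 \<le> n" and compact_D: "compact D" and D_zero: "\<And>x j. x \<in> D \<Longrightarrow> j \<le> Suc n \<Longrightarrow> x j = 0"
    and d_in: "\<And>k. d k \<in> D" and net: "\<And>k x. x \<in> D \<Longrightarrow> \<exists>i\<le>m k. dist x (d i) \<le> (1/2)^k"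
begin

text \<open>Injectivity keeps distinct cells apart, and convergence to 0 makes their excursions from
  \<open>D\<close> shrink.\<close>

definition scale :: "cell \<Rightarrow> real" where "scale c = 1 / (1 + real (to_nat c))"

definition lift :: "real \<Rightarrow> (nat \<Rightarrow> real) \<Rightarrow> nat \<Rightarrow> real" where
  "lift s v = (\<lambda>j. if j \<le> n then s * v j else if j = Suc n then s\<^sup>2 * v 0 else 0)"

definition sph :: "nat \<Rightarrow> nat \<Rightarrow> (nat \<Rightarrow> real) \<Rightarrow> nat \<Rightarrow> real" where
  "sph k l u = (\<lambda>j. d k j + lift (scale (Inl (k, l))) (\<lambda>i. u i - sphere_base i) j)"

definition seg :: "nat \<Rightarrow> nat \<Rightarrow> real \<Rightarrow> nat \<Rightarrow> real" where
  "seg i j t = (\<lambda>a. (1 - t) * d i a + t * d j a)"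

text \<open>On the unit interval the bump t * (1 - t) vanishes exactly at the ends, so the arc is
  off \<open>D\<close> in between although the segment itself may meet \<open>D\<close>.\<close>

definition arc_of :: "nat \<Rightarrow> nat \<Rightarrow> nat \<Rightarrow> real \<Rightarrow> nat \<Rightarrow> real" where
  "arc_of k i j t = (\<lambda>a. seg i j t a + lift (scale (Inr (k, i, j))) (\<lambda>b. if b = 0 then t * (1 - t) else 0) a)"

definition cl_cell :: "cell \<Rightarrow> (nat \<Rightarrow> real) set" where
  "cl_cell c = (case c of Inl (k, l) \<Rightarrow> sph k l ` topspace (nsphere n) | Inr (k, i, j) \<Rightarrow> arc_of k i j ` {0..1})"

definition ends :: "cell \<Rightarrow> (nat \<Rightarrow> real) set" where
  "ends c = (case c of Inl (k, l) \<Rightarrow> {d k} | Inr (k, i, j) \<Rightarrow> {d i, d j})"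

text \<open>For two points at distance at most 2 * (1/2)^k, approximations in the nets k and
  \<open>Suc k\<close> are at most (1 + 2 + 1/2) * (1/2)^k apart, whence the factor 4. With equal
  ends the arc would not be injective. Each level has finitely many arcs.\<close>

definition cells :: "cell set" where
  "cells = range Inl \<union> Inr ` {(k, i, j). i \<le> m k \<and> j \<le> m (Suc k) \<and> d i \<noteq> d j \<and> dist (d i) (d j) \<le> 4 * (1/2)^k}"

definition X :: "(nat \<Rightarrow> real) set" where "X = D \<union> (\<Union>c\<in>cells. cl_cell c)"

lemma cells_cases:
  assumes "c \<in> cells"
  obtains (sph) k l where "c = Inl (k, l)" |
    (arc) k i j where "c = Inr (k, i, j)" "i \<le> m k" "j \<le> m (Suc k)" "d i \<noteq> d j" "dist (d i) (d j) \<le> 4 * (1/2)^k"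
  using assms unfolding cells_def by auto

lemma scale: "0 < scale c" "scale c \<le> 1" "(scale c)\<^sup>2 \<le> scale c" "scale c = scale c' \<longleftrightarrow> c = c'"
proof -
  show s: "0 < scale c" "scale c \<le> 1" by (simp_all add: scale_def)
  then show "(scale c)\<^sup>2 \<le> scale c" by (simp add: power2_eq_square mult_left_le)
  have "scale c = scale c' \<Longrightarrow> real (to_nat c) = real (to_nat c')"
    by (simp add: scale_def)
  then show "scale c = scale c' \<longleftrightarrow> c = c'" by (auto simp: inj_to_nat[THEN inj_eq])
qed

lemma finite_scale_ge: "0 < e \<Longrightarrow> finite {c. e \<le> scale c}"
proof -
  assume e: "0 < e"
  have "to_nat ` {c. e \<le> scale c} \<subseteq> {..nat \<lceil>1 / e\<rceil>}"
  proof
    fix k assume "k \<in> to_nat ` {c. e \<le> scale c}"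
    then have "e \<le> 1 / (1 + real k)" by (auto simp: scale_def)
    then have "1 + real k \<le> 1 / e" using e by (simp add: field_simps)
    then show "k \<in> {..nat \<lceil>1 / e\<rceil>}" by (simp add: le_nat_iff) linarith
  qed
  then have "finite (to_nat ` {c. e \<le> scale c})" using finite_subset by blast
  then show ?thesis using finite_imageD inj_to_nat inj_on_subset by blast
qed

lemma abs_lift_le:
  assumes "\<And>i. \<bar>v i\<bar> \<le> b"
  shows "\<bar>lift (scale c) v j\<bar> \<le> scale c * b"
proof -
  have b: "0 \<le> b" using assms[of 0] by linarith
  have "(scale c)\<^sup>2 * \<bar>v 0\<bar> \<le> scale c * b"
    using scale[of c] assms[of 0] b by (intro mult_mono) auto
  moreover have "scale c * \<bar>v j\<bar> \<le> scale c * b"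
    using scale(1)[of c] assms by (intro mult_left_mono) auto
  ultimately show ?thesis
    using scale(1)[of c] b by (simp add: lift_def abs_mult)
qed

lemma d_zero: "j \<le> Suc n \<Longrightarrow> d k j = 0"
  using D_zero d_in by blast

lemma continuous_on_sph: "continuous_on S (sph k l)"
proof (rule continuous_on_coordinatewise_then_product)
  show "continuous_on S (\<lambda>u. sph k l u j)" for j
    unfolding sph_def lift_def by (cases "j \<le> n"; cases "j = Suc n") (auto intro!: continuous_intros)
qed

lemma continuous_on_arc_of: "continuous_on S (arc_of k i j)"
proof (rule continuous_on_coordinatewise_then_product)
  show "continuous_on S (\<lambda>t. arc_of k i j t a)" for a
    unfolding arc_of_def lift_def seg_def by (cases "a \<le> n"; cases "a = 0"; cases "a = Suc n") (auto intro!: continuous_intros)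
qed

text \<open>The coordinates of \<open>d k\<close> up to n vanish, so there only the sphere is seen.
  The same formula gives the retraction in \<open>essential_sph\<close>.\<close>

lemma sph_left_inverse:
  assumes "u \<in> topspace (nsphere n)"
  shows "(\<lambda>j. if j \<le> n then sph k l u j / scale (Inl (k, l)) + sphere_base j else 0) = u"
  using assms scale(1)[of "Inl (k, l)"]
  by (auto simp: fun_eq_iff sph_def lift_def d_zero topspace_nsphere sphere_base_def)

lemma inj_on_sph: "inj_on (sph k l) (topspace (nsphere n))"
  by (rule inj_on_inverseI[where g = "\<lambda>x j. if j \<le> n then x j / scale (Inl (k, l)) + sphere_base j else 0"])
    (rule sph_left_inverse)

lemma sph_base: "sph k l sphere_base = d k"
  by (auto simp: fun_eq_iff sph_def lift_def)

lemma arc_of_ends: "arc_of k i j 0 = d i" "arc_of k i j 1 = d j"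
  by (auto simp: fun_eq_iff arc_of_def lift_def seg_def)

text \<open>The ends differ in a coordinate above \<open>Suc n\<close>, where the bump is absent and
  the arc is affine in t.\<close>

lemma inj_on_arc_of:
  assumes "d i \<noteq> d j"
  shows "inj_on (arc_of k i j) S"
proof (rule inj_onI)
  fix t t' assume eq: "arc_of k i j t = arc_of k i j t'"
  obtain a where a: "d i a \<noteq> d j a" using assms by (meson ext)
  then have "Suc n < a" using d_zero[of a i] d_zero[of a j] by (metis not_le)
  then have "(1 - t) * d i a + t * d j a = (1 - t') * d i a + t' * d j a"
    using fun_cong[OF eq, of a] by (simp add: arc_of_def lift_def seg_def)
  then have "(t - t') * (d j a - d i a) = 0" by (simp add: algebra_simps)
  then show "t = t'" using a by simp
qed

lemma cl_cell_simps [simp]: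
  "cl_cell (Inl (k, l)) = sph k l ` topspace (nsphere n)" "cl_cell (Inr (k, i, j)) = arc_of k i j ` {0..1}"
  by (simp_all add: cl_cell_def)

lemma ends_simps [simp]: "ends (Inl (k, l)) = {d k}" "ends (Inr (k, i, j)) = {d i, d j}"
  by (simp_all add: ends_def)

lemma cell_exhaust:
  fixes c :: cell
  obtains (sph) k l where "c = Inl (k, l)" | (arc) k i j where "c = Inr (k, i, j)"
proof (cases c)
  case (Inl p)
  then show ?thesis using sph by (cases p) auto
next
  case (Inr q)
  then show ?thesis using arc by (cases q rule: prod_cases3) auto
qed

lemma ends_subset: "ends c \<subseteq> D" "ends c \<subseteq> cl_cell c" "ends c \<noteq> {}" "finite (ends c)"
proof -
  have "d k \<in> sph k l ` topspace (nsphere n)" for k l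
    using sphere_base_in_nsphere sph_base by (metis image_eqI)
  moreover have "d i \<in> arc_of k i j ` {0..1}" "d j \<in> arc_of k i j ` {0..1}" for k i j
    using arc_of_ends[of k i j] by (metis atLeastAtMost_iff image_eqI order_refl zero_le_one)+
  ultimately show "ends c \<subseteq> cl_cell c"
    by (cases c rule: cell_exhaust) auto
  show "ends c \<subseteq> D" "ends c \<noteq> {}" "finite (ends c)"
    using d_in by (cases c rule: cell_exhaust; auto)+
qed

text \<open>Coordinate 0 is a positive multiple of u 0 - 1 on a sphere and of t * (1 - t) on an arc,
  and these vanish at the attaching points only.\<close>

lemma cl_cell_coordinate:
  assumes "x \<in> cl_cell c"
  shows "x (Suc n) = scale c * x 0" "x 0 = 0 \<longleftrightarrow> x \<in> ends c"
proof -
  have D0: "x 0 = 0" if "x \<in> ends c" using that ends_subset(1) D_zero by blast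
  have "x (Suc n) = scale c * x 0 \<and> (x 0 = 0 \<longrightarrow> x \<in> ends c)"
  proof (cases c rule: cell_exhaust)
    case c: (sph k l)
    then obtain u where u: "u \<in> topspace (nsphere n)" "x = sph k l u" using assms by auto
    have "x 0 = scale c * (u 0 - 1)" "x (Suc n) = (scale c)\<^sup>2 * (u 0 - 1)"
      by (simp_all add: u(2) sph_def lift_def d_zero sphere_base_def c)
    moreover have "x = d k" if "u 0 = 1"
      using that u nsphere_first_coordinate(2)[OF u(1)] sph_base by simp
    ultimately show ?thesis using scale(1)[of c] by (auto simp: c power2_eq_square)
  next
    case c: (arc k' i j)
    then obtain t where t: "x = arc_of k' i j t" using assms by auto
    have "x 0 = scale c * (t * (1 - t))" "x (Suc n) = (scale c)\<^sup>2 * (t * (1 - t))"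
      by (simp_all add: t arc_of_def lift_def seg_def d_zero c)
    moreover have "x = d i \<or> x = d j" if "t = 0 \<or> t = 1"
      using that t arc_of_ends by auto
    ultimately show ?thesis using scale(1)[of c] by (auto simp: c power2_eq_square)
  qed
  then show "x (Suc n) = scale c * x 0" "x 0 = 0 \<longleftrightarrow> x \<in> ends c" using D0 by auto
qed

lemma cl_cell_Int_D: "cl_cell c \<inter> D = ends c"
proof
  show "cl_cell c \<inter> D \<subseteq> ends c"
  proof
    fix x assume x: "x \<in> cl_cell c \<inter> D"
    then have "x 0 = 0" by (intro D_zero) auto
    then show "x \<in> ends c" using cl_cell_coordinate(2) x by blast
  qed
qed (use ends_subset in blast)

lemma cl_cell_Int: "c \<noteq> c' \<Longrightarrow> cl_cell c \<inter> cl_cell c' \<subseteq> D"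
proof
  fix x assume c: "c \<noteq> c'" and x: "x \<in> cl_cell c \<inter> cl_cell c'"
  then have "scale c * x 0 = scale c' * x 0"
    using cl_cell_coordinate(1) by (metis IntD1 IntD2)
  then have "x 0 = 0" using scale(4) c by simp
  then show "x \<in> D" using cl_cell_coordinate(2) x ends_subset(1) by blast
qed

lemma compact_cl_cell: "compact (cl_cell c)"
  using compact_nsphere[of n] continuous_on_sph continuous_on_arc_of
  by (cases c rule: cell_exhaust) (simp_all add: compact_continuous_image)

lemma connected_cl_cell: "connected (cl_cell c)"
  using connected_nsphere[OF n] continuous_on_sph continuous_on_arc_of
  by (cases c rule: cell_exhaust) (simp_all add: connected_continuous_image)

lemma property_S_cl_cell: "property_S (cl_cell c)"
proof -
  have "locally_connected_space (top_of_set (topspace (nsphere n)))"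
    using locally_connected_nsphere[of n] by (metis nsphere_top_of_set)
  then have "property_S (topspace (nsphere n))"
    using compact_nsphere by (intro compact_locally_connected_imp_property_S)
  moreover have "property_S {0..1::real}"
    by (intro compact_locally_connected_imp_property_S locally_path_connected_imp_locally_connected_space
        locally_path_connected_real_interval) simp
  ultimately show ?thesis
    using compact_nsphere[of n] continuous_on_sph continuous_on_arc_of
    by (cases c rule: cell_exhaust) (simp_all add: property_S_continuous_image)
qed

text \<open>A sphere is displaced from \<open>d k\<close> by at most 2 * \<open>scale c\<close> in
  each coordinate, which the metric doubles; passing through \<open>d k\<close> gives 8. An arc is
  within 2 * \<open>scale c\<close> of its segment.\<close>

lemma dist_cl_cell:
  assumes "x \<in> cl_cell c" "y \<in> cl_cell c"
  shows "c = Inl (k, l) \<Longrightarrow> dist x y \<le> 8 * scale c" "c = Inr (k', i, j) \<Longrightarrow> dist x y \<le> 8 * scale c + dist (d i) (d j)"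
proof -
  have near: "dist (\<lambda>a. b a + lift (scale c) v a) b \<le> 2 * (scale c * r)" if "\<And>i. \<bar>v i\<bar> \<le> r" for b v r
    by (rule dist_fun_le) (use abs_lift_le[OF that] in auto)
  show "dist x y \<le> 8 * scale c" if c: "c = Inl (k, l)"
  proof -
    have "dist z (d k) \<le> 4 * scale c" if z: "z \<in> cl_cell c" for z
    proof -
      obtain u where u: "u \<in> topspace (nsphere n)" "z = sph k l u" using z c by auto
      have "\<bar>u i - sphere_base i\<bar> \<le> 2" for i
        using nsphere_first_coordinate(1)[OF u(1), of i] by (auto simp: sphere_base_def)
      from near[OF this, of "d k"] show ?thesis by (simp add: u(2) sph_def c)
    qed
    from this[OF assms(1)] this[OF assms(2)] show ?thesis
      using dist_triangle2[of x y "d k"] by linarith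
  qed
  show "dist x y \<le> 8 * scale c + dist (d i) (d j)" if c: "c = Inr (k', i, j)"
  proof -
    have *: "\<exists>t\<in>{0..1}. dist z (seg i j t) \<le> 2 * scale c" if z: "z \<in> cl_cell c" for z
    proof -
      obtain t where t: "t \<in> {0..1}" "z = arc_of k' i j t" using z c by auto
      have "\<bar>t * (1 - t)\<bar> \<le> 1" using t(1) by (simp add: abs_mult mult_le_one)
      then have "\<bar>if b = 0 then t * (1 - t) else 0\<bar> \<le> 1" for b :: nat by simp
      from near[OF this, of "seg i j t"] show ?thesis using t(1) by (intro bexI[of _ t]) (simp_all add: t(2) arc_of_def c)
    qed
    obtain t t' where t: "t \<in> {0..1}" "dist x (seg i j t) \<le> 2 * scale c" "t' \<in> {0..1}" "dist y (seg i j t') \<le> 2 * scale c"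
      using *[OF assms(1)] *[OF assms(2)] by blast
    have "dist (seg i j t) (seg i j t') \<le> dist (d i) (d j)"
    proof (rule dist_fun_mono)
      fix a
      have "seg i j t a - seg i j t' a = (t' - t) * (d i a - d j a)" by (simp add: seg_def algebra_simps)
      moreover have "\<bar>t' - t\<bar> \<le> 1" using t by auto
      ultimately show "\<bar>seg i j t a - seg i j t' a\<bar> \<le> \<bar>d i a - d j a\<bar>"
        by (simp add: abs_mult mult_left_le_one_le)
    qed
    then show ?thesis
      using dist_triangle2[of x "seg i j t'" "seg i j t"] dist_triangle2[of x y "seg i j t'"] t scale(1)[of c]
      by (simp add: dist_commute)
  qed
qed

lemma null_family_cells: "null_family cells cl_cell"
  unfolding null_family_def
proof (intro allI impI)
  fix e :: real assume e: "0 < e"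
  \<comment> \<open>Half of e is left for 8 * \<open>scale c\<close>, the other half for ends at
    distance at most 4 * (1/2)^k; the exceptions have a large scale or a level up to N.\<close>
  obtain N where N: "(1/2::real)^N < e/8"
    using real_arch_pow_inv[of "e/8" "1/2"] e by auto
  let ?A = "{c. e/16 \<le> scale c} \<union> Inr ` (\<Union>k\<in>{..N}. \<Union>i\<in>{..m k}. \<Union>j\<in>{..m (Suc k)}. {(k, i, j)})"
  have "finite ?A" using finite_scale_ge[of "e/16"] e by auto
  moreover have "{c \<in> cells. \<not> (\<forall>x\<in>cl_cell c. \<forall>y\<in>cl_cell c. dist x y < e)} \<subseteq> ?A"
  proof (rule subsetI, rule ccontr)
    fix c assume c: "c \<in> {c \<in> cells. \<not> (\<forall>x\<in>cl_cell c. \<forall>y\<in>cl_cell c. dist x y < e)}" and A: "c \<notin> ?A"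
    then obtain x y where xy: "x \<in> cl_cell c" "y \<in> cl_cell c" "\<not> dist x y < e" by auto
    have s: "scale c < e/16" using A by auto
    have "c \<in> cells" using c by simp
    then show False
    proof (cases rule: cells_cases)
      case (sph k l)
      then show ?thesis using dist_cl_cell(1)[OF xy(1,2)] s xy(3) e by fastforce
    next
      case (arc k i j)
      then have "N < k" using A by (auto simp: not_le)
      then have "(1/2::real)^k \<le> (1/2)^N" by (intro power_decreasing) auto
      then have "dist x y < e"
        using dist_cl_cell(2)[OF xy(1,2) arc(1)] arc(5) s N by linarith
      then show ?thesis using xy(3) by simp
    qed
  qed
  ultimately show "finite {c \<in> cells. \<not> (\<forall>x\<in>cl_cell c. \<forall>y\<in>cl_cell c. dist x y < e)}"
    using finite_subset by blast
qed

lemma cl_cell_meets_D: "cl_cell c \<inter> D \<noteq> {}"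
  using cl_cell_Int_D ends_subset(3) by simp

lemma compact_sub: "J \<subseteq> cells \<Longrightarrow> compact (D \<union> (\<Union>c\<in>J. cl_cell c))"
  by (intro compact_null_family_Un compact_D null_family_subset[OF null_family_cells] cl_cell_meets_D compact_cl_cell)

lemma compact_X: "compact X"
  unfolding X_def by (rule compact_sub) simp

lemma D_subset_X: "D \<subseteq> X" and cl_cell_subset_X: "c \<in> cells \<Longrightarrow> cl_cell c \<subseteq> X"
  by (auto simp: X_def)

text \<open>\<open>D\<close> with all other cells is again compact, hence closed, and its complement
  in \<open>X\<close> is the open cell.\<close>

lemma openin_cell:
  assumes "c \<in> cells"
  shows "openin (top_of_set X) (cl_cell c - D)"
proof -
  let ?R = "D \<union> (\<Union>c'\<in>cells - {c}. cl_cell c')"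
  have "closed ?R" using compact_sub[of "cells - {c}"] compact_imp_closed by blast
  then have "openin (top_of_set X) (X \<inter> - ?R)" by (intro openin_open_Int open_Compl)
  moreover have "cl_cell c \<inter> cl_cell c' \<subseteq> D" if "c' \<in> cells - {c}" for c'
    using that cl_cell_Int[of c c'] by auto
  then have "X \<inter> - ?R = cl_cell c - D"
    using assms unfolding X_def by blast
  ultimately show ?thesis by simp
qed

text \<open>Only arcs are measured: the connecting sets built from here on consist of arcs and
  points of \<open>D\<close>, never of spheres.\<close>

definition fine_arcs :: "nat \<Rightarrow> real \<Rightarrow> bool" where
  "fine_arcs k e \<longleftrightarrow> (\<forall>k' i j. k \<le> k' \<longrightarrow> Inr (k', i, j) \<in> cells \<longrightarrow>
     (\<forall>x\<in>cl_cell (Inr (k', i, j)). \<forall>y\<in>cl_cell (Inr (k', i, j)). dist x y < e))"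

lemma fine_arcs_mono: "fine_arcs k e \<Longrightarrow> k \<le> l \<Longrightarrow> fine_arcs l e"
  by (simp add: fine_arcs_def)

text \<open>A point \<open>x \<in> D\<close> is the limit of its approximations in the nets, which are joined by arcs.\<close>

lemma link:
  assumes "i \<le> m k" "j \<le> m (Suc k)" "dist (d i) (d j) \<le> 4 * (1/2)^k"
    and small: "fine_arcs k e"
    and "0 < e"
  obtains A where "connected A" "A \<subseteq> X" "d i \<in> A" "d j \<in> A" "\<And>u. u \<in> A \<Longrightarrow> dist (d i) u < e"
\<comment> \<open>No arc is attached between equal points; the point itself serves.\<close>
proof (cases "d i = d j")
  case True
  then show thesis
    using that[of "{d i}"] d_in D_subset_X \<open>0 < e\<close> by auto
next
  case False
  then have c: "Inr (k, i, j) \<in> cells" using assms by (auto simp: cells_def)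
  have "d i \<in> cl_cell (Inr (k, i, j))" "d j \<in> cl_cell (Inr (k, i, j))"
    using ends_subset(2)[of "Inr (k, i, j)"] by simp_all
  then show thesis
    using that[OF connected_cl_cell cl_cell_subset_X[OF c]] small[unfolded fine_arcs_def, rule_format, OF order_refl c]
    by blast
qed

text \<open>The arcs from level k on form a connected chain whose closure contains x, and adding
  such a point keeps it connected. Every net point on the chain is within (1/2)^k of x.\<close>

lemma approach:
  assumes x: "x \<in> D" and "0 < e"
    and small: "fine_arcs k e"
  obtains A i where "connected A" "A \<subseteq> X" "x \<in> A" "i \<le> m k" "dist x (d i) \<le> (1/2)^k" "d i \<in> A"
    "\<And>u. u \<in> A \<Longrightarrow> dist x u < (1/2)^k + e"
proof -
  have "\<forall>l. \<exists>i. i \<le> m l \<and> dist x (d i) \<le> (1/2)^l" using net[OF x] by blast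
  then obtain p where p: "\<And>l. p l \<le> m l" "\<And>l. dist x (d (p l)) \<le> (1/2)^l" by metis
  have "\<exists>A. connected A \<and> A \<subseteq> X \<and> d (p (k + l)) \<in> A \<and> d (p (Suc (k + l))) \<in> A \<and> (\<forall>u\<in>A. dist (d (p (k + l))) u < e)" for l
  proof -
    have "dist (d (p (k + l))) (d (p (Suc (k + l)))) \<le> (1/2)^(k + l) + (1/2)^Suc (k + l)"
      using dist_triangle3[of "d (p (k + l))" "d (p (Suc (k + l)))" x] p(2)[of "k + l"] p(2)[of "Suc (k + l)"] by linarith
    also have "\<dots> \<le> 4 * (1/2)^(k + l)" by simp
    finally have le: "dist (d (p (k + l))) (d (p (Suc (k + l)))) \<le> 4 * (1/2)^(k + l)" .
    show ?thesis
      by (rule link[OF p(1) p(1) le fine_arcs_mono[OF small le_add1] \<open>0 < e\<close>]) blast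
  qed
  then obtain A where A: "\<And>l. connected (A l)" "\<And>l. A l \<subseteq> X" "\<And>l. d (p (k + l)) \<in> A l" "\<And>l. d (p (Suc (k + l))) \<in> A l"
    "\<And>l u. u \<in> A l \<Longrightarrow> dist (d (p (k + l))) u < e"
    by metis
  let ?B = "\<Union>l. A l"
  have "connected ?B"
    using A(1,3,4) by (intro connected_chain_UN[of A "\<lambda>l. d (p (k + l))"]) auto
  moreover have "x \<in> closure ?B"
    unfolding closure_approachable
  proof (intro allI impI)
    fix c :: real assume "0 < c"
    then obtain N where N: "(1/2::real)^N < c" using real_arch_pow_inv[of c "1/2"] by auto
    have "dist (d (p (k + N))) x \<le> (1/2)^(k + N)" using p(2) by (simp add: dist_commute)
    also have "\<dots> \<le> (1/2)^N" by (intro power_decreasing) auto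
    finally show "\<exists>y\<in>?B. dist y x < c" using N A(3)[of N] by (intro bexI[of _ "d (p (k + N))"]) auto
  qed
  ultimately have "connected (insert x ?B)"
    using connected_intermediate_closure[of ?B "insert x ?B"] closure_subset[of ?B] by blast
  moreover have "dist x u < (1/2)^k + e" if u: "u \<in> insert x ?B" for u
  proof (cases "u = x")
    case True
    then show ?thesis using \<open>0 < e\<close> by (simp add: add_pos_pos)
  next
    case False
    then obtain l where "u \<in> A l" using u by blast
    then have "dist (d (p (k + l))) u < e" by (rule A(5))
    moreover have "dist x (d (p (k + l))) \<le> (1/2)^k"
    proof -
      have "dist x (d (p (k + l))) \<le> (1/2)^(k + l)" by (rule p(2))
      also have "\<dots> \<le> (1/2)^k" by (intro power_decreasing) auto
      finally show ?thesis .
    qed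
    ultimately show ?thesis using dist_triangle[of x u "d (p (k + l))"] by linarith
  qed
  moreover have "insert x ?B \<subseteq> X" using A(2) x D_subset_X by blast
  moreover have "d (p k) \<in> insert x ?B" using A(3)[of 0] by auto
  ultimately show thesis
    using that[of "insert x ?B" "p k"] p[of k] by blast
qed

text \<open>Approaching x from level k and y from level \<open>Suc k\<close> puts the two ends in
  successive nets, where a single link joins them.\<close>

lemma join:
  assumes x: "x \<in> D" "y \<in> D" "dist x y \<le> 2 * (1/2)^k" and "0 < e"
    and small: "fine_arcs k e"
  obtains Q where "connected Q" "Q \<subseteq> X" "x \<in> Q" "y \<in> Q" "\<And>u. u \<in> Q \<Longrightarrow> dist x u < 4 * (1/2)^k + e"
proof -
  obtain A i where A: "connected A" "A \<subseteq> X" "x \<in> A" "i \<le> m k" "dist x (d i) \<le> (1/2)^k" "d i \<in> A"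
    "\<And>u. u \<in> A \<Longrightarrow> dist x u < (1/2)^k + e"
    using approach[OF x(1) \<open>0 < e\<close> small] by blast
  obtain B j where B: "connected B" "B \<subseteq> X" "y \<in> B" "j \<le> m (Suc k)" "dist y (d j) \<le> (1/2)^Suc k" "d j \<in> B"
    "\<And>u. u \<in> B \<Longrightarrow> dist y u < (1/2)^Suc k + e"
    using approach[OF x(2) \<open>0 < e\<close> fine_arcs_mono[OF small, of "Suc k"]] le_SucI[OF order_refl] by blast
  have half: "(1/2::real)^Suc k = (1/2)^k / 2" by simp
  have pos: "0 < (1/2::real)^k" by simp
  have le: "dist (d i) (d j) \<le> 4 * (1/2)^k"
    using dist_triangle3[of "d i" "d j" x] dist_triangle[of x "d j" y] A(5) B(5) x(3) half pos by linarith
  obtain L where L: "connected L" "L \<subseteq> X" "d i \<in> L" "d j \<in> L" "\<And>u. u \<in> L \<Longrightarrow> dist (d i) u < e"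
    using link[OF A(4) B(4) le small \<open>0 < e\<close>] by blast
  have "connected (A \<union> L \<union> B)"
    using A(1,6) L(1,3,4) B(1,6) by (intro connected_Un) auto
  moreover have "dist x u < 4 * (1/2)^k + e" if u: "u \<in> A \<union> L \<union> B" for u
  proof -
    consider "u \<in> A" | "u \<in> L" | "u \<in> B" using u by blast
    then show ?thesis
    proof cases
      case 1
      then show ?thesis using A(7)[of u] pos by linarith
    next
      case 2
      then show ?thesis using L(5)[of u] A(5) dist_triangle[of x u "d i"] pos by linarith
    next
      case 3
      then show ?thesis using B(7)[of u] x(3) dist_triangle[of x u y] half pos by linarith
    qed
  qed
  ultimately show thesis
    using that[of "A \<union> L \<union> B"] A(2,3) L(2) B(2,3) by blast
qed

lemma property_S_X: "property_S X"
  unfolding X_def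
proof (rule property_S_null_family_Un[OF compact_D null_family_cells cl_cell_meets_D connected_cl_cell property_S_cl_cell])
  fix e :: real assume e: "0 < e"
  define E where "E = {c \<in> cells. \<not> (\<forall>x\<in>cl_cell c. \<forall>y\<in>cl_cell c. dist x y < e/8)}"
  have "finite E" unfolding E_def using null_familyD[OF null_family_cells, of "e/8"] e by simp
  \<comment> \<open>The shift by one makes a bound on \<open>lev\<close> exceed the levels of the
    large arcs strictly; spheres get the neutral value 0.\<close>
  define lev :: "cell \<Rightarrow> nat" where "lev c = (case c of Inl _ \<Rightarrow> 0 | Inr (k, _) \<Rightarrow> Suc k)" for c
  have "finite (lev ` E)" using \<open>finite E\<close> by (rule finite_imageI)
  then obtain k0 where k0: "\<And>k. k \<in> lev ` E \<Longrightarrow> k \<le> k0"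
    unfolding finite_nat_set_iff_bounded_le by blast
  \<comment> \<open>This makes 4 * (1/2)^k + e/8 less than e/4, so two points of Q are closer than
    e/2.\<close>
  obtain N where N: "(1/2::real)^N < e/32" using real_arch_pow_inv[of "e/32" "1/2"] e by auto
  define k where "k = max k0 N"
  have small': "dist x y < e/8"
    if "k \<le> k'" "Inr (k', i, j) \<in> cells" "x \<in> cl_cell (Inr (k', i, j))" "y \<in> cl_cell (Inr (k', i, j))" for k' i j x y
  proof -
    have "Inr (k', i, j) \<notin> E"
    proof
      assume "Inr (k', i, j) \<in> E"
      then have "Suc k' \<le> k0" by (intro k0 image_eqI[of _ _ "Inr (k', i, j)"]) (simp_all add: lev_def)
      then show False using that(1) by (simp add: k_def)
    qed
    then show ?thesis using that(2-4) unfolding E_def by blast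
  qed
  have e8: "0 < e/8" using e by simp
  have small: "fine_arcs k (e/8)" unfolding fine_arcs_def using small' by blast
  have "(1/2::real)^k \<le> (1/2)^N" by (intro power_decreasing) (auto simp: k_def)
  then have kN: "(1/2::real)^k < e/32" using N by linarith
  show "\<exists>\<delta>>0. \<forall>x\<in>D. \<forall>y\<in>D. dist x y < \<delta> \<longrightarrow>
      (\<exists>Q\<subseteq>D \<union> (\<Union>c\<in>cells. cl_cell c). connected Q \<and> x \<in> Q \<and> y \<in> Q \<and> (\<forall>u\<in>Q. \<forall>v\<in>Q. dist u v < e))"
  proof (intro exI[of _ "2 * (1/2)^k"] conjI ballI impI)
    fix x y assume xy: "x \<in> D" "y \<in> D" "dist x y < 2 * (1/2)^k"
    obtain Q where Q: "connected Q" "Q \<subseteq> X" "x \<in> Q" "y \<in> Q" "\<And>u. u \<in> Q \<Longrightarrow> dist x u < 4 * (1/2)^k + e/8"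
      using join[OF xy(1,2) less_imp_le[OF xy(3)] e8 small] by blast
    have "dist u v < e" if "u \<in> Q" "v \<in> Q" for u v
      using Q(5)[OF that(1)] Q(5)[OF that(2)] dist_triangle3[of u v x] kN e by linarith
    then show "\<exists>Q\<subseteq>D \<union> (\<Union>c\<in>cells. cl_cell c). connected Q \<and> x \<in> Q \<and> y \<in> Q \<and> (\<forall>u\<in>Q. \<forall>v\<in>Q. dist u v < e)"
      using Q by (intro exI[of _ Q]) (auto simp: X_def)
  qed simp
qed

text \<open>The metric is bounded by 2, so \<open>join\<close> at level 0 already reaches from
  \<open>d 0\<close> to every point of \<open>D\<close>.\<close>

lemma connected_X: "connected X"
  unfolding X_def
proof (rule connected_null_family_Un[OF d_in[of 0] cl_cell_meets_D connected_cl_cell])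
  fix y assume y: "y \<in> D"
  have le: "dist (d 0) y \<le> 2 * (1/2)^0" using dist_fun_le_2 by simp
  have "dist x y < 3" for x y :: "nat \<Rightarrow> real" using dist_fun_le_2[of x y] by linarith
  then have "fine_arcs 0 3" by (simp add: fine_arcs_def)
  from join[OF d_in[of 0] y le _ this]
  show "\<exists>Q\<subseteq>D \<union> (\<Union>c\<in>cells. cl_cell c). connected Q \<and> d 0 \<in> Q \<and> y \<in> Q"
    unfolding X_def by (metis zero_less_numeral)
qed

lemma peano_continuum_X: "peano_continuum (top_of_set X)"
  unfolding peano_continuum_def
proof (intro conjI)
  show "compact_space (top_of_set X)" using compact_X by (simp add: compact_space_subtopology)
  have "connectedin euclidean X" using connected_X by simp
  then show "connected_space (top_of_set X)" by (simp only: connectedin_def)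
  show "locally_connected_space (top_of_set X)" by (rule property_S_imp_locally_connected[OF property_S_X])
  show "metrizable_space (top_of_set X)" by (intro metrizable_space_subtopology metrizable_space_euclidean)
qed

subsection \<open>Its cells, wild set and dimension\<close>

definition cell_dim :: "cell \<Rightarrow> nat" where
  "cell_dim c = (case c of Inl _ \<Rightarrow> n | Inr _ \<Rightarrow> 1)"

lemma cell_dim_simps: "cell_dim (Inl p) = n" "cell_dim (Inr q) = 1"
  by (simp_all add: cell_dim_def)

lemma homeomorphic_cell:
  assumes c: "c \<in> cells"
  shows "top_of_set (cl_cell c - D) homeomorphic_space Euclidean_space (cell_dim c)"
  using c
proof (cases rule: cells_cases)
  case (sph k l)
  have img: "cl_cell c - D = sph k l ` (topspace (nsphere n) - {sphere_base})"
  proof -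
    have "cl_cell c - D = cl_cell c - ends c" using cl_cell_Int_D[of c] by blast
    also have "\<dots> = sph k l ` topspace (nsphere n) - sph k l ` {sphere_base}"
      by (simp add: sph sph_base)
    also have "\<dots> = sph k l ` (topspace (nsphere n) - {sphere_base})"
      by (rule inj_on_image_set_diff[OF inj_on_sph, symmetric]) (use sphere_base_in_nsphere in auto)
    finally show ?thesis .
  qed
  have "homeomorphic_map (nsphere n) (top_of_set (sph k l ` topspace (nsphere n))) (sph k l)"
    using compact_embedding[OF compact_nsphere continuous_on_sph inj_on_sph, of k l]
    unfolding embedding_map_def by (metis nsphere_top_of_set topspace_euclidean_subtopology)
  then have "homeomorphic_map (subtopology (nsphere n) (- {sphere_base}))
      (subtopology (top_of_set (sph k l ` topspace (nsphere n))) (cl_cell c - D)) (sph k l)"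
    by (rule homeomorphic_map_subtopologies) (use img sphere_base_in_nsphere in \<open>auto simp: sph\<close>)
  moreover have "subtopology (top_of_set (sph k l ` topspace (nsphere n))) (cl_cell c - D) = top_of_set (cl_cell c - D)"
    by (simp add: subtopology_subtopology img Int_absorb1 image_mono)
  ultimately have "subtopology (nsphere n) (- {sphere_base}) homeomorphic_space top_of_set (cl_cell c - D)"
    using homeomorphic_space by metis
  moreover have "subtopology (nsphere n) (- {sphere_base}) homeomorphic_space Euclidean_space n"
    using homeomorphic_maps_stereo[of n] unfolding homeomorphic_space_def by blast
  ultimately show ?thesis
    using homeomorphic_space_sym homeomorphic_space_trans by (metis cell_dim_simps(1) sph)
next
  case (arc k i j)
  have inj: "inj_on (arc_of k i j) {0..1}" by (rule inj_on_arc_of[OF arc(4)])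
  have img: "cl_cell c - D = arc_of k i j ` {0<..<1}"
  proof -
    have "cl_cell c - D = cl_cell c - ends c" using cl_cell_Int_D[of c] by blast
    also have "\<dots> = arc_of k i j ` {0..1} - arc_of k i j ` {0, 1}"
      by (simp add: arc arc_of_ends)
    also have "\<dots> = arc_of k i j ` ({0..1} - {0, 1})"
      by (rule inj_on_image_set_diff[OF inj, symmetric]) auto
    also have "{0..1} - {0, 1} = {0<..<1::real}" by auto
    finally show ?thesis .
  qed
  have "homeomorphic_map (top_of_set {0..1}) (top_of_set (arc_of k i j ` {0..1})) (arc_of k i j)"
    using compact_embedding[OF _ continuous_on_arc_of inj] unfolding embedding_map_def by simp
  then have "homeomorphic_map (subtopology (top_of_set {0..1}) {0<..<1})
      (subtopology (top_of_set (arc_of k i j ` {0..1})) (cl_cell c - D)) (arc_of k i j)"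
    by (rule homeomorphic_map_subtopologies) (use img in auto)
  moreover have "subtopology (top_of_set (arc_of k i j ` {0..1})) (cl_cell c - D) = top_of_set (cl_cell c - D)"
    "subtopology (top_of_set {0..1}) {0<..<1::real} = top_of_set {0<..<1}"
    by (auto simp: subtopology_subtopology img Int_absorb1 image_mono greaterThanLessThan_subseteq_atLeastAtMost_iff)
  ultimately have "top_of_set {0<..<1::real} homeomorphic_space top_of_set (cl_cell c - D)"
    using homeomorphic_space by metis
  then show ?thesis
    using Euclidean_space_1_homeomorphic_interval homeomorphic_space_sym homeomorphic_space_trans by (metis cell_dim_simps(2) arc(1))
qed

lemma countable_union_of_cells_X: "countable_union_of_cells {1, n} (top_of_set (X - D))"
proof -
  have "top_of_set (X - D) homeomorphic_space sum_topology (\<lambda>k. Euclidean_space (cell_dim (from_nat k))) (to_nat ` cells)"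
  proof (rule homeomorphic_space_sum_topology[where G = "\<lambda>c. cl_cell c - D"])
    fix c assume c: "c \<in> cells"
    have sub: "cl_cell c - D \<subseteq> X - D" using cl_cell_subset_X[OF c] by blast
    show "openin (top_of_set (X - D)) (cl_cell c - D)"
      using openin_subset_trans[OF openin_cell[OF c] sub] by blast
    show "subtopology (top_of_set (X - D)) (cl_cell c - D) homeomorphic_space Euclidean_space (cell_dim c)"
      using homeomorphic_cell[OF c] sub by (simp add: subtopology_subtopology Int_absorb1)
  next
    show "(cl_cell c - D) \<inter> (cl_cell c' - D) = {}" if "c \<noteq> c'" for c c'
      using cl_cell_Int[OF that] by blast
    show "(\<Union>c\<in>cells. cl_cell c - D) = topspace (top_of_set (X - D))"
      by (auto simp: X_def)
  qed
  moreover have "cell_dim c \<in> {1, n}" for c by (auto simp: cell_dim_def split: sum.split)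
  ultimately show ?thesis
    unfolding countable_union_of_cells_def by (intro exI conjI ballI)
qed

text \<open>An open cell is an open contractible neighbourhood of each of its points.\<close>

lemma wild_set_subset: "wild_set n (top_of_set X) \<subseteq> D"
proof
  fix x assume x: "x \<in> wild_set n (top_of_set X)"
  then have w: "wild_point n (top_of_set X) x" and xX: "x \<in> X" by (auto simp: wild_set_def wild_point_def)
  show "x \<in> D"
  proof (rule ccontr)
    assume "x \<notin> D"
    then obtain c where c: "c \<in> cells" "x \<in> cl_cell c - D" using xX by (auto simp: X_def)
    have "subtopology (top_of_set X) (cl_cell c - D) = top_of_set (cl_cell c - D)"
      using Int_absorb1[of "cl_cell c - D" X] cl_cell_subset_X[OF c(1)] by (simp add: subtopology_subtopology le_infI1 subset_iff)
    then have "contractible_space (subtopology (top_of_set X) (cl_cell c - D))"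
      using homeomorphic_cell[OF c(1)] homeomorphic_space_contractibility contractible_Euclidean_space by metis
    then show False
      using not_wild_point_in_contractible[OF openin_cell[OF c(1)] _ c(2)] w by blast
  qed
qed

lemma essential_sph: "essential n (top_of_set X) (sph k l)"
proof (rule essential_if_left_inverse)
  let ?c = "Inl (k, l) :: cell"
  have c: "?c \<in> cells" by (auto simp: cells_def)
  show "continuous_map (nsphere n) (top_of_set X) (sph k l)"
    using continuous_on_sph cl_cell_subset_X[OF c] by (subst nsphere_top_of_set) auto
  \<comment> \<open>Everything outside the sphere is collapsed to the basepoint. On \<open>D\<close>
    the coordinates up to n vanish, so the formula gives \<open>sphere_base\<close> there and the
    two closed parts fit.\<close>
  define r where "r x = (if x \<in> cl_cell ?c then (\<lambda>j. if j \<le> n then x j / scale ?c + sphere_base j else 0) else sphere_base)"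
    for x :: "nat \<Rightarrow> real"
  have rs: "r (sph k l u) = u" if "u \<in> topspace (nsphere n)" for u
    using that sph_left_inverse[OF that, of k l] by (simp add: r_def)
  then show "r (sph k l u) = u" if "u \<in> topspace (nsphere n)" for u using that .
  let ?R = "D \<union> (\<Union>c\<in>cells - {?c}. cl_cell c)"
  have XR: "X = cl_cell ?c \<union> ?R" using c by (auto simp: X_def)
  have "continuous_on (cl_cell ?c \<union> ?R) r"
    unfolding r_def
  proof (rule continuous_on_cases)
    show "closed (cl_cell ?c)" using compact_cl_cell compact_imp_closed by blast
    show "closed ?R" using compact_sub[of "cells - {?c}"] compact_imp_closed by blast
    show "continuous_on (cl_cell ?c) (\<lambda>x j. if j \<le> n then x j / scale ?c + sphere_base j else 0)"
    proof (rule continuous_on_coordinatewise_then_product)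
      show "continuous_on (cl_cell ?c) (\<lambda>x. if j \<le> n then x j / scale ?c + sphere_base j else 0)" for j
        unfolding divide_inverse by (cases "j \<le> n") (auto intro!: continuous_intros)
    qed
    have "(\<lambda>j. if j \<le> n then x j / scale ?c + sphere_base j else 0) = sphere_base" if "x \<in> D" for x
      using D_zero[OF that] by (auto simp: fun_eq_iff sphere_base_def)
    moreover have "cl_cell ?c \<inter> cl_cell c' \<subseteq> D" if "c' \<in> cells - {?c}" for c'
      using that cl_cell_Int[of ?c c'] by auto
    then have "cl_cell ?c \<inter> ?R \<subseteq> D" by blast
    ultimately show "\<forall>x. x \<in> cl_cell ?c \<and> x \<notin> cl_cell ?c \<or> x \<in> ?R \<and> x \<in> cl_cell ?c \<longrightarrow>
        (\<lambda>j. if j \<le> n then x j / scale ?c + sphere_base j else 0) = sphere_base"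
      by blast
  qed auto
  moreover have "r x \<in> topspace (nsphere n)" for x
  proof (cases "x \<in> cl_cell ?c")
    case True
    then obtain u where "u \<in> topspace (nsphere n)" "x = sph k l u" by auto
    then show ?thesis using rs by simp
  next
    case False
    then show ?thesis using sphere_base_in_nsphere by (simp add: r_def)
  qed
  ultimately show "continuous_map (top_of_set X) (nsphere n) r"
    by (subst nsphere_top_of_set) (auto simp: XR)
qed

lemma D_subset_wild_set: "D \<subseteq> wild_set n (top_of_set X)"
proof -
  have wild: "wild_point n (top_of_set X) (d k)" for k
  proof (rule wild_pointI[where g = "\<lambda>l. sph k l"])
    show "d k \<in> topspace (top_of_set X)" using d_in D_subset_X by auto
    show "essential n (top_of_set X) (sph k l)" for l by (rule essential_sph)
    show "sph k l sphere_base = d k" for l by (rule sph_base)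
    fix U assume U: "openin (top_of_set X) U" "d k \<in> U"
    then obtain e where e: "0 < e" "ball (d k) e \<inter> X \<subseteq> U" by (meson openin_contains_ball)
    let ?E = "{c \<in> cells. \<not> (\<forall>x\<in>cl_cell c. \<forall>y\<in>cl_cell c. dist x y < e)}"
    have "sph k l ` topspace (nsphere n) \<subseteq> U" if "Inl (k, l) \<notin> ?E" for l
    proof -
      have c: "Inl (k, l) \<in> cells" by (auto simp: cells_def)
      have "d k \<in> cl_cell (Inl (k, l))" using ends_subset(2)[of "Inl (k, l)"] by simp
      then have "cl_cell (Inl (k, l)) \<subseteq> ball (d k) e" using that c by auto
      then show ?thesis using e(2) cl_cell_subset_X[OF c] by auto
    qed
    then have "{l. \<not> sph k l ` topspace (nsphere n) \<subseteq> U} \<subseteq> (\<lambda>l. Inl (k, l)) -` ?E" by blast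
    moreover have "finite ((\<lambda>l. Inl (k, l)) -` ?E)"
      using null_familyD[OF null_family_cells e(1)] by (intro finite_vimageI) (auto simp: inj_def)
    ultimately show "finite {l. \<not> sph k l ` topspace (nsphere n) \<subseteq> U}" using finite_subset by blast
  qed
  have closed: "closedin (top_of_set X) (wild_set n (top_of_set X))"
    using peano_continuum_imp_locally_path_connected[OF peano_continuum_X] peano_continuum_X
    by (intro closedin_wild_set) (auto simp: peano_continuum_def)
  show ?thesis
  proof (rule subsetI, rule ccontr)
    fix x assume x: "x \<in> D" "x \<notin> wild_set n (top_of_set X)"
    have "openin (top_of_set X) (X - wild_set n (top_of_set X))"
      using openin_diff[OF openin_topspace closed] by simp
    moreover have "x \<in> X - wild_set n (top_of_set X)" using x D_subset_X by blast
    ultimately obtain e where e: "0 < e" "ball x e \<inter> X \<subseteq> X - wild_set n (top_of_set X)"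
      by (meson openin_contains_ball)
    obtain N where N: "(1/2::real)^N < e" using real_arch_pow_inv[of e "1/2"] e(1) by auto
    obtain i where "dist x (d i) \<le> (1/2)^N" using net[OF x(1)] by blast
    then have "d i \<in> ball x e \<inter> X" using N d_in[of i] D_subset_X by auto
    then have "d i \<notin> wild_set n (top_of_set X)" using e(2) by blast
    then show False using wild[of i] by (simp add: wild_set_def)
  qed
qed

lemma covering_dim_le_cl_cell:
  assumes "c \<in> cells" "int n \<le> q"
  shows "covering_dim_le (top_of_set (cl_cell c)) q"
  using assms(1)
proof (cases rule: cells_cases)
  case (sph k l)
  have "covering_dim_le (top_of_set (topspace (nsphere n))) (int n)"
    using covering_dim_le_nsphere[of n] by (metis nsphere_top_of_set)
  then have "covering_dim_le (top_of_set (cl_cell c)) (int n)"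
    using covering_dim_le_compact_image[OF compact_nsphere continuous_on_sph inj_on_sph, of k l "int n"]
    by (simp add: sph)
  then show ?thesis using assms(2) by (rule covering_dim_le_mono)
next
  case (arc k i j)
  have "covering_dim_le (top_of_set (cl_cell c)) (int n)"
    using covering_dim_le_compact_image[of "{0..1}" "arc_of k i j" "int n",
        OF compact_Icc continuous_on_arc_of inj_on_arc_of[OF arc(4)]]
      covering_dim_le_unit_interval[OF n]
    by (simp add: arc)
  then show ?thesis using assms(2) by (rule covering_dim_le_mono)
qed

lemma covering_dim_le_X:
  assumes q: "-1 \<le> q"
  shows "covering_dim_le (top_of_set X) q \<longleftrightarrow> covering_dim_le (top_of_set D) q \<and> int n \<le> q"
proof
  assume L: "covering_dim_le (top_of_set X) q"
  have "covering_dim_le (top_of_set D) q"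
    using covering_dim_le_closed_subset[OF compact_imp_closed[OF compact_D] D_subset_X L] .
  moreover have "int n \<le> q"
  proof -
    \<comment> \<open>One sphere, closed in \<open>X\<close>, already forces the bound n.\<close>
    let ?c = "Inl (0, 0) :: cell"
    have "?c \<in> cells" by (auto simp: cells_def)
    then have "covering_dim_le (top_of_set (cl_cell ?c)) q"
      using covering_dim_le_closed_subset[OF compact_imp_closed[OF compact_cl_cell] cl_cell_subset_X L] by blast
    then have "covering_dim_le (top_of_set (topspace (nsphere n))) q"
      using covering_dim_le_compact_image[OF compact_nsphere continuous_on_sph inj_on_sph, of 0 0 q] by simp
    then have "covering_dim_le (nsphere n) q" by (metis nsphere_top_of_set)
    then show ?thesis using q by (rule covering_dim_le_nsphere_imp)
  qed
  ultimately show "covering_dim_le (top_of_set D) q \<and> int n \<le> q" ..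
next
  assume R: "covering_dim_le (top_of_set D) q \<and> int n \<le> q"
  have "refinable (nat (q + 1)) X \<U>" if U: "\<And>U. U \<in> \<U> \<Longrightarrow> open U" "X \<subseteq> \<Union>\<U>" for \<U>
    unfolding X_def
  proof (rule refinable_null_family_Un[OF compact_D null_family_cells cl_cell_meets_D compact_cl_cell])
    show "finite (cl_cell c \<inter> D)" for c by (simp add: cl_cell_Int_D ends_subset(4))
    show "cl_cell c \<inter> cl_cell c' \<subseteq> D" if "c \<noteq> c'" for c c' using cl_cell_Int[OF that] .
    show "refinable (nat (q + 1)) D \<U>'" if "\<And>U. U \<in> \<U>' \<Longrightarrow> open U" "D \<subseteq> \<Union>\<U>'" for \<U>'
      using R covering_dim_le_iff_refinable[OF q, of D] that by blast
    show "refinable (nat (q + 1)) (cl_cell c) \<U>'"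
      if "c \<in> cells" "\<And>U. U \<in> \<U>' \<Longrightarrow> open U" "cl_cell c \<subseteq> \<Union>\<U>'" for c \<U>'
      using covering_dim_le_cl_cell[OF that(1), of q] R covering_dim_le_iff_refinable[OF q, of "cl_cell c"] that(2,3) by blast
    show "open U" if "U \<in> \<U>" for U using U(1)[OF that] .
    show "D \<union> (\<Union>c\<in>cells. cl_cell c) \<subseteq> \<Union>\<U>" using U(2) by (simp add: X_def)
  qed
  then show "covering_dim_le (top_of_set X) q"
    unfolding covering_dim_le_iff_refinable[OF q] by blast
qed

end

section \<open>Nets in C and the theorem\<close>

text \<open>One enumeration of the union of finite (1/2)^k-nets serves all levels, and
  \<open>m k\<close> bounds the chosen indices of the k-th net. For finite \<open>E\<close> the
  enumeration repeats points.\<close>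

lemma earring_complex_exists:
  fixes D :: "(nat \<Rightarrow> real) set"
  assumes "1 \<le> n" "compact D" "D \<noteq> {}" "\<And>x j. x \<in> D \<Longrightarrow> j \<le> Suc n \<Longrightarrow> x j = 0"
  obtains d m where "earring_complex n D d m"
proof -
  have "\<exists>T. finite T \<and> T \<subseteq> D \<and> D \<subseteq> (\<Union>t\<in>T. ball t ((1/2)^k))" for k :: nat
  proof -
    have "D \<subseteq> (\<Union>t\<in>D. ball t ((1/2)^k))" by auto
    then obtain T where "T \<subseteq> D" "finite T" "D \<subseteq> (\<Union>t\<in>T. ball t ((1/2)^k))"
      using compactE_image[OF assms(2), of D "\<lambda>t. ball t ((1/2)^k)"] by blast
    then show ?thesis by blast
  qed
  then obtain T where T: "\<And>k. finite (T k)" "\<And>k. T k \<subseteq> D" "\<And>k. D \<subseteq> (\<Union>t\<in>T k. ball t ((1/2)^k))"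
    by metis
  define E where "E = (\<Union>k. T k)"
  have E: "countable E" "E \<subseteq> D" using T(1,2) by (auto simp: E_def intro: countable_finite)
  have "E \<noteq> {}" using T(3)[of 0] assms(3) by (auto simp: E_def)
  define d where "d = from_nat_into E"
  have dE: "d k \<in> E" for k unfolding d_def using \<open>E \<noteq> {}\<close> by (rule from_nat_into)
  have "\<exists>i. d i = t" if "t \<in> E" for t using E(1) that unfolding d_def by (metis from_nat_into_surj)
  then obtain ix where ix: "\<And>t. t \<in> E \<Longrightarrow> d (ix t) = t" by metis
  define m where "m k = Max (insert 0 (ix ` T k))" for k
  have "earring_complex n D d m"
  proof
    show "d k \<in> D" for k using dE E(2) by blast
    fix k x assume "x \<in> D"
    then obtain t where t: "t \<in> T k" "dist t x < (1/2)^k" using T(3)[of k] by auto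
    then have "ix t \<le> m k" unfolding m_def using T(1) by (intro Max_ge) auto
    moreover have "d (ix t) = t" using ix t(1) by (auto simp: E_def)
    ultimately show "\<exists>i\<le>m k. dist x (d i) \<le> (1/2)^k"
      using t(2) by (intro exI[of _ "ix t"]) (simp add: dist_commute)
  qed (use assms in auto)
  then show thesis by (rule that)
qed

(* X in the second part lives on nat => real: a Peano continuum embeds in the Hilbert cube, so
   this type is no restriction. The equation w_n(X) = C is up to the embedding e of C in X. *)
theorem theorem1p2:
  fixes n :: nat
  assumes "n \<ge> 1"
  shows "(\<forall>X :: 'a topology. peano_continuum X \<longrightarrow>
            compact_space (subtopology X (wild_set n X)) \<and>
            metrizable_space (subtopology X (wild_set n X))) \<and>
         (\<forall>C :: 'b topology. compact_space C \<and> metrizable_space C \<and> topspace C \<noteq> {} \<longrightarrow>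
            (\<exists>(X :: (nat \<Rightarrow> real) topology) e.
               peano_continuum X \<and> embedding_map C X e \<and>
               wild_set n X = e ` topspace C \<and>
               countable_union_of_cells {1, n} (subtopology X (topspace X - e ` topspace C)) \<and>
               covering_dim X = max (covering_dim C) (ereal (real n))))"
proof (intro conjI allI impI)
  fix X :: "'a topology" assume X: "peano_continuum X"
  then have "compact_space X" "metrizable_space X" by (auto simp: peano_continuum_def)
  moreover have "closedin X (wild_set n X)"
    using peano_continuum_imp_locally_path_connected[OF X] calculation(2) by (rule closedin_wild_set)
  ultimately show "compact_space (subtopology X (wild_set n X))"
    "metrizable_space (subtopology X (wild_set n X))"
    by (auto intro: compact_space_subtopology closedin_compact_space metrizable_space_subtopology)
next
  fix C :: "'b topology" assume "compact_space C \<and> metrizable_space C \<and> topspace C \<noteq> {}"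
  then have C: "compact_space C" "metrizable_space C" "topspace C \<noteq> {}" by auto
  obtain e0 :: "'b \<Rightarrow> nat \<Rightarrow> real" where e0: "embedding_map C euclidean e0"
    using compact_metrizable_embedding[OF C(1,2)] by blast
  have e0c: "continuous_map C euclidean e0" and e0i: "inj_on e0 (topspace C)"
    using e0 unfolding embedding_map_def
    by (meson continuous_map_into_fulltopology homeomorphic_imp_continuous_map homeomorphic_imp_injective_map)+
  \<comment> \<open>Shifting by n + 2 frees the coordinates 0, ..., \<open>Suc n\<close> for the
    cells.\<close>
  define e where "e = (\<lambda>c j. if j \<le> Suc n then 0 else e0 c (j - (n + 2)))"
  have "continuous_map C euclideanreal (\<lambda>c. e0 c i)" for i
    using e0c by (simp add: continuous_map_componentwise_UNIV flip: euclidean_product_topology)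
  then have "continuous_map C euclideanreal (\<lambda>c. e c j)" for j
    unfolding e_def by (cases "j \<le> Suc n") simp_all
  then have ec: "continuous_map C euclidean e"
    by (simp add: continuous_map_componentwise_UNIV flip: euclidean_product_topology)
  have ei: "inj_on e (topspace C)"
  proof (rule inj_onI)
    fix x y assume xy: "x \<in> topspace C" "y \<in> topspace C" "e x = e y"
    have "e0 x i = e0 y i" for i
      using fun_cong[OF xy(3), of "i + (n + 2)"] by (simp add: e_def)
    then show "x = y" using e0i xy(1,2) by (auto dest: inj_onD)
  qed
  have emb: "embedding_map C euclidean e"
    using continuous_imp_closed_map[OF ec C(1) Hausdorff_space_euclidean] ec ei
    by (simp add: injective_closed_imp_embedding_map)
  define D where "D = e ` topspace C"
  have "compactin euclidean D"
    unfolding D_def using C(1) ec by (meson compact_space_def image_compactin)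
  then have "compact D" by simp
  moreover have "D \<noteq> {}" using C(3) by (simp add: D_def)
  moreover have "x j = 0" if "x \<in> D" "j \<le> Suc n" for x j
    using that by (auto simp: D_def e_def)
  ultimately obtain d m where "earring_complex n D d m"
    using earring_complex_exists[OF assms] by metis
  then interpret earring_complex n D d m .
  have CD: "C homeomorphic_space top_of_set D"
    using embedding_map_imp_homeomorphic_space[OF emb] by (simp add: D_def)
  show "\<exists>(X :: (nat \<Rightarrow> real) topology) e. peano_continuum X \<and> embedding_map C X e \<and>
      wild_set n X = e ` topspace C \<and>
      countable_union_of_cells {1, n} (subtopology X (topspace X - e ` topspace C)) \<and>
      covering_dim X = max (covering_dim C) (ereal (real n))"
  proof (intro exI[of _ "top_of_set X"] exI[of _ e] conjI)
    show "peano_continuum (top_of_set X)" by (rule peano_continuum_X)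
    show "embedding_map C (top_of_set X) e"
      using emb D_subset_X by (simp add: embedding_map_in_subtopology D_def)
    show "wild_set n (top_of_set X) = e ` topspace C"
      using wild_set_subset D_subset_wild_set by (simp add: D_def)
    have "subtopology (top_of_set X) (topspace (top_of_set X) - e ` topspace C) = top_of_set (X - D)"
      by (simp add: subtopology_subtopology D_def Int_absorb1)
    then show "countable_union_of_cells {1, n} (subtopology (top_of_set X) (topspace (top_of_set X) - e ` topspace C))"
      using countable_union_of_cells_X by simp
    show "covering_dim (top_of_set X) = max (covering_dim C) (ereal (real n))"
      using covering_dim_le_X covering_dim_le_homeomorphic[OF CD] by (intro covering_dim_eq_max) simp
  qed
qed

end
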